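(* Let $X$ be a CHLOTS and let $\Omega$ be the first uncountable ordinal. For $(\alpha,\beta),(\alpha',\beta')\in\Omega\times\Omega$ with $\beta,\beta'$ positive, if $(\alpha',\beta')>(\alpha,\beta)$ in the lexicographic order on $\Omega\times\Omega$, then $(a_{\alpha'}(X))_{\beta'}$ is bigger than $(a_{\alpha}(X))_{\beta}$.
   Context: A LOTS is a totally ordered set with the order topology; it is complete if every nonempty bounded subset has a supremum and infimum. A HLOTS is a LOTS with at least three points which is order isomorphic to every nonempty open convex subset of itself; a CHLOTS is a complete HLOTS. The completion of an order dense LOTS $Y$ is the (essentially unique) complete order dense LOTS containing $Y$ as a dense subset and having a max (resp. min) iff $Y$ does. An order map is a (not necessarily continuous) map with $a\le b\Rightarrow f(a)\le f(b)$. $Y_1$ is bigger than $Y$ if there is an injective order map $Y\to Y_1$ but no injective order map $Y_1\to Y$. For a CHLOTS $F$ and a positive ordinal $\delta$: fix a closed bounded interval $J=[-1,+1]\subset F$ with $-1<+1$, and let $F_\delta=\{x:\delta\to F \mid x(i)\in J\text{ for }0<i<\delta\}$ with the lexicographic order (independent of $J$ up to isomorphism). Order tree $T(F)$ of a CHLOTS $F$: let $\bullet F\bullet=\{m\}+F+\{M\}$ be $F$ with a minimum $m$ and a maximum $M$ adjoined. For an ordinal $\gamma$ and $p:\gamma\to F$ put $\hat p(0)=m$, $\hat p(i)=\sup\{p(j):j<i\}\in\bullet F\bullet$ for $0<i\le\gamma$. The vertices of order $\gamma$ are the $p:\gamma\to F$ with $\hat p(i)<p(i)$ for all $i<\gamma$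 and $\hat p(\gamma)<M$; the tree order is proper extension of functions. A branch is a maximal linearly ordered set of vertices; by taking the union, a branch is identified with a function $x:\lambda\to F$, $\lambda$ a limit ordinal, and distinct branches are ordered by $x<y$ iff $x(\epsilon)<y(\epsilon)$ at the least $\epsilon$ with $x(\epsilon)\ne y(\epsilon)$. The branch space is an order dense LOTS, and $a(F)$ denotes its completion. The map $x\mapsto x(0)$ from the branch space to $F$ extends to an order surjection $\pi_F:a(F)\to F$, $\pi_F(z)=\sup\{x(0): x \text{ a branch},\ x\le z\}$. The LOTS $a_\alpha(X)$ for $\alpha<\Omega$, with order surjections $p^\alpha_\beta:a_\alpha(X)\to a_\beta(X)$ for $\beta<\alpha$, are defined inductively: $a_0(X)=X$; $a_{\alpha+1}(X)=a(a_\alpha(X))$ with $p^{\alpha+1}_\alpha=\pi_{a_\alpha(X)}$ and $p^{\alpha+1}_\beta=p^\alpha_\beta\circ p^{\alpha+1}_\alpha$ for $\beta<\alpha$; and for a countable limit ordinal $\alpha$, $a_\alpha(X)$ is the inverse limit $\{x\in\prod_{i<\alpha}a_i(X): x_i=p^j_i(x_j)\text{ for all }i<j<\alpha\}$ with the lexicographic order, and $p^\alpha_\beta$ is the coordinate projection. (All $a_\alpha(X)$, $\alpha<\Omega$, are CHLOTS, so the induction makes sense.) *)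

theory Defs
  imports "HOL-Analysis.Analysis"
begin

section \<open>Ordinals\<close>

text \<open>
  \<open>'k ords\<close> is the type of all ordinals of cardinality at most \<open>max |'k| \<aleph>\<^sub>0\<close>, i.e. the set of
  ordinals below the successor cardinal of \<open>|'k + nat|\<close>; an ordinal \<open>\<gamma>\<close> is identified with the
  initial segment \<open>{..<\<gamma>}\<close>. In particular \<open>nat ords\<close> is (the set of elements of) \<open>\<Omega>\<close>.
\<close>

typedef 'k ords = "Field (cardSuc (card_of (UNIV :: ('k + nat) set)))"
proof -
  have "infinite (Field (cardSuc (card_of (UNIV :: ('k + nat) set))))"
    by (simp add: card_of_cardSuc_finite)
  then show ?thesis by (metis finite.emptyI ex_in_conv)
qed

lemma Card_order_cardSuc_ords: "Card_order (cardSuc (card_of (UNIV :: ('k + nat) set)))"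
  by (simp add: cardSuc_Card_order card_of_Card_order)

lemma wo_rel_ords: "wo_rel (cardSuc (card_of (UNIV :: ('k + nat) set)))"
  using Card_order_cardSuc_ords by (auto simp: wo_rel_def card_order_on_def)

instantiation ords :: (type) wellorder
begin

definition less_eq_ords :: "'a ords \<Rightarrow> 'a ords \<Rightarrow> bool" where
  "x \<le> y \<longleftrightarrow> (Rep_ords x, Rep_ords y) \<in> cardSuc (card_of (UNIV :: ('a + nat) set))"

definition less_ords :: "'a ords \<Rightarrow> 'a ords \<Rightarrow> bool" where
  "(x :: 'a ords) < y \<longleftrightarrow> x \<le> y \<and> x \<noteq> y"

lemma less_eq_ords_facts:
  fixes x y z :: "'a ords"
  shows "x \<le> x" and "x \<le> y \<Longrightarrow> y \<le> x \<Longrightarrow> x = y"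
    and "x \<le> y \<Longrightarrow> y \<le> z \<Longrightarrow> x \<le> z" and "x \<le> y \<or> y \<le> x"
proof -
  let ?K = "cardSuc (card_of (UNIV :: ('a + nat) set))"
  note wo = wo_rel_ords[where 'k = 'a]
  have F: "Rep_ords w \<in> Field ?K" for w :: "'a ords" by (rule Rep_ords)
  show "x \<le> x"
    unfolding less_eq_ords_def by (rule refl_onD[OF wo_rel.REFL[OF wo] F])
  show "x \<le> z" if "x \<le> y" "y \<le> z"
    using that unfolding less_eq_ords_def by (rule transD[OF wo_rel.TRANS[OF wo]])
  show "x = y" if "x \<le> y" "y \<le> x"
    using that antisymD[OF wo_rel.ANTISYM[OF wo]] Rep_ords_inject
    unfolding less_eq_ords_def by metis
  show "x \<le> y \<or> y \<le> x"
    using wo_rel.TOTALS[OF wo] F unfolding less_eq_ords_def by simp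
qed

lemma wf_less_ords: "wf {(x, y :: 'a ords). x < y}"
proof -
  let ?K = "cardSuc (card_of (UNIV :: ('a + nat) set))"
  have "wf (inv_image (?K - Id) Rep_ords)"
    by (rule wf_inv_image[OF wo_rel.WF[OF wo_rel_ords]])
  moreover have "{(x, y :: 'a ords). x < y} \<subseteq> inv_image (?K - Id) Rep_ords"
    by (auto simp: inv_image_def less_ords_def less_eq_ords_def Rep_ords_inject)
  ultimately show ?thesis by (rule wf_subset)
qed

instance
proof
  fix x y z :: "'a ords"
  show "x \<le> x" by (rule less_eq_ords_facts)
  show "x \<le> y \<Longrightarrow> y \<le> x \<Longrightarrow> x = y" by (rule less_eq_ords_facts)
  show "x \<le> y \<Longrightarrow> y \<le> z \<Longrightarrow> x \<le> z" by (rule less_eq_ords_facts)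
  show "x \<le> y \<or> y \<le> x" by (rule less_eq_ords_facts)
  show "(x < y) = (x \<le> y \<and> \<not> y \<le> x)"
    using less_eq_ords_facts(1)[of x] less_eq_ords_facts(2)[of x y] by (auto simp: less_ords_def)
next
  fix P :: "'a ords \<Rightarrow> bool" and a :: "'a ords"
  assume "\<And>x. (\<And>y. y < x \<Longrightarrow> P y) \<Longrightarrow> P x"
  then show "P a" using wf_induct_rule[OF wf_less_ords, of P a] by simp
qed

end

lemma card_below_ords:
  "(card_of {..<\<alpha> :: 'k ords}, card_of (UNIV :: ('k + nat) set)) \<in> ordLeq"
proof -
  let ?K = "cardSuc (card_of (UNIV :: ('k + nat) set))"
  have "(card_of (underS ?K (Rep_ords \<alpha>)), ?K) \<in> ordLess"
    using card_of_underS[OF Card_order_cardSuc_ords Rep_ords] .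
  then have 1: "(card_of (underS ?K (Rep_ords \<alpha>)), card_of (UNIV :: ('k + nat) set)) \<in> ordLeq"
    by (simp add: cardSuc_ordLeq_ordLess card_of_Card_order)
  have "(card_of {..<\<alpha>}, card_of (underS ?K (Rep_ords \<alpha>))) \<in> ordLeq"
    by (rule card_of_ordLeqI[of Rep_ords])
      (auto simp: inj_on_def Rep_ords_inject underS_def less_ords_def less_eq_ords_def)
  then show ?thesis using 1 by (rule ordLeq_transitive)
qed

lemma card_UNIV_ords:
  "(card_of (UNIV :: ('k + nat) set), card_of (UNIV :: 'k ords set)) \<in> ordLess"
proof -
  let ?K = "cardSuc (card_of (UNIV :: ('k + nat) set))"
  have "(card_of (UNIV :: ('k + nat) set), ?K) \<in> ordLess"
    by (simp add: cardSuc_greater card_of_Card_order)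
  moreover have "(?K, card_of (Field ?K)) \<in> ordLeq"
    using card_of_Field_ordIso[OF Card_order_cardSuc_ords[where 'k = 'k]] by (simp add: ordIso_iff_ordLeq)
  moreover have "(card_of (Field ?K), card_of (UNIV :: 'k ords set)) \<in> ordLeq"
    by (rule card_of_ordLeqI[of Abs_ords]) (auto simp: inj_on_def Abs_ords_inject)
  ultimately show ?thesis by (rule ordLess_ordLeq_trans[OF ordLess_ordLeq_trans])
qed

lemma ex_greater_ords: "\<exists>\<beta> :: 'k ords. \<alpha> < \<beta>"
proof (rule ccontr)
  let ?U = "UNIV :: 'k ords set" and ?N = "UNIV :: ('k + nat) set"
  assume "\<not> ?thesis"
  then have U: "?U = insert \<alpha> {..<\<alpha>}" by (auto simp: not_less order.order_iff_strict)
  have "(card_of ?N, card_of ?U) \<in> ordLeq"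
    by (rule ordLess_imp_ordLeq[OF card_UNIV_ords])
  moreover have "infinite ?N" by simp
  ultimately have inf: "infinite ?U" by (rule card_of_ordLeq_infinite)
  have "infinite {..<\<alpha>}"
  proof
    assume "finite {..<\<alpha>}"
    then have "finite (insert \<alpha> {..<\<alpha>})" by simp
    with inf U show False by argo
  qed
  then obtain h where "bij_betw h {..<\<alpha>} ({..<\<alpha>} \<union> {\<alpha>})"
    using infinite_imp_bij_betw2[of "{..<\<alpha>}" \<alpha>] by auto
  then have "bij_betw h {..<\<alpha>} ?U" by (subst U) simp
  then have "(card_of {..<\<alpha>}, card_of ?U) \<in> ordIso" by (rule card_of_ordIsoI)
  then have "(card_of ?U, card_of ?N) \<in> ordLeq"
    by (rule ordIso_ordLeq_trans[OF ordIso_symmetric card_below_ords])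
  then show False using not_ordLess_ordLeq[OF card_UNIV_ords] by contradiction
qed

instantiation ords :: (type) zero
begin

definition zero_ords :: "'a ords" where "(0 :: 'a ords) = (LEAST x. True)"

instance ..

end

definition succ_ord :: "'k ords \<Rightarrow> 'k ords" where
  "succ_ord \<alpha> = (LEAST \<beta>. \<alpha> < \<beta>)"

definition limit_ord :: "'k ords \<Rightarrow> bool" where
  "limit_ord \<alpha> \<longleftrightarrow> \<alpha> \<noteq> 0 \<and> (\<forall>\<beta><\<alpha>. succ_ord \<beta> < \<alpha>)"

type_synonym Omega = "nat ords"

lemma succ_ord_greater: "\<alpha> < succ_ord \<alpha>"
  unfolding succ_ord_def using ex_greater_ords[of \<alpha>] by (auto intro: LeastI_ex)

lemma countable_below_Omega: "countable {..<\<alpha> :: Omega}"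
proof -
  obtain f :: "Omega \<Rightarrow> nat + nat" where "inj_on f {..<\<alpha>}"
    using card_below_ords[of \<alpha>] by (auto simp: card_of_ordLeq[symmetric])
  then show ?thesis by (rule countableI') 
qed

lemma uncountable_Omega: "uncountable (UNIV :: Omega set)"
proof
  assume "countable (UNIV :: Omega set)"
  then obtain f :: "Omega \<Rightarrow> nat" where "inj f" by blast
  then have "inj (Inl \<circ> f :: _ \<Rightarrow> nat + nat)" by (simp add: inj_compose)
  then have "(card_of (UNIV :: Omega set), card_of (UNIV :: (nat + nat) set)) \<in> ordLeq"
    by (intro card_of_ordLeqI[of "Inl \<circ> f"]) auto
  then show False using not_ordLess_ordLeq[OF card_UNIV_ords] by contradiction
qed


section \<open>Linearly ordered sets\<close>

text \<open>
  A LOTS is a reflexive relation \<open>r\<close> with \<open>Linear_order r\<close>; its set of points is \<open>Field r\<close>.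
\<close>

definition order_topology :: "'a rel \<Rightarrow> 'a topology" where
  "order_topology r = topology_generated_by
     (insert (Field r) (underS r ` Field r \<union> aboveS r ` Field r))"

definition convex_in :: "'a rel \<Rightarrow> 'a set \<Rightarrow> bool" where
  "convex_in r C \<longleftrightarrow> C \<subseteq> Field r \<and>
     (\<forall>x\<in>C. \<forall>y\<in>C. \<forall>z. (x, z) \<in> r \<and> (z, y) \<in> r \<longrightarrow> z \<in> C)"

definition is_sup :: "'a rel \<Rightarrow> 'a set \<Rightarrow> 'a \<Rightarrow> bool" where
  "is_sup r S s \<longleftrightarrow> s \<in> Above r S \<and> (\<forall>b\<in>Above r S. (s, b) \<in> r)"

definition is_inf :: "'a rel \<Rightarrow> 'a set \<Rightarrow> 'a \<Rightarrow> bool" where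
  "is_inf r S s \<longleftrightarrow> s \<in> Under r S \<and> (\<forall>b\<in>Under r S. (b, s) \<in> r)"

definition complete_lots :: "'a rel \<Rightarrow> bool" where
  "complete_lots r \<longleftrightarrow> Linear_order r \<and>
     (\<forall>S \<subseteq> Field r. S \<noteq> {} \<and> Above r S \<noteq> {} \<and> Under r S \<noteq> {} \<longrightarrow>
        (\<exists>s. is_sup r S s) \<and> (\<exists>s. is_inf r S s))"

definition order_dense :: "'a rel \<Rightarrow> bool" where
  "order_dense r \<longleftrightarrow>
     (\<forall>x y. (x, y) \<in> r - Id \<longrightarrow> (\<exists>z. (x, z) \<in> r - Id \<and> (z, y) \<in> r - Id))"

definition HLOTS :: "'a rel \<Rightarrow> bool" where
  "HLOTS r \<longleftrightarrow> Linear_order r \<and>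
     (infinite (Field r) \<or> 3 \<le> card (Field r)) \<and>
     (\<forall>C. C \<noteq> {} \<and> openin (order_topology r) C \<and> convex_in r C \<longrightarrow>
        (\<exists>f. iso r (Restr r C) f))"

definition CHLOTS :: "'a rel \<Rightarrow> bool" where
  "CHLOTS r \<longleftrightarrow> HLOTS r \<and> complete_lots r"

definition order_map :: "'a rel \<Rightarrow> 'b rel \<Rightarrow> ('a \<Rightarrow> 'b) \<Rightarrow> bool" where
  "order_map r s f \<longleftrightarrow> f ` Field r \<subseteq> Field s \<and> (\<forall>a b. (a, b) \<in> r \<longrightarrow> (f a, f b) \<in> s)"

definition bigger :: "'b rel \<Rightarrow> 'a rel \<Rightarrow> bool" where
  "bigger r' r \<longleftrightarrow>
     (\<exists>f. order_map r r' f \<and> inj_on f (Field r)) \<and>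
     \<not> (\<exists>f. order_map r' r f \<and> inj_on f (Field r'))"

text \<open>
  \<open>e\<close> identifies the order dense LOTS \<open>Y\<close> with a dense subset of its completion \<open>Z\<close>.
\<close>

definition is_completion :: "'a rel \<Rightarrow> 'b rel \<Rightarrow> ('a \<Rightarrow> 'b) \<Rightarrow> bool" where
  "is_completion Y Z e \<longleftrightarrow>
     complete_lots Z \<and> order_dense Z \<and>
     order_map Y Z e \<and> inj_on e (Field Y) \<and>
     order_topology Z closure_of (e ` Field Y) = Field Z \<and>
     ((\<exists>M. is_sup Z (Field Z) M) \<longleftrightarrow> (\<exists>M. is_sup Y (Field Y) M)) \<and>
     ((\<exists>m. is_inf Z (Field Z) m) \<longleftrightarrow> (\<exists>m. is_inf Y (Field Y) m))"


section \<open>Lexicographic orders\<close>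

definition lex_order :: "'k ords \<Rightarrow> ('k ords \<Rightarrow> 'a rel) \<Rightarrow> ('k ords \<Rightarrow> 'a) set \<Rightarrow> ('k ords \<Rightarrow> 'a) rel" where
  "lex_order \<delta> R S = {(x, y). x \<in> S \<and> y \<in> S \<and>
     (x = y \<or> (\<exists>i<\<delta>. (\<forall>j<i. x j = y j) \<and> (x i, y i) \<in> R i - Id))}"

definition interval :: "'a rel \<Rightarrow> 'a \<Rightarrow> 'a \<Rightarrow> 'a set" where
  "interval F u v = {z. (u, z) \<in> F \<and> (z, v) \<in> F}"

text \<open>\<open>F\<^sub>\<delta>\<close>, formed with the interval \<open>J = [u, v]\<close>.\<close>

definition lex_power :: "'a rel \<Rightarrow> 'a \<Rightarrow> 'a \<Rightarrow> 'k ords \<Rightarrow> ('k ords \<Rightarrow> 'a) rel" where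
  "lex_power F u v \<delta> = lex_order \<delta> (\<lambda>_. F)
     (\<Pi>\<^sub>E i\<in>{..<\<delta>}. if i = 0 then Field F else interval F u v)"


section \<open>The order tree and its branch space\<close>

text \<open>\<open>\<bullet>F\<bullet>\<close>, with \<open>m = BMin\<close> and \<open>M = BMax\<close>.\<close>

datatype 'a bullet = BMin | Pt 'a | BMax

definition bullet :: "'a rel \<Rightarrow> 'a bullet rel" where
  "bullet F = {(x, y). x \<in> insert BMin (insert BMax (Pt ` Field F)) \<and>
                       y \<in> insert BMin (insert BMax (Pt ` Field F)) \<and>
     (x = BMin \<or> y = BMax \<or> (\<exists>a b. x = Pt a \<and> y = Pt b \<and> (a, b) \<in> F))}"

text \<open>
  A function on an ordinal \<open>\<gamma>\<close> is a partial map with domain \<open>{..<\<gamma>}\<close>. A vertex, being strictly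
  increasing, is injective on its domain, and so is the union of any chain of vertices; hence for
  \<open>F :: 'a rel\<close> the ordinals in \<open>'a ords\<close> exhaust all possible domains of vertices and branches.
\<close>

definition hat :: "'a rel \<Rightarrow> ('a ords \<rightharpoonup> 'a) \<Rightarrow> 'a ords \<Rightarrow> 'a bullet" where
  "hat F p i = (if i = 0 then BMin
     else (THE s. is_sup (bullet F) ((\<lambda>j. Pt (the (p j))) ` {..<i}) s))"

definition vertices :: "'a rel \<Rightarrow> ('a ords \<rightharpoonup> 'a) set" where
  "vertices F = {p. \<exists>\<gamma>. dom p = {..<\<gamma>} \<and> ran p \<subseteq> Field F \<and>
     (\<forall>i<\<gamma>. (hat F p i, Pt (the (p i))) \<in> bullet F - Id) \<and>
     (hat F p \<gamma>, BMax) \<in> bullet F - Id}"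

definition branches :: "'a rel \<Rightarrow> ('a ords \<rightharpoonup> 'a) set" where
  "branches F = {x. \<exists>B. pred_on.maxchain (vertices F) (\<lambda>p q. p \<subseteq>\<^sub>m q \<and> p \<noteq> q) B \<and>
     Map.graph x = (\<Union>p\<in>B. Map.graph p)}"

definition branch_space :: "'a rel \<Rightarrow> ('a ords \<rightharpoonup> 'a) rel" where
  "branch_space F = {(x, y). x \<in> branches F \<and> y \<in> branches F \<and>
     (x = y \<or> (\<exists>\<epsilon> a b. (\<forall>i<\<epsilon>. x i = y i) \<and> x \<epsilon> = Some a \<and> y \<epsilon> = Some b \<and> (a, b) \<in> F - Id))}"

text \<open>
  \<open>Z\<close> is \<open>a(F)\<close> and \<open>\<pi>\<close> is the map \<open>\<pi>\<^sub>F : a(F) \<rightarrow> F\<close>.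
\<close>

definition is_a :: "'a rel \<Rightarrow> 'b rel \<Rightarrow> ('b \<Rightarrow> 'a) \<Rightarrow> bool" where
  "is_a F Z \<pi> \<longleftrightarrow> (\<exists>e. is_completion (branch_space F) Z e \<and>
     (\<forall>z\<in>Field Z. is_sup F {the (x 0) |x. x \<in> branches F \<and> (e x, z) \<in> Z} (\<pi> z)))"


section \<open>The tower\<close>

definition inverse_limit ::
  "('k ords \<Rightarrow> 'a rel) \<Rightarrow> ('k ords \<Rightarrow> 'k ords \<Rightarrow> 'a \<Rightarrow> 'a) \<Rightarrow> 'k ords \<Rightarrow> ('k ords \<Rightarrow> 'a) rel" where
  "inverse_limit A p \<alpha> = lex_order \<alpha> A
     {x \<in> \<Pi>\<^sub>E i\<in>{..<\<alpha>}. Field (A i). \<forall>j<\<alpha>. \<forall>i<j. x i = p j i (x j)}"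

text \<open>
  \<open>A \<alpha>\<close> is \<open>a\<^sub>\<alpha>(X)\<close> and \<open>p \<alpha> \<beta>\<close>, for \<open>\<beta> < \<alpha>\<close>, is \<open>p\<^sup>\<alpha>\<^sub>\<beta>\<close>. Since types cannot depend on \<open>\<alpha>\<close>, all
  \<open>A \<alpha>\<close> are relations on one type. The completion is only determined up to isomorphism
  anyway, so an arbitrary representative is allowed at successors; at limits \<open>A \<alpha>\<close> may be any
  copy of the inverse limit, a point \<open>z\<close> standing for the thread \<open>(p \<alpha> i z)\<^sub>i\<close>.
\<close>

definition a_tower ::
  "'a rel \<Rightarrow> (Omega \<Rightarrow> 'a rel) \<Rightarrow> (Omega \<Rightarrow> Omega \<Rightarrow> 'a \<Rightarrow> 'a) \<Rightarrow> bool" where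
  "a_tower X A p \<longleftrightarrow>
     A 0 = X \<and>
     (\<forall>\<alpha>. is_a (A \<alpha>) (A (succ_ord \<alpha>)) (p (succ_ord \<alpha>) \<alpha>)) \<and>
     (\<forall>\<alpha> \<beta>. \<beta> < \<alpha> \<longrightarrow>
        (\<forall>z\<in>Field (A (succ_ord \<alpha>)). p (succ_ord \<alpha>) \<beta> z = p \<alpha> \<beta> (p (succ_ord \<alpha>) \<alpha> z))) \<and>
     (\<forall>\<alpha>. limit_ord \<alpha> \<longrightarrow>
        iso (A \<alpha>) (inverse_limit A p \<alpha>) (\<lambda>z. \<lambda>i\<in>{..<\<alpha>}. p \<alpha> i z))"

end

theory Submission
  imports Defs
begin

text \<open>
  For a bounded complete chain \<open>C\<close> the lexicographic product \<open>C \<times> 2\<close> never embeds in \<open>C\<close>: this is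
  a fixed point argument. With \<open>C = J\<^sup>\<beta>\<close> it shows that \<open>F\<^bsub>\<beta>'\<^esub>\<close> does not embed in \<open>F\<^bsub>\<beta>\<^esub>\<close> for
  \<open>\<beta> < \<beta>'\<close>, as soon as \<open>F\<close> is complete and embeds in each of its open intervals. Every \<open>F\<^bsub>\<delta>\<^esub>\<close>
  with \<open>\<delta>\<close> countable embeds in \<open>a(F)\<close>, by sending \<open>x\<close> to a branch that starts with \<open>x 0\<close> and whose
  further values code the \<open>x i\<close> in consecutive intervals. Since the projections of the tower are
  order surjections, each stage embeds in the later ones. So an embedding of \<open>(a\<^bsub>\<alpha>'\<^esub>(X))\<^bsub>\<beta>'\<^esub>\<close> in
  \<open>(a\<^bsub>\<alpha>\<^esub>(X))\<^bsub>\<beta>\<^esub>\<close> with \<open>\<alpha> < \<alpha>'\<close> would embed \<open>(a\<^bsub>\<alpha>\<^esub>(X))\<^bsub>\<beta>+1\<^esub>\<close> in \<open>(a\<^bsub>\<alpha>\<^esub>(X))\<^bsub>\<beta>\<^esub>\<close>.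

  Instead of homogeneity only self-embeddings into open intervals are carried along the tower. At
  limits they are obtained as limits of lifts: a strictly increasing self-map of \<open>F\<close> acts on the
  branches and thereby lifts to \<open>a(F)\<close>.
\<close>

section \<open>Chains and strictly increasing maps\<close>

text \<open>The completion is known only through \<open>is_completion\<close>, so a map out of a(F)
  has to be defined on branches and then extended by suprema; strictness survives because two
  branches fit between any two points.

  On branches the obstacle is reindexing. A self-map applied to a branch, or a vertex prolonged by
  another one, would have to be recomputed as an ordinal-indexed function, and hats are suprema,
  which strictly increasing maps need not preserve. Both difficulties disappear when a vertex is
  replaced by its range and the gap condition asks only for some bound strictly below the value.

  Squeezing into an interval has two uses. It makes room beyond a vertex, and it bounds coordinate 0
  of F_\<beta>, which ranges over all of F, a chain without endpoints; the fixed point argument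
  needs a least point and all suprema. Countability of \<delta> provides an increasing
  \<delta>-sequence in F, which separates the intervals coding the later coordinates.\<close>

definition lt :: "'a rel \<Rightarrow> 'a \<Rightarrow> 'a \<Rightarrow> bool" where
  "lt r a b \<longleftrightarrow> (a, b) \<in> r - Id"

definition strict_map :: "'a rel \<Rightarrow> 'b rel \<Rightarrow> ('a \<Rightarrow> 'b) \<Rightarrow> bool" where
  "strict_map r s f \<longleftrightarrow> f ` Field r \<subseteq> Field s \<and> (\<forall>a b. lt r a b \<longrightarrow> lt s (f a) (f b))"

lemma lt_imp_le: "lt r a b \<Longrightarrow> (a, b) \<in> r"
  by (simp add: lt_def)

lemma lt_Field: "lt r a b \<Longrightarrow> a \<in> Field r" "lt r a b \<Longrightarrow> b \<in> Field r"
  by (auto simp: lt_def Field_def)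

lemma lt_irrefl [simp]: "\<not> lt r a a"
  by (simp add: lt_def)

locale lots =
  fixes r :: "'a rel"
  assumes linear: "Linear_order r"
begin

lemma le_refl [simp]: "a \<in> Field r \<Longrightarrow> (a, a) \<in> r"
  using linear by (auto simp: order_on_defs refl_on_def)

lemma Field_Restr: "C \<subseteq> Field r \<Longrightarrow> Field (Restr r C) = C"
  using le_refl by (fastforce simp: Field_def)

lemma le_trans: "(a, b) \<in> r \<Longrightarrow> (b, c) \<in> r \<Longrightarrow> (a, c) \<in> r"
  using linear by (auto simp: order_on_defs dest: transD)

lemma le_antisym: "(a, b) \<in> r \<Longrightarrow> (b, a) \<in> r \<Longrightarrow> a = b"
  using linear by (auto simp: order_on_defs dest: antisymD)

lemma le_lt_trans: "(a, b) \<in> r \<Longrightarrow> lt r b c \<Longrightarrow> lt r a c"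
  using le_trans[of a b c] le_antisym[of a b] by (auto simp: lt_def)

lemma lt_le_trans: "lt r a b \<Longrightarrow> (b, c) \<in> r \<Longrightarrow> lt r a c"
  using le_trans[of a b c] le_antisym[of a b] by (auto simp: lt_def)

lemma lt_trans: "lt r a b \<Longrightarrow> lt r b c \<Longrightarrow> lt r a c"
  by (rule le_lt_trans[OF lt_imp_le])

lemma not_lt: "a \<in> Field r \<Longrightarrow> b \<in> Field r \<Longrightarrow> \<not> lt r a b \<longleftrightarrow> (b, a) \<in> r"
  using linear le_refl[of a] le_antisym[of a b] unfolding lt_def order_on_defs total_on_def
  by (cases "a = b") auto

lemma not_le: "a \<in> Field r \<Longrightarrow> b \<in> Field r \<Longrightarrow> (a, b) \<notin> r \<longleftrightarrow> lt r b a"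
  using not_lt by blast

lemma lt_asym: "lt r a b \<Longrightarrow> \<not> (b, a) \<in> r"
  using le_antisym unfolding lt_def by blast

lemma le_cases: "a \<in> Field r \<Longrightarrow> b \<in> Field r \<Longrightarrow> lt r a b \<or> a = b \<or> lt r b a"
  using not_lt unfolding lt_def by blast

lemma sup_unique: "is_sup r S a \<Longrightarrow> is_sup r S b \<Longrightarrow> a = b"
  using le_antisym unfolding is_sup_def by blast

lemma sup_upper: "is_sup r S s \<Longrightarrow> a \<in> S \<Longrightarrow> (a, s) \<in> r"
  by (auto simp: is_sup_def Above_def)

lemma sup_least: "is_sup r S s \<Longrightarrow> b \<in> Field r \<Longrightarrow> (\<And>a. a \<in> S \<Longrightarrow> (a, b) \<in> r) \<Longrightarrow> (s, b) \<in> r"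
  by (auto simp: is_sup_def Above_def)

lemma sup_Field: "is_sup r S s \<Longrightarrow> s \<in> Field r"
  by (auto simp: is_sup_def Above_def)

lemma sup_lessD:
  assumes "is_sup r S s" "S \<subseteq> Field r" "lt r b s"
  shows "\<exists>a\<in>S. lt r b a"
proof (rule ccontr)
  assume "\<not> ?thesis"
  then have "(s, b) \<in> r"
    using assms not_lt lt_Field(1)[OF assms(3)] by (intro sup_least[OF assms(1)]) blast+
  then show False using assms lt_asym by blast
qed

lemma strict_map_mono:
  assumes "strict_map r s f" "Linear_order s" "(a, b) \<in> r"
  shows "(f a, f b) \<in> s"
proof (cases "a = b")
  case True
  interpret s: lots s by unfold_locales fact
  have "a \<in> Field r" using assms(3) by (auto simp: Field_def)
  then show ?thesis using assms True by (auto simp: strict_map_def image_subset_iff)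
next
  case False
  then show ?thesis using assms by (auto simp: strict_map_def lt_def)
qed

text \<open>This translates \<open>bigger\<close> in the last step. In between, strict monotonicity
  is the handier form, since it composes and is checked on single inequalities.\<close>

lemma strict_map_iff_order_map_inj:
  assumes "Linear_order s"
  shows "strict_map r s f \<longleftrightarrow> order_map r s f \<and> inj_on f (Field r)"
proof
  assume f: "strict_map r s f"
  have "inj_on f (Field r)"
  proof (rule inj_onI)
    fix x y assume "x \<in> Field r" "y \<in> Field r" "f x = f y"
    then show "x = y" using f le_cases[of x y] unfolding strict_map_def by (metis lt_irrefl)
  qed
  then show "order_map r s f \<and> inj_on f (Field r)"
    using f strict_map_mono[OF f assms] by (auto simp: order_map_def strict_map_def)
next
  assume "order_map r s f \<and> inj_on f (Field r)"
  then show "strict_map r s f"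
    unfolding order_map_def strict_map_def lt_def inj_on_def
    by (auto dest: FieldI1 FieldI2) (metis FieldI1 FieldI2)
qed

end

lemma strict_map_comp: "strict_map r s f \<Longrightarrow> strict_map s t g \<Longrightarrow> strict_map r t (g \<circ> f)"
  unfolding strict_map_def image_subset_iff by auto

text \<open>The supremum \<open>s\<close> of all \<open>y\<close> with \<open>y \<le> f y\<close> is one of them, but then so is \<open>g s > s\<close>.\<close>

lemma no_doubling:
  assumes "Linear_order r" and a: "a \<in> Field r" "\<And>x. x \<in> Field r \<Longrightarrow> (a, x) \<in> r"
    and sup: "\<And>S. S \<subseteq> Field r \<Longrightarrow> S \<noteq> {} \<Longrightarrow> \<exists>s. is_sup r S s"
    and f: "\<And>x. x \<in> Field r \<Longrightarrow> f x \<in> Field r"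
    and fg: "\<And>x. x \<in> Field r \<Longrightarrow> lt r (f x) (g x)"
    and gf: "\<And>x y. lt r x y \<Longrightarrow> lt r (g x) (f y)"
  shows False
proof -
  interpret lots r by unfold_locales fact
  let ?S = "{y \<in> Field r. (y, f y) \<in> r}"
  \<comment> \<open>The least element enters here: \<open>a\<close> lies in \<open>?S\<close>
    because \<open>(a, f a) \<in> r\<close>.\<close>
  obtain s where s: "is_sup r ?S s" using sup[of ?S] a f by blast
  have sF: "s \<in> Field r" by (rule sup_Field[OF s])
  have mono: "(f x, f y) \<in> r" if "(x, y) \<in> r" for x y
  proof (cases "x = y")
    case True
    have "x \<in> Field r" using that by (auto simp: Field_def)
    then show ?thesis using True f by simp
  next
    case False
    then have l: "lt r x y" using that by (simp add: lt_def)
    show ?thesis using lt_imp_le[OF lt_trans[OF fg[OF lt_Field(1)[OF l]] gf[OF l]]] .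
  qed
  have "(s, f s) \<in> r"
  proof (rule sup_least[OF s f[OF sF]])
    fix y assume y: "y \<in> ?S"
    then show "(y, f s) \<in> r" using mono[OF sup_upper[OF s y]] le_trans by blast
  qed
  then have sg: "lt r s (g s)" using fg[OF sF] le_lt_trans by blast
  then have "(g s, s) \<in> r" using gf[OF sg] by (intro sup_upper[OF s]) (auto simp: lt_imp_le dest: lt_Field)
  then show False using sg lt_asym by blast
qed

section \<open>Lexicographic orders\<close>

lemma Field_lex_order [simp]: "Field (lex_order \<delta> R S) = S"
  by (auto simp: lex_order_def Field_def)

lemma lt_lex_order:
  "lt (lex_order \<delta> R S) x y \<longleftrightarrow>
    x \<in> S \<and> y \<in> S \<and> (\<exists>i<\<delta>. (\<forall>j<i. x j = y j) \<and> lt (R i) (x i) (y i))"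
  by (auto simp: lex_order_def lt_def)

lemma first_difference:
  fixes x y :: "'k ords \<Rightarrow> 'a"
  assumes "x \<in> extensional {..<\<delta>}" "y \<in> extensional {..<\<delta>}" "x \<noteq> y"
  obtains i where "i < \<delta>" "\<And>j. j < i \<Longrightarrow> x j = y j" "x i \<noteq> y i"
proof -
  obtain k where "x k \<noteq> y k" using assms(3) by blast
  then have i: "x (LEAST i. x i \<noteq> y i) \<noteq> y (LEAST i. x i \<noteq> y i)" by (rule LeastI)
  show thesis
  proof (rule that[OF _ _ i])
    \<comment> \<open>From \<delta> on both functions are \<open>undefined\<close>, so they cannot
      differ there.\<close>
    show "(LEAST i. x i \<noteq> y i) < \<delta>"
      using i extensional_arb[OF assms(1)] extensional_arb[OF assms(2)] by fastforce
  qed (use not_less_Least in blast)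
qed

text \<open>Stated for any subset of the product, so that it covers lexicographic powers and inverse
  limits alike.\<close>

lemma Linear_order_lex_order:
  fixes R :: "'k ords \<Rightarrow> 'a rel"
  assumes R: "\<And>i. i < \<delta> \<Longrightarrow> Linear_order (R i)"
    and S: "S \<subseteq> (\<Pi>\<^sub>E i\<in>{..<\<delta>}. Field (R i))"
  shows "Linear_order (lex_order \<delta> R S)"
proof -
  let ?L = "lex_order \<delta> R S"
  have lots: "lots (R i)" if "i < \<delta>" for i using R that by unfold_locales
  have ltI: "lt ?L x y" if "x \<in> S" "y \<in> S" "i < \<delta>" "\<And>j. j < i \<Longrightarrow> x j = y j" "lt (R i) (x i) (y i)" for x y i
    using that by (auto simp: lt_lex_order)
  have trans_lt: "lt ?L x z" if xy: "lt ?L x y" and yz: "lt ?L y z" for x y z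
  proof -
    obtain i where i: "i < \<delta>" "\<And>j. j < i \<Longrightarrow> x j = y j" "lt (R i) (x i) (y i)"
      using xy by (auto simp: lt_lex_order)
    obtain k where k: "k < \<delta>" "\<And>j. j < k \<Longrightarrow> y j = z j" "lt (R k) (y k) (z k)"
      using yz by (auto simp: lt_lex_order)
    have S: "x \<in> S" "z \<in> S" using xy yz by (auto simp: lt_lex_order)
    consider "i < k" | "i = k" | "k < i" by (rule linorder_cases)
    then show ?thesis
    proof cases
      case 1
      then show ?thesis using i k S by (intro ltI[of x z i]) auto
    next
      case 2
      then have "lt (R i) (x i) (z i)" using lots.lt_trans[OF lots[OF i(1)] i(3)] k(3) by blast
      then show ?thesis using 2 i k S by (intro ltI[of x z i]) auto
    next
      case 3
      then show ?thesis using i k S by (intro ltI[of x z k]) auto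
    qed
  qed
  have le: "(x, y) \<in> ?L \<longleftrightarrow> x \<in> S \<and> y \<in> S \<and> (x = y \<or> lt ?L x y)" for x y
    by (auto simp: lt_def lex_order_def)
  have irrefl: "\<not> (lt ?L x y \<and> lt ?L y x)" for x y using trans_lt[of x y x] lt_irrefl by metis
  have tot: "lt ?L x y \<or> lt ?L y x" if xy: "x \<in> S" "y \<in> S" "x \<noteq> y" for x y
  proof -
    obtain i where i: "i < \<delta>" "\<And>j. j < i \<Longrightarrow> x j = y j" "x i \<noteq> y i"
      using first_difference[of x \<delta> y] xy S by (metis PiE_iff subsetD)
    have "x i \<in> Field (R i)" "y i \<in> Field (R i)" using i(1) xy S by auto
    then consider "lt (R i) (x i) (y i)" | "lt (R i) (y i) (x i)"
      using lots.le_cases[OF lots[OF i(1)]] i(3) by blast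
    then show ?thesis using i xy ltI[of x y i] ltI[of y x i] by metis
  qed
  show ?thesis
    unfolding order_on_defs
  proof (intro conjI)
    show "?L \<subseteq> Field ?L \<times> Field ?L" by (auto simp: Field_def)
    show "refl_on (Field ?L) ?L" by (auto simp: refl_on_def le) 
    show "trans ?L" by (rule transI) (use trans_lt le in metis)
    show "antisym ?L" by (rule antisymI) (use irrefl le in metis)
    show "total_on (Field ?L) ?L" unfolding total_on_def Field_lex_order using tot le by metis
  qed
qed

text \<open>The supremum is built by recursion: its value at i is the supremum of the i-th values of
  those members of \<open>S\<close> that agree with it below i. Once no member follows it that far,
  all members have been exceeded, and the least values \<open>m i\<close> keep it minimal.\<close>

lemma lex_order_sup:
  fixes R :: "'k ords \<Rightarrow> 'a rel"
  assumes R: "\<And>i. i < \<delta> \<Longrightarrow> Linear_order (R i)"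
    and m: "\<And>i. i < \<delta> \<Longrightarrow> m i \<in> Field (R i)" "\<And>i x. i < \<delta> \<Longrightarrow> x \<in> Field (R i) \<Longrightarrow> (m i, x) \<in> R i"
    and sup: "\<And>i T. i < \<delta> \<Longrightarrow> T \<subseteq> Field (R i) \<Longrightarrow> T \<noteq> {} \<Longrightarrow> \<exists>s. is_sup (R i) T s"
    and S: "S \<subseteq> (\<Pi>\<^sub>E i\<in>{..<\<delta>}. Field (R i))"
  shows "\<exists>s. is_sup (lex_order \<delta> R (\<Pi>\<^sub>E i\<in>{..<\<delta>}. Field (R i))) S s"
proof -
  let ?P = "\<Pi>\<^sub>E i\<in>{..<\<delta>}. Field (R i)"
  let ?L = "lex_order \<delta> R ?P"
  let ?T = "\<lambda>f i. {x i |x. x \<in> S \<and> (\<forall>j<i. x j = f j)}"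
  have "\<exists>f. \<forall>i. if i < \<delta> then (if ?T f i = {} then f i = m i else is_sup (R i) (?T f i) (f i))
    else f i = undefined"
  proof (rule dependent_wellorder_choice)
    fix r i and f g :: "'k ords \<Rightarrow> 'a" assume "\<And>y. y < i \<Longrightarrow> f y = g y"
    then have "?T f i = ?T g i" by force
    show "(if i < \<delta> then (if ?T f i = {} then r = m i else is_sup (R i) (?T f i) r)
        else r = undefined) =
      (if i < \<delta> then (if ?T g i = {} then r = m i else is_sup (R i) (?T g i) r) else r = undefined)"
      unfolding \<open>?T f i = ?T g i\<close> ..
  next
    fix i and f :: "'k ords \<Rightarrow> 'a"
    have T: "?T f i \<subseteq> Field (R i)" if "i < \<delta>" using S that by auto
    have "\<exists>r. is_sup (R i) (?T f i) r" if "i < \<delta>" "?T f i \<noteq> {}"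
      using sup[OF that(1) T[OF that(1)] that(2)] .
    then show "\<exists>r. if i < \<delta> then (if ?T f i = {} then r = m i else is_sup (R i) (?T f i) r)
        else r = undefined"
      by (cases "i < \<delta>"; cases "?T f i = {}") (simp_all del: Collect_empty_eq)
  qed
  then obtain s where s0: "\<forall>i. if i < \<delta> then (if ?T s i = {} then s i = m i
    else is_sup (R i) (?T s i) (s i)) else s i = undefined" ..
  then have s: "\<And>i. i < \<delta> \<Longrightarrow> ?T s i = {} \<Longrightarrow> s i = m i"
    "\<And>i. i < \<delta> \<Longrightarrow> ?T s i \<noteq> {} \<Longrightarrow> is_sup (R i) (?T s i) (s i)"
    "\<And>i. \<not> i < \<delta> \<Longrightarrow> s i = undefined"
    by presburger+
  have lots: "lots (R i)" if "i < \<delta>" for i using R that by unfold_locales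
  have sP: "s \<in> ?P"
  proof (rule PiE_I)
    fix i assume "i \<in> {..<\<delta>}"
    then show "s i \<in> Field (R i)"
      using s(1,2)[of i] m(1)[of i] lots.sup_Field[OF lots] by (cases "?T s i = {}") auto
  qed (use s(3) in simp)
  interpret L: lots ?L
    using Linear_order_lex_order[of \<delta> R ?P] R by unfold_locales auto
  have "(x, s) \<in> ?L" if x: "x \<in> S" for x
  proof (cases "x = s")
    case True
    then show ?thesis using sP by simp
  next
    case False
    obtain i where i: "i < \<delta>" "\<And>j. j < i \<Longrightarrow> x j = s j" "x i \<noteq> s i"
      using first_difference[of x \<delta> s] False sP x S by (metis PiE_iff subsetD)
    have xi: "x i \<in> ?T s i" using x i by blast
    then have "is_sup (R i) (?T s i) (s i)" using s(2)[OF i(1)] by blast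
    then have "lt (R i) (x i) (s i)"
      using lots.sup_upper[OF lots[OF i(1)] _ xi] i(3) by (simp add: lt_def)
    then have "lt ?L x s" using i x S sP unfolding lt_lex_order by blast
    then show ?thesis by (rule lt_imp_le)
  qed
  moreover have "(s, b) \<in> ?L" if b: "b \<in> ?P" "\<And>x. x \<in> S \<Longrightarrow> (x, b) \<in> ?L" for b
  proof (rule ccontr)
    assume "(s, b) \<notin> ?L"
    then have "lt ?L b s" using L.not_le sP b by simp
    then obtain i where i: "i < \<delta>" "\<And>j. j < i \<Longrightarrow> b j = s j" "lt (R i) (b i) (s i)"
      by (auto simp: lt_lex_order)
    show False
    proof (cases "?T s i = {}")
      case True
      then have "s i = m i" using s(1)[OF i(1)] by blast
      then show False using i(3) m(2)[OF i(1)] lt_Field(1)[OF i(3)] lots.lt_asym[OF lots[OF i(1)]] by metis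
    next
      case False
      then have "is_sup (R i) (?T s i) (s i)" using s(2)[OF i(1)] by blast
      moreover have "?T s i \<subseteq> Field (R i)" using S i(1) by auto
      ultimately obtain x where x: "x \<in> S" "\<And>j. j < i \<Longrightarrow> x j = s j" "lt (R i) (b i) (x i)"
        using lots.sup_lessD[OF lots[OF i(1)] _ _ i(3)] by blast
      then have "lt ?L b x" unfolding lt_lex_order using i x b(1) S by (auto intro!: exI[of _ i])
      then show False using b(2)[OF x(1)] L.lt_asym by blast
    qed
  qed
  ultimately have "is_sup ?L S s" using sP by (auto simp: is_sup_def Above_def)
  then show ?thesis by blast
qed

section \<open>Zero, successor and limit among the ordinals\<close>

lemma zero_ords_le [simp]: "0 \<le> (i :: 'k ords)"
  by (simp add: zero_ords_def Least_le)

lemma zero_ords_less: "0 < (i :: 'k ords) \<longleftrightarrow> i \<noteq> 0"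
  by (metis order_le_less zero_ords_le less_irrefl)

lemma not_less_zero_ords [simp]: "\<not> (i :: 'k ords) < 0"
  by (simp add: not_less)

lemma less_succ_ord: "i < succ_ord j \<longleftrightarrow> i \<le> j"
proof
  show "i \<le> j" if "i < succ_ord j"
    using that not_less_Least unfolding succ_ord_def by (metis not_le)
  show "i < succ_ord j" if "i \<le> j"
    using that succ_ord_greater by (rule le_less_trans)
qed

lemma ords_cases:
  obtains "i = 0" | j where "i = succ_ord j" | "limit_ord i"
proof (cases "i = 0 \<or> limit_ord i")
  case False
  then obtain j where j: "j < i" "\<not> succ_ord j < i" by (auto simp: limit_ord_def)
  then have "succ_ord j \<le> i" unfolding succ_ord_def by (intro Least_le)
  then have "i = succ_ord j" using j by simp
  then show thesis using that by blast
qed (use that in blast)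

text \<open>The properties carried up the tower. Density is implied by \<open>self_map\<close>,
  whose range is nonempty and lies strictly between \<open>u\<close> and \<open>v\<close>.\<close>

locale continuum = lots +
  assumes bounded_sup: "S \<subseteq> Field r \<Longrightarrow> S \<noteq> {} \<Longrightarrow> b \<in> Field r \<Longrightarrow> (\<And>a. a \<in> S \<Longrightarrow> (a, b) \<in> r) \<Longrightarrow>
      \<exists>s. is_sup r S s"
    and no_max: "a \<in> Field r \<Longrightarrow> \<exists>b. lt r a b"
    and no_min: "a \<in> Field r \<Longrightarrow> \<exists>b. lt r b a"
    and nonempty: "Field r \<noteq> {}"
    and self_map: "lt r u v \<Longrightarrow> \<exists>f. strict_map r r f \<and> (\<forall>x\<in>Field r. lt r u (f x) \<and> lt r (f x) v)"
begin

lemma dense: "lt r u v \<Longrightarrow> \<exists>c. lt r u c \<and> lt r c v"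
  using self_map[of u v] nonempty by blast

end

section \<open>Vertices and branches\<close>

lemma bullet_simps:
  "(BMin, y) \<in> bullet r \<longleftrightarrow> y \<in> insert BMin (insert BMax (Pt ` Field r))"
  "(y, BMax) \<in> bullet r \<longleftrightarrow> y \<in> insert BMin (insert BMax (Pt ` Field r))"
  "(BMax, Pt a) \<notin> bullet r" "(BMax, BMin) \<notin> bullet r" "(Pt a, BMin) \<notin> bullet r"
  "(Pt a, Pt b) \<in> bullet r \<longleftrightarrow> (a, b) \<in> r"
  by (auto simp: bullet_def Field_def)

lemma bullet_Field: "y \<in> Field (bullet r) \<longleftrightarrow> y \<in> insert BMin (insert BMax (Pt ` Field r))"
  by (auto simp: bullet_def Field_def)

context lots
begin

lemma bullet_sup_unique: "is_sup (bullet r) S a \<Longrightarrow> is_sup (bullet r) S b \<Longrightarrow> a = b"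
  unfolding is_sup_def using le_antisym
  by (metis bullet.exhaust bullet_simps(3-6))

lemma bullet_sup_Pt:
  assumes "is_sup r T s" "T \<noteq> {}"
  shows "is_sup (bullet r) (Pt ` T) (Pt s)"
  unfolding is_sup_def Above_def
proof (intro conjI CollectI ballI)
  fix y assume y: "y \<in> {b \<in> Field (bullet r). \<forall>a\<in>Pt ` T. (a, b) \<in> bullet r}"
  show "(Pt s, y) \<in> bullet r"
  proof (cases y)
    case BMin
    then show ?thesis using y assms(2) by (auto simp: bullet_simps)
  next
    case (Pt c)
    then show ?thesis using y assms(1) sup_least[OF assms(1), of c] by (auto simp: bullet_simps bullet_Field)
  next
    case BMax
    then show ?thesis using sup_Field[OF assms(1)] by (simp add: bullet_simps)
  qed
qed (use assms sup_Field sup_upper in \<open>auto simp: bullet_simps bullet_Field\<close>)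

lemma bullet_sup_BMax:
  assumes "T \<subseteq> Field r" "T \<noteq> {}" "\<And>b. b \<in> Field r \<Longrightarrow> \<exists>a\<in>T. (a, b) \<notin> r"
  shows "is_sup (bullet r) (Pt ` T) BMax"
  unfolding is_sup_def Above_def
proof (intro conjI CollectI ballI)
  fix y assume y: "y \<in> {b \<in> Field (bullet r). \<forall>a\<in>Pt ` T. (a, b) \<in> bullet r}"
  then have "y = BMax" using assms(2,3)
    by (cases y) (auto simp: bullet_simps bullet_Field)
  then show "(BMax, y) \<in> bullet r" by (simp add: bullet_simps)
qed (use assms in \<open>auto simp: bullet_simps bullet_Field\<close>)

end

context continuum
begin

lemma hat_cases:
  assumes "i \<noteq> 0" and T: "\<And>j. j < i \<Longrightarrow> the (p j) \<in> Field r"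
  obtains (bounded) s where "is_sup r ((\<lambda>j. the (p j)) ` {..<i}) s" "hat r p i = Pt s"
  | (unbounded) "hat r p i = BMax" "\<And>b. b \<in> Field r \<Longrightarrow> \<exists>j<i. (the (p j), b) \<notin> r"
proof -
  let ?T = "(\<lambda>j. the (p j)) ` {..<i}"
  have hat: "hat r p i = (THE s. is_sup (bullet r) (Pt ` ?T) s)"
    using assms(1) by (simp add: hat_def image_image)
  have hatI: "hat r p i = s" if "is_sup (bullet r) (Pt ` ?T) s" for s
    unfolding hat using that bullet_sup_unique by (intro the_equality) auto
  have ne: "?T \<noteq> {}" using assms(1) by (auto simp: zero_ords_less[symmetric])
  show thesis
  proof (cases "\<exists>b\<in>Field r. \<forall>a\<in>?T. (a, b) \<in> r")
    case True
    then obtain b where "b \<in> Field r" "\<forall>a\<in>?T. (a, b) \<in> r" ..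
    then obtain s where "is_sup r ?T s" using bounded_sup[of ?T b] T ne by auto
    then show thesis using bounded hatI bullet_sup_Pt ne by blast
  next
    case False
    then have "is_sup (bullet r) (Pt ` ?T) BMax" using T ne by (intro bullet_sup_BMax) auto
    then show thesis using unbounded hatI False by auto
  qed
qed

text \<open>A supremum below \<open>a\<close> is itself such a bound \<open>b\<close>, and for
  \<open>i = 0\<close> a bound exists because there is no minimum. All later arguments about
  vertices use this form of the condition.\<close>

lemma hat_less_Pt_iff:
  assumes "\<And>j. j < i \<Longrightarrow> the (p j) \<in> Field r" "a \<in> Field r"
  shows "(hat r p i, Pt a) \<in> bullet r - Id \<longleftrightarrow> (\<exists>b. lt r b a \<and> (\<forall>j<i. (the (p j), b) \<in> r))"
proof (cases "i = 0")
  case True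
  then show ?thesis using assms(2) no_min[OF assms(2)] by (auto simp: hat_def bullet_simps)
next
  case False
  then show ?thesis
  proof (cases rule: hat_cases[of i p, case_names field bounded unbounded])
    case (bounded s)
    have "lt r s a \<longleftrightarrow> (\<exists>b. lt r b a \<and> (\<forall>j<i. (the (p j), b) \<in> r))" (is "_ \<longleftrightarrow> ?R")
    proof
      show ?R if "lt r s a" using that sup_upper[OF bounded(1)] by auto
      assume ?R
      then obtain b where b: "lt r b a" "\<forall>j<i. (the (p j), b) \<in> r" by blast
      then have "(s, b) \<in> r" using lt_Field(1)[OF b(1)] by (intro sup_least[OF bounded(1)]) auto
      then show "lt r s a" using b(1) le_lt_trans by blast
    qed
    then show ?thesis using bounded(2) by (auto simp: bullet_simps lt_def)
  next
    case unbounded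
    then show ?thesis using lt_Field(1) by (fastforce simp: bullet_simps)
  qed (use assms in auto)
qed

lemma hat_less_BMax_iff:
  assumes "\<And>j. j < i \<Longrightarrow> the (p j) \<in> Field r"
  shows "(hat r p i, BMax) \<in> bullet r - Id \<longleftrightarrow> (\<exists>b\<in>Field r. \<forall>j<i. (the (p j), b) \<in> r)"
proof (cases "i = 0")
  case True
  then show ?thesis using nonempty by (auto simp: hat_def bullet_simps)
next
  case False
  then show ?thesis
  proof (cases rule: hat_cases[of i p, case_names field bounded unbounded])
    case (bounded s)
    then show ?thesis using sup_Field[OF bounded(1)] sup_upper[OF bounded(1)] by (auto simp: bullet_simps)
  qed (use assms in \<open>auto simp: bullet_simps\<close>)
qed

lemma vertices_iff:
  "p \<in> vertices r \<longleftrightarrow> (\<exists>\<gamma>. dom p = {..<\<gamma>} \<and> ran p \<subseteq> Field r \<and>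
     (\<forall>i<\<gamma>. \<exists>b. lt r b (the (p i)) \<and> (\<forall>j<i. (the (p j), b) \<in> r)) \<and>
     (\<exists>b\<in>Field r. \<forall>j<\<gamma>. (the (p j), b) \<in> r))"
proof -
  have F: "the (p i) \<in> Field r" if "dom p = {..<\<gamma>}" "ran p \<subseteq> Field r" "i < \<gamma>" for \<gamma> i
  proof -
    have "i \<in> dom p" using that by simp
    then show ?thesis using that(2) by (auto simp: ran_def)
  qed
  have "(hat r p i, Pt (the (p i))) \<in> bullet r - Id \<longleftrightarrow>
      (\<exists>b. lt r b (the (p i)) \<and> (\<forall>j<i. (the (p j), b) \<in> r))"
    if "dom p = {..<\<gamma>}" "ran p \<subseteq> Field r" "i < \<gamma>" for \<gamma> i
    using F[OF that(1,2)] that(3) by (intro hat_less_Pt_iff) auto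
  moreover have "(hat r p \<gamma>, BMax) \<in> bullet r - Id \<longleftrightarrow> (\<exists>b\<in>Field r. \<forall>j<\<gamma>. (the (p j), b) \<in> r)"
    if "dom p = {..<\<gamma>}" "ran p \<subseteq> Field r" for \<gamma>
    using F[OF that(1,2)] by (intro hat_less_BMax_iff)
  ultimately show ?thesis unfolding vertices_def by (simp cong: conj_cong del: split_paired_Ex)
qed

section \<open>Restricting and prolonging vertices\<close>

lemma vertexE:
  assumes "p \<in> vertices r"
  obtains \<gamma> b where "dom p = {..<\<gamma>}" "ran p \<subseteq> Field r" "b \<in> Field r" "\<And>a. a \<in> ran p \<Longrightarrow> (a, b) \<in> r"
    "\<And>i a. p i = Some a \<Longrightarrow> \<exists>b. lt r b a \<and> (\<forall>j<i. \<forall>c. p j = Some c \<longrightarrow> (c, b) \<in> r)"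
proof -
  obtain \<gamma> b where \<gamma>: "dom p = {..<\<gamma>}" "ran p \<subseteq> Field r" "b \<in> Field r" "\<And>j. j < \<gamma> \<Longrightarrow> (the (p j), b) \<in> r"
    "\<And>i. i < \<gamma> \<Longrightarrow> \<exists>b. lt r b (the (p i)) \<and> (\<forall>j<i. (the (p j), b) \<in> r)"
    using assms unfolding vertices_iff by blast
  have "i < \<gamma>" if "p i = Some a" for i a using \<gamma>(1) that by blast
  then have "\<exists>b. lt r b a \<and> (\<forall>j<i. \<forall>c. p j = Some c \<longrightarrow> (c, b) \<in> r)" if "p i = Some a" for i a
    using \<gamma>(5)[of i] that by (metis option.sel)
  moreover have "(a, b) \<in> r" if a: "a \<in> ran p" for a
  proof -
    obtain j where "p j = Some a" using a unfolding ran_def by blast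
    then show ?thesis using \<gamma>(1) \<gamma>(4)[of j] by (metis domI lessThan_iff option.sel)
  qed
  ultimately show thesis using that \<gamma>(1-3) by blast
qed

lemma vertexI:
  assumes "dom p = {..<\<gamma>}" "ran p \<subseteq> Field r" "b \<in> Field r" "\<And>a. a \<in> ran p \<Longrightarrow> (a, b) \<in> r"
    "\<And>i a. p i = Some a \<Longrightarrow> \<exists>b. lt r b a \<and> (\<forall>j<i. \<forall>c. p j = Some c \<longrightarrow> (c, b) \<in> r)"
  shows "p \<in> vertices r"
proof -
  have Some: "\<exists>a. p i = Some a" if "i < \<gamma>" for i using assms(1) that by blast
  have "\<exists>b. lt r b (the (p i)) \<and> (\<forall>j<i. (the (p j), b) \<in> r)" if "i < \<gamma>" for i
    using Some[OF that] assms(5)[of i] Some order.strict_trans[OF _ that] by (metis option.sel)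
  moreover have "(the (p i), b) \<in> r" if "i < \<gamma>" for i
    using Some[OF that] assms(4) by (metis option.sel ranI)
  ultimately show ?thesis using assms(1-3) unfolding vertices_iff by blast
qed

lemma vertex_down: "p \<in> vertices r \<Longrightarrow> p i = Some a \<Longrightarrow> j < i \<Longrightarrow> \<exists>c. p j = Some c"
  by (elim vertexE) (metis domD domI lessThan_iff order.strict_trans)

lemma vertex_mono: "p \<in> vertices r \<Longrightarrow> j < i \<Longrightarrow> p j = Some b \<Longrightarrow> p i = Some a \<Longrightarrow> lt r b a"
  by (elim vertexE) (metis le_lt_trans)

lemma vertex_restrict:
  assumes "p \<in> vertices r"
  shows "p |` {..<i} \<in> vertices r"
  using assms
proof (rule vertexE)
  fix \<gamma> b
  assume p: "dom p = {..<\<gamma>}" "ran p \<subseteq> Field r" "b \<in> Field r" "\<And>a. a \<in> ran p \<Longrightarrow> (a, b) \<in> r"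
    "\<And>i a. p i = Some a \<Longrightarrow> \<exists>b. lt r b a \<and> (\<forall>j<i. \<forall>c. p j = Some c \<longrightarrow> (c, b) \<in> r)"
  have ran: "ran (p |` {..<i}) \<subseteq> ran p" by (auto simp: ran_def restrict_map_def)
  show ?thesis
  proof (rule vertexI)
    show "dom (p |` {..<i}) = {..<min \<gamma> i}" using p(1) by auto
    show "b \<in> Field r" by fact
    fix k a assume "(p |` {..<i}) k = Some a"
    then have k: "p k = Some a" "k < i" by (auto simp: restrict_map_def split: if_splits)
    then show "\<exists>b. lt r b a \<and> (\<forall>j<k. \<forall>c. (p |` {..<i}) j = Some c \<longrightarrow> (c, b) \<in> r)"
      using p(5)[of k a] by (auto simp: restrict_map_def)
  qed (use ran p(2,4) in auto)
qed

lemma vertex_snoc: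
  assumes "p \<in> vertices r" "dom p = {..<\<gamma>}" "lt r b c" "\<And>a. a \<in> ran p \<Longrightarrow> (a, b) \<in> r"
  shows "p(\<gamma> \<mapsto> c) \<in> vertices r"
proof -
  have \<gamma>: "p \<gamma> = None" using assms(2) by (metis domIff lessThan_iff less_irrefl)
  then have ran: "ran (p(\<gamma> \<mapsto> c)) = insert c (ran p)" by simp
  have p: "ran p \<subseteq> Field r" 
    "\<And>i a. p i = Some a \<Longrightarrow> \<exists>b. lt r b a \<and> (\<forall>j<i. \<forall>c. p j = Some c \<longrightarrow> (c, b) \<in> r)"
    using assms(1) by (auto elim: vertexE)
  show ?thesis
  proof (rule vertexI)
    show "dom (p(\<gamma> \<mapsto> c)) = {..<succ_ord \<gamma>}" using assms(2) by (auto simp: less_succ_ord)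
    show "ran (p(\<gamma> \<mapsto> c)) \<subseteq> Field r" using ran p(1) lt_Field[OF assms(3)] by simp
    show "c \<in> Field r" by (rule lt_Field[OF assms(3)])
    then show "(a, c) \<in> r" if "a \<in> ran (p(\<gamma> \<mapsto> c))" for a
      using that ran assms(4) le_trans[OF _ lt_imp_le[OF assms(3)]] by auto
    fix i a assume i: "(p(\<gamma> \<mapsto> c)) i = Some a"
    show "\<exists>b. lt r b a \<and> (\<forall>j<i. \<forall>d. (p(\<gamma> \<mapsto> c)) j = Some d \<longrightarrow> (d, b) \<in> r)"
    proof (cases "i = \<gamma>")
      case True
      then show ?thesis using i assms(3,4) by (auto intro!: exI[of _ b] ranI)
    next
      case False
      then have "p i = Some a" using i by simp
      then have "i < \<gamma>" using assms(2) by blast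
      then show ?thesis using p(2)[OF \<open>p i = Some a\<close>] by (metis fun_upd_apply less_asym)
    qed
  qed
qed

text \<open>A vertex is bounded and there is no maximum, which leaves room for one more value. Hence
  the tree has no maximal vertex.\<close>

lemma vertex_proper_extension:
  assumes "p \<in> vertices r"
  shows "\<exists>q\<in>vertices r. p \<subseteq>\<^sub>m q \<and> \<not> q \<subseteq>\<^sub>m p"
  using assms
proof (rule vertexE)
  fix \<gamma> b
  assume p: "dom p = {..<\<gamma>}" "b \<in> Field r" "\<And>a. a \<in> ran p \<Longrightarrow> (a, b) \<in> r"
  obtain c where "lt r b c" using no_max p(2) by blast
  then have "p(\<gamma> \<mapsto> c) \<in> vertices r" using assms p by (intro vertex_snoc)
  moreover have "p \<gamma> = None" using p(1) by (metis domIff lessThan_iff less_irrefl)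
  then have "p \<subseteq>\<^sub>m p(\<gamma> \<mapsto> c)" "\<not> p(\<gamma> \<mapsto> c) \<subseteq>\<^sub>m p" by (auto simp: map_le_def)
  ultimately show ?thesis by blast
qed

section \<open>Branches as unions of maximal chains of vertices\<close>

lemma branch_imp_vertices:
  assumes "x \<in> branches r" "x i = Some a"
  shows "x |` {..<succ_ord i} \<in> vertices r"
proof -
  obtain B where B: "pred_on.maxchain (vertices r) (\<lambda>p q. p \<subseteq>\<^sub>m q \<and> p \<noteq> q) B"
    "Map.graph x = (\<Union>p\<in>B. Map.graph p)"
    using assms(1) by (auto simp: branches_def)
  have BV: "B \<subseteq> vertices r" using B(1) by (auto simp: pred_on.maxchain_def pred_on.chain_def)
  have "(i, a) \<in> Map.graph x" using assms(2) by (simp add: Map.graph_def)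
  then obtain p where p: "p \<in> B" "(i, a) \<in> Map.graph p" using B(2) by blast
  then have pi: "p i = Some a" by (simp add: Map.graph_def)
  have "Map.graph p \<subseteq> Map.graph x" using B(2) p(1) by blast
  then have le: "x j = Some c" if "p j = Some c" for j c using that by (auto simp: Map.graph_def)
  have "x |` {..<succ_ord i} = p |` {..<succ_ord i}"
  proof
    fix j
    show "(x |` {..<succ_ord i}) j = (p |` {..<succ_ord i}) j"
    proof (cases "j \<le> i")
      case True
      then obtain c where "p j = Some c" using vertex_down[of p i a j] pi BV p(1) by (metis order_le_less subsetD)
      then show ?thesis using le by (simp add: restrict_map_def)
    qed (simp add: restrict_map_def less_succ_ord)
  qed
  then show ?thesis using vertex_restrict BV p(1) by (metis subsetD)
qed

lemma maxchain_in:
  assumes "pred_on.maxchain A (\<lambda>p q. p \<subseteq>\<^sub>m q \<and> p \<noteq> q) B" "q \<in> A"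
    "\<And>p. p \<in> B \<Longrightarrow> p \<subseteq>\<^sub>m q \<or> q \<subseteq>\<^sub>m p"
  shows "q \<in> B"
proof (rule ccontr)
  assume "q \<notin> B"
  have "pred_on.chain A (\<lambda>p q. p \<subseteq>\<^sub>m q \<and> p \<noteq> q) (insert q B)"
    using assms by (auto simp: pred_on.maxchain_def pred_on.chain_def)
  then show False using assms(1) \<open>q \<notin> B\<close> by (auto simp: pred_on.maxchain_def)
qed

text \<open>If \<open>x\<close> were contained in \<open>q\<close>, a proper extension of
  \<open>q\<close> would be comparable with the whole chain defining \<open>x\<close> and belong to
  it by maximality; it would then be contained in \<open>x\<close> and so in
  \<open>q\<close>.\<close>

lemma branch_not_le_vertex:
  assumes "x \<in> branches r" "q \<in> vertices r"
  shows "\<not> x \<subseteq>\<^sub>m q"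
proof
  assume xq: "x \<subseteq>\<^sub>m q"
  obtain B where B: "pred_on.maxchain (vertices r) (\<lambda>p q. p \<subseteq>\<^sub>m q \<and> p \<noteq> q) B"
    "Map.graph x = (\<Union>p\<in>B. Map.graph p)"
    using assms(1) by (auto simp: branches_def)
  have le: "p \<subseteq>\<^sub>m x" if "p \<in> B" for p
  proof -
    have "Map.graph p \<subseteq> Map.graph x" using B(2) that by blast
    then show ?thesis by (auto simp: Map.graph_def map_le_def dom_def)
  qed
  have in_B: "q' \<subseteq>\<^sub>m x" if "q' \<in> vertices r" "x \<subseteq>\<^sub>m q'" for q'
    by (rule le, rule maxchain_in[OF B(1) that(1)]) (use le that(2) map_le_trans in blast)
  obtain q' where q': "q' \<in> vertices r" "q \<subseteq>\<^sub>m q'" "\<not> q' \<subseteq>\<^sub>m q"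
    using vertex_proper_extension[OF assms(2)] by blast
  have "q' \<subseteq>\<^sub>m x" using in_B q' xq map_le_trans by blast
  then show False using xq q'(3) map_le_trans by blast
qed

text \<open>Hausdorff's principle is applied to the vertices comparable with \<open>q\<close>, which
  forces \<open>q\<close> into the maximal chain. Any larger chain of vertices contains
  \<open>q\<close> and so consists of such vertices too; hence maximality holds among all
  vertices.\<close>

lemma vertex_le_branch:
  assumes q: "q \<in> vertices r"
  shows "\<exists>x\<in>branches r. q \<subseteq>\<^sub>m x"
proof -
  let ?P = "\<lambda>p q. p \<subseteq>\<^sub>m q \<and> p \<noteq> (q :: 'a ords \<rightharpoonup> 'a)"
  let ?A = "{p \<in> vertices r. p \<subseteq>\<^sub>m q \<or> q \<subseteq>\<^sub>m p}"
  obtain B where B: "pred_on.maxchain ?A ?P B" using pred_on.Hausdorff by blast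
  have chain: "pred_on.chain ?A ?P B" using B by (rule pred_on.maxchain_imp_chain)
  then have BA: "B \<subseteq> ?A" by (auto simp: pred_on.chain_def)
  have qB: "q \<in> B" by (rule maxchain_in[OF B]) (use q BA in auto)
  have comparable: "p \<subseteq>\<^sub>m p' \<or> p' \<subseteq>\<^sub>m p" if "p \<in> B" "p' \<in> B" for p p'
  proof -
    have "?P\<^sup>=\<^sup>= p p' \<or> ?P\<^sup>=\<^sup>= p' p"
      using chain that unfolding pred_on.chain_def by (elim conjE) (drule (1) bspec, drule (1) bspec)
    then show ?thesis by auto
  qed
  have "pred_on.maxchain (vertices r) ?P B"
    unfolding pred_on.maxchain_def
  proof (intro conjI notI)
    show "pred_on.chain (vertices r) ?P B"
      using chain by (auto simp: pred_on.chain_def)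
    assume "\<exists>S. pred_on.chain (vertices r) ?P S \<and> B \<subset> S"
    then obtain S where S: "pred_on.chain (vertices r) ?P S" "B \<subset> S" by blast
    then have "pred_on.chain ?A ?P S"
      using qB by (auto simp: pred_on.chain_def) (metis map_le_refl subsetD)
    then show False using B S(2) by (auto simp: pred_on.maxchain_def)
  qed
  \<comment> \<open>The union of the chain as a partial map. The choice is harmless because members
    of a chain agree wherever both are defined.\<close>
  moreover define x where "x i = (if \<exists>p\<in>B. p i \<noteq> None then (SOME p. p \<in> B \<and> p i \<noteq> None) i else None)" for i
  have x: "x i = Some a" if "p \<in> B" "p i = Some a" for p i a
  proof -
    let ?p = "SOME p. p \<in> B \<and> p i \<noteq> None"
    have p': "?p \<in> B \<and> ?p i \<noteq> None" by (rule someI[of _ p]) (simp add: that)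
    then have "?p i = Some a" using comparable[of p ?p] that by (auto simp: map_le_def dom_def)
    then show ?thesis using that unfolding x_def by auto
  qed
  have "Map.graph x = (\<Union>p\<in>B. Map.graph p)"
  proof (intro equalityI subsetI)
    fix y assume "y \<in> Map.graph x"
    then obtain i a where y: "y = (i, a)" "x i = Some a" by (auto simp: Map.graph_def)
    then obtain p c where "p \<in> B" "p i = Some c" unfolding x_def by (auto split: if_splits)
    then show "y \<in> (\<Union>p\<in>B. Map.graph p)" using x y by (auto simp: Map.graph_def)
  qed (use x in \<open>auto simp: Map.graph_def\<close>)
  ultimately have "x \<in> branches r" unfolding branches_def mem_Collect_eq by (intro exI[of _ B] conjI)
  moreover have "q \<subseteq>\<^sub>m x" using x qB by (auto simp: map_le_def)
  ultimately show ?thesis by (intro bexI[of _ x])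
qed

lemma branch_vertexE:
  assumes "x \<in> branches r" "x i = Some a"
  obtains q where "q \<in> vertices r" "q \<subseteq>\<^sub>m x" "\<And>j. j \<le> i \<Longrightarrow> q j = x j"
  by (rule that[OF branch_imp_vertices[OF assms]])
    (auto simp: map_le_def restrict_map_def less_succ_ord split: if_splits)

lemma branch_down: "x \<in> branches r \<Longrightarrow> x i = Some a \<Longrightarrow> j < i \<Longrightarrow> \<exists>c. x j = Some c"
  by (erule (1) branch_vertexE) (metis vertex_down order_refl order_less_imp_le)

lemma branch_mono:
  "x \<in> branches r \<Longrightarrow> j < i \<Longrightarrow> x j = Some b \<Longrightarrow> x i = Some a \<Longrightarrow> lt r b a"
  by (erule (1) branch_vertexE) (metis vertex_mono order_refl order_less_imp_le)

lemma branch_Field: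
  assumes "x \<in> branches r" "x i = Some a"
  shows "a \<in> Field r"
  using assms
proof (rule branch_vertexE)
  fix q assume q: "q \<in> vertices r" "\<And>j. j \<le> i \<Longrightarrow> q j = x j"
  then have "a \<in> ran q" using assms(2) ranI[of q i a] by simp
  then show ?thesis using q(1) by (auto elim: vertexE)
qed

text \<open>At the least index of disagreement both branches are defined: one that had stopped there
  would be contained in a vertex, namely an initial segment of the other.\<close>

lemma branch_difference:
  assumes "x \<in> branches r" "y \<in> branches r" "x \<noteq> y"
  shows "\<exists>\<epsilon> a b. (\<forall>i<\<epsilon>. x i = y i) \<and> x \<epsilon> = Some a \<and> y \<epsilon> = Some b \<and> a \<noteq> b"
proof -
  obtain k where "x k \<noteq> y k" using assms(3) by blast
  define \<epsilon> where "\<epsilon> = (LEAST i. x i \<noteq> y i)"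
  have \<epsilon>: "x \<epsilon> \<noteq> y \<epsilon>" unfolding \<epsilon>_def by (rule LeastI[of _ k]) fact
  have eq: "x i = y i" if "i < \<epsilon>" for i using that not_less_Least unfolding \<epsilon>_def by blast
  have "x' \<epsilon> \<noteq> None" if x': "x' \<in> branches r" and y': "y' \<in> branches r" and "x' \<epsilon> \<noteq> y' \<epsilon>"
    and eq': "\<And>i. i < \<epsilon> \<Longrightarrow> x' i = y' i" for x' y'
  proof
    assume None: "x' \<epsilon> = None"
    then obtain b where b: "y' \<epsilon> = Some b" using \<open>x' \<epsilon> \<noteq> y' \<epsilon>\<close> by (cases "y' \<epsilon>") auto
    have dom: "i < \<epsilon>" if "x' i = Some a" for i a
    proof (rule ccontr)
      assume "\<not> i < \<epsilon>"
      then have "\<epsilon> < i" using None that by (cases "\<epsilon> = i") auto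
      then show False using branch_down[OF x' that] None by fastforce
    qed
    have "x' \<subseteq>\<^sub>m y' |` {..<succ_ord \<epsilon>}"
      unfolding map_le_def
    proof
      fix i assume "i \<in> dom x'"
      then have "i < \<epsilon>" using dom by blast
      then show "x' i = (y' |` {..<succ_ord \<epsilon>}) i" using eq' by (simp add: less_succ_ord restrict_map_def less_imp_le)
    qed
    then show False using branch_not_le_vertex[OF x' branch_imp_vertices[OF y' b]] by blast
  qed
  from this[OF assms(1,2) \<epsilon> eq] this[OF assms(2,1) \<epsilon>[symmetric] eq[symmetric]]
  show ?thesis using \<epsilon> eq by (intro exI[of _ \<epsilon>]) auto
qed

end

lemma Field_branch_space [simp]: "Field (branch_space r) = branches r"
  by (auto simp: branch_space_def Field_def)

lemma lt_branch_space:
  "lt (branch_space r) x y \<longleftrightarrow> x \<in> branches r \<and> y \<in> branches r \<and>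
    (\<exists>\<epsilon> a b. (\<forall>i<\<epsilon>. x i = y i) \<and> x \<epsilon> = Some a \<and> y \<epsilon> = Some b \<and> lt r a b)"
  by (auto simp: lt_def branch_space_def)

lemma (in continuum) branch_space_cases:
  assumes "x \<in> branches r" "y \<in> branches r"
  shows "lt (branch_space r) x y \<or> x = y \<or> lt (branch_space r) y x"
proof (cases "x = y")
  case False
  then obtain \<epsilon> a b where \<epsilon>: "\<forall>i<\<epsilon>. x i = y i" "x \<epsilon> = Some a" "y \<epsilon> = Some b" "a \<noteq> b"
    using branch_difference assms by blast
  then have "lt r a b \<or> lt r b a" using le_cases branch_Field assms by blast
  then show ?thesis unfolding lt_branch_space using assms \<epsilon> by metis
qed simp

section \<open>Branches from well-ordered sets\<close>

text \<open>The bounded gapped sets are the ranges of the vertices: the last condition expresses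
  \<open>hat p i < p i\<close> without reference to the enumeration.\<close>

definition gapped :: "'a rel \<Rightarrow> 'a set \<Rightarrow> bool" where
  "gapped r S \<longleftrightarrow> S \<subseteq> Field r \<and> (\<forall>T\<subseteq>S. T \<noteq> {} \<longrightarrow> (\<exists>m\<in>T. \<forall>t\<in>T. (m, t) \<in> r)) \<and>
     (\<forall>s\<in>S. \<exists>b. lt r b s \<and> (\<forall>t\<in>S. lt r t s \<longrightarrow> (t, b) \<in> r))"

text \<open>The branch order read off from ranges: \<open>s\<close> and \<open>s'\<close> are the
  values at the first difference. Since no index occurs, the relation passes easily to images and
  unions.\<close>

definition precedes :: "'a rel \<Rightarrow> 'a set \<Rightarrow> 'a set \<Rightarrow> bool" where
  "precedes r S S' \<longleftrightarrow> (\<exists>s\<in>S. \<exists>s'\<in>S'. lt r s s' \<and> {t \<in> S. lt r t s} = {t \<in> S'. lt r t s'})"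

text \<open>The cardinality of \<open>S\<close> is at most that of \<open>'a + nat\<close>, so its
  well-order is shorter than the successor cardinal underlying \<open>'a ords\<close> and isomorphic
  to an initial segment of it.\<close>

lemma (in lots) ex_ords_enumeration:
  assumes S: "S \<subseteq> Field r" and wo: "\<And>T. T \<subseteq> S \<Longrightarrow> T \<noteq> {} \<Longrightarrow> \<exists>m\<in>T. \<forall>t\<in>T. (m, t) \<in> r"
  shows "\<exists>(\<gamma> :: 'a ords) \<phi>. bij_betw \<phi> {..<\<gamma>} S \<and> (\<forall>i j. j < i \<longrightarrow> i < \<gamma> \<longrightarrow> lt r (\<phi> j) (\<phi> i))"
proof -
  let ?U = "UNIV :: ('a + nat) set"
  let ?K = "cardSuc (card_of ?U)"
  let ?R = "Restr r S"
  have CK: "Card_order ?K" by (rule Card_order_cardSuc_ords)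
  then have WK: "Well_order ?K" by (simp add: card_order_on_def)
  have F: "Field ?R = S"
  proof (intro equalityI subsetI)
    show "a \<in> Field ?R" if "a \<in> S" for a using that S le_refl[of a] by (intro FieldI1[of a a]) auto
  qed (auto simp: Field_def)
  have WR: "Well_order ?R"
    unfolding Linear_order_Well_order_iff[OF Linear_order_Restr[OF linear, of S]]
    unfolding F
  proof (intro allI impI)
    fix T assume T: "T \<subseteq> S" "T \<noteq> {}"
    then show "\<exists>m\<in>T. \<forall>t\<in>T. (m, t) \<in> ?R" using wo[OF T] by (meson IntI SigmaI subsetD)
  qed
  have "(card_of S, card_of ?U) \<in> ordLeq" by (rule card_of_ordLeqI[of Inl]) auto
  then have lt_K: "(card_of S, ?K) \<in> ordLess"
    using cardSuc_greater[OF card_of_Card_order] by (rule ordLeq_ordLess_trans)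
  have "(?R, ?K) \<in> ordLess"
  proof (rule ccontr)
    assume "\<not> ?thesis"
    then have "(?K, ?R) \<in> ordLeq" using WR WK by (simp add: not_ordLess_iff_ordLeq)
    then have "(card_of (Field ?K), card_of S) \<in> ordLeq" using card_of_mono2 F by metis
    then have "(?K, card_of S) \<in> ordLeq"
      by (rule ordIso_ordLeq_trans[OF ordIso_symmetric[OF card_of_Field_ordIso[OF CK]]])
    then show False using lt_K not_ordLess_ordLeq by blast
  qed
  then obtain a where a: "a \<in> Field ?K" "(?R, Restr ?K (underS ?K a)) \<in> ordIso"
    using ordLess_iff_ordIso_Restr[OF WK WR] by blast
  then obtain f where "iso ?R (Restr ?K (underS ?K a)) f" by (auto simp: ordIso_def)
  moreover have Fa: "Field (Restr ?K (underS ?K a)) = underS ?K a"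
    using wo_rel_ords by (intro Field_Restr_ofilter[OF WK] wo_rel.underS_ofilter)
  ultimately have f: "bij_betw f S (underS ?K a)"
    "\<And>c d. c \<in> S \<Longrightarrow> d \<in> S \<Longrightarrow> (c, d) \<in> ?R \<longleftrightarrow> (f c, f d) \<in> Restr ?K (underS ?K a)"
    unfolding iso_iff2 F Fa by auto
  define \<gamma> :: "'a ords" where "\<gamma> = Abs_ords a"
  have Rep: "Rep_ords \<gamma> = a" using a(1) by (simp add: \<gamma>_def Abs_ords_inverse)
  have below: "i < \<gamma> \<longleftrightarrow> Rep_ords i \<in> underS ?K a" for i
    by (auto simp: less_ords_def less_eq_ords_def Rep underS_def Rep_ords_inject[symmetric])
  have "bij_betw Rep_ords {..<\<gamma>} (underS ?K a)"
  proof (rule bij_betwI')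
    fix y assume y: "y \<in> underS ?K a"
    then have "y \<in> Field ?K" by (auto simp: underS_def Field_def)
    then show "\<exists>i\<in>{..<\<gamma>}. y = Rep_ords i" using y below by (metis Rep_ords_cases lessThan_iff)
  qed (auto simp: Rep_ords_inject below)
  then have bij: "bij_betw (inv_into S f \<circ> Rep_ords) {..<\<gamma>} S"
    using bij_betw_inv_into[OF f(1)] by (rule bij_betw_trans)
  have "lt r (inv_into S f (Rep_ords j)) (inv_into S f (Rep_ords i))" if "j < i" "i < \<gamma>" for i j
  proof -
    let ?c = "inv_into S f (Rep_ords j)" and ?d = "inv_into S f (Rep_ords i)"
    have "j < \<gamma>" using that by simp
    then have S': "?c \<in> S" "?d \<in> S" using bij_betwE[OF bij] that by auto
    have eq: "f ?c = Rep_ords j" "f ?d = Rep_ords i"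
      using below that \<open>j < \<gamma>\<close> by (auto intro!: bij_betw_inv_into_right[OF f(1)])
    have *: "(Rep_ords j, Rep_ords i) \<in> Restr ?K (underS ?K a)" "Rep_ords j \<noteq> Rep_ords i"
      using that below \<open>j < \<gamma>\<close> by (auto simp: less_ords_def less_eq_ords_def Rep_ords_inject)
    have "(?c, ?d) \<in> ?R" unfolding f(2)[OF S'] eq by (rule *(1))
    moreover have "?c \<noteq> ?d" using eq *(2) by metis
    ultimately show ?thesis by (simp add: lt_def)
  qed
  with bij show ?thesis by (intro exI[of _ \<gamma>] exI[of _ "inv_into S f \<circ> Rep_ords"]) auto
qed

text \<open>Here it pays that the gap is expressed by a bound instead of a supremum:
  \<open>h\<close> may jump, but \<open>h b\<close> still bounds the images of the earlier
  elements.\<close>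

lemma gapped_image:
  assumes "gapped r S" "strict_map r s h" "Linear_order r" "Linear_order s"
  shows "gapped s (h ` S)"
proof -
  interpret r: lots r by unfold_locales fact
  interpret s: lots s by unfold_locales fact
  note mono = r.strict_map_mono[OF assms(2,4)]
  have S: "S \<subseteq> Field r" using assms(1) by (simp add: gapped_def)
  show ?thesis
    unfolding gapped_def
  proof (intro conjI allI impI ballI)
    show "h ` S \<subseteq> Field s" using assms(2) S by (auto simp: strict_map_def)
    fix T assume T: "T \<subseteq> h ` S" "T \<noteq> {}"
    let ?T = "{t \<in> S. h t \<in> T}"
    have "?T \<noteq> {}" "?T \<subseteq> S" using T by auto
    then obtain m where "m \<in> ?T" "\<forall>t\<in>?T. (m, t) \<in> r" using assms(1) unfolding gapped_def by meson
    then show "\<exists>m\<in>T. \<forall>t\<in>T. (m, t) \<in> s" using mono T(1) by (intro bexI[of _ "h m"]) auto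
  next
    fix s' assume "s' \<in> h ` S"
    then obtain a where a: "a \<in> S" "s' = h a" by blast
    then obtain b where b: "lt r b a" "\<And>t. t \<in> S \<Longrightarrow> lt r t a \<Longrightarrow> (t, b) \<in> r"
      using assms(1) unfolding gapped_def by meson
    have "(h t, h b) \<in> s" if t: "t \<in> S" "lt s (h t) (h a)" for t
    proof -
      have "\<not> (a, t) \<in> r" using mono t(2) s.lt_asym by blast
      then show ?thesis using r.not_le S t(1) a(1) b(2) mono by blast
    qed
    then show "\<exists>b. lt s b s' \<and> (\<forall>t\<in>h ` S. lt s t s' \<longrightarrow> (t, b) \<in> s)"
      using a(2) b(1) assms(2) by (intro exI[of _ "h b"]) (auto simp: strict_map_def)
  qed
qed

lemma precedes_image:
  assumes "precedes r S S'" "S \<subseteq> Field r" "S' \<subseteq> Field r"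
    "strict_map r s h" "Linear_order r" "Linear_order s"
  shows "precedes s (h ` S) (h ` S')"
proof -
  interpret r: lots r by unfold_locales fact
  interpret s: lots s by unfold_locales fact
  obtain a a' where a: "a \<in> S" "a' \<in> S'" "lt r a a'" "{t \<in> S. lt r t a} = {t \<in> S'. lt r t a'}"
    using assms(1) by (auto simp: precedes_def)
  have lt_iff: "lt s (h c) (h d) \<longleftrightarrow> lt r c d" if "c \<in> Field r" "d \<in> Field r" for c d
    using assms(4) r.strict_map_mono[OF assms(4,6)] r.not_lt[OF that] s.lt_asym unfolding strict_map_def by blast
  have "{t \<in> h ` S. lt s t (h a)} = h ` {t \<in> S. lt r t a}" using lt_iff assms(2) a(1) by blast
  moreover have "{t \<in> h ` S'. lt s t (h a')} = h ` {t \<in> S'. lt r t a'}" using lt_iff assms(3) a(2) by blast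
  ultimately have "{t \<in> h ` S. lt s t (h a)} = {t \<in> h ` S'. lt s t (h a')}" using a(4) by simp
  moreover have "lt s (h a) (h a')" using a(3) assms(4) by (simp add: strict_map_def)
  ultimately show ?thesis unfolding precedes_def using a(1,2) by blast
qed

section \<open>From gapped sets to branches and back\<close>

context continuum
begin

lemma ex_vertex_ran:
  assumes S: "gapped r S" and b: "b \<in> Field r" "\<And>s. s \<in> S \<Longrightarrow> (s, b) \<in> r"
  shows "\<exists>p\<in>vertices r. ran p = S"
proof -
  have SF: "S \<subseteq> Field r" using S by (simp add: gapped_def)
  have wo: "\<exists>m\<in>T. \<forall>t\<in>T. (m, t) \<in> r" if "T \<subseteq> S" "T \<noteq> {}" for T
    using S that by (simp add: gapped_def)
  from ex_ords_enumeration[OF SF wo] obtain \<gamma> :: "'a ords" and \<phi>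
    where \<phi>: "bij_betw \<phi> {..<\<gamma>} S" "\<And>i j. j < i \<Longrightarrow> i < \<gamma> \<Longrightarrow> lt r (\<phi> j) (\<phi> i)"
    by blast
  define p where "p i = (if i < \<gamma> then Some (\<phi> i) else None)" for i
  have ran: "ran p = S" using bij_betw_imp_surj_on[OF \<phi>(1)] by (auto simp: p_def ran_def)
  have "p \<in> vertices r"
  proof (rule vertexI)
    show "dom p = {..<\<gamma>}" by (auto simp: p_def split: if_splits)
    fix i a assume "p i = Some a"
    then have i: "i < \<gamma>" "a = \<phi> i" by (auto simp: p_def split: if_splits)
    have "\<phi> j \<in> S" if "j < \<gamma>" for j using bij_betwE[OF \<phi>(1)] that by blast
    then obtain c where c: "lt r c a" "\<And>t. t \<in> S \<Longrightarrow> lt r t a \<Longrightarrow> (t, c) \<in> r"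
      using S i unfolding gapped_def by meson
    have "(d, c) \<in> r" if "j < i" "p j = Some d" for j d
      using that \<phi>(2)[OF that(1) i(1)] i c(2) ran by (auto simp: p_def ran_def split: if_splits)
    then show "\<exists>b. lt r b a \<and> (\<forall>j<i. \<forall>c. p j = Some c \<longrightarrow> (c, b) \<in> r)" using c(1) by blast
  qed (use S b ran in \<open>auto simp: gapped_def\<close>)
  with ran show ?thesis by blast
qed

text \<open>A branch undefined at 0 would be empty and so contained in the empty vertex.\<close>

lemma branch_0_ex:
  assumes x: "x \<in> branches r"
  obtains a where "x 0 = Some a"
proof (cases "x 0")
  case None
  have "x i = None" for i using branch_down[OF x, of i _ 0] None zero_ords_less by (cases "x i") fastforce+
  then have "x \<subseteq>\<^sub>m Map.empty" by (simp add: map_le_def dom_def)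
  moreover have "Map.empty \<in> vertices r"
    using nonempty by (auto intro!: vertexI[where \<gamma> = 0])
  ultimately show ?thesis using branch_not_le_vertex[OF x] by blast
qed (use that in blast)

lemma branch_0:
  assumes "x \<in> branches r" 
  shows "x 0 = Some (the (x 0))" "the (x 0) \<in> Field r" "the (x 0) \<in> ran x"
    "t \<in> ran x \<Longrightarrow> (the (x 0), t) \<in> r"
proof -
  obtain a where a: "x 0 = Some a" by (rule branch_0_ex[OF assms])
  then show "x 0 = Some (the (x 0))" "the (x 0) \<in> Field r" "the (x 0) \<in> ran x"
    using branch_Field[OF assms a] by (auto intro: ranI)
  assume "t \<in> ran x"
  then obtain i where i: "x i = Some t" by (auto simp: ran_def)
  show "(the (x 0), t) \<in> r"
  proof (cases "i = 0")
    case True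
    then show ?thesis using a i branch_Field[OF assms a] by simp
  next
    case False
    then show ?thesis using branch_mono[OF assms _ a i] a by (simp add: zero_ords_less lt_imp_le)
  qed
qed

lemma branch_ran_Field: "x \<in> branches r \<Longrightarrow> ran x \<subseteq> Field r"
  using branch_Field by (auto simp: ran_def)

lemma branch_less_iff:
  assumes "x \<in> branches r" "x i = Some a" "x j = Some b"
  shows "lt r b a \<longleftrightarrow> j < i"
  using branch_mono[OF assms(1) _ assms(3,2)] branch_mono[OF assms(1) _ assms(2,3)] assms lt_asym
  by (metis lt_imp_le lt_irrefl linorder_neqE option.inject)

lemma branch_gapped:
  assumes x: "x \<in> branches r"
  shows "gapped r (ran x)"
  unfolding gapped_def
proof (intro conjI allI impI ballI)
  show "ran x \<subseteq> Field r" by (rule branch_ran_Field[OF x])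
  fix T assume T: "T \<subseteq> ran x" "T \<noteq> {}"
  then obtain t where "t \<in> T" "t \<in> ran x" by blast
  then obtain k where k: "x k \<in> Some ` T" by (auto simp: ran_def)
  define i where "i = (LEAST i. x i \<in> Some ` T)"
  have "x i \<in> Some ` T" unfolding i_def by (rule LeastI) fact
  then obtain m where m: "x i = Some m" "m \<in> T" by blast
  have "(m, t) \<in> r" if t: "t \<in> T" for t
  proof -
    obtain j where j: "x j = Some t" using t T(1) by (auto simp: ran_def)
    then have "i \<le> j" unfolding i_def using t by (intro Least_le) simp
    then show ?thesis
      using branch_less_iff[OF x m(1) j] branch_Field[OF x] m j not_lt by auto
  qed
  then show "\<exists>m\<in>T. \<forall>t\<in>T. (m, t) \<in> r" using m by blast
next
  fix s assume "s \<in> ran x"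
  then obtain i where i: "x i = Some s" by (auto simp: ran_def)
  obtain q where q: "q \<in> vertices r" "q \<subseteq>\<^sub>m x" "\<And>j. j \<le> i \<Longrightarrow> q j = x j"
    using branch_vertexE[OF x i] by blast
  have "q i = Some s" using i q(3) by simp
  then obtain b where b: "lt r b s" "\<And>j c. j < i \<Longrightarrow> q j = Some c \<Longrightarrow> (c, b) \<in> r"
    using q(1) by (elim vertexE) metis
  have "(t, b) \<in> r" if t: "t \<in> ran x" "lt r t s" for t
  proof -
    obtain j where j: "x j = Some t" using t(1) by (auto simp: ran_def)
    then have "j < i" using branch_less_iff[OF x i j] t(2) by blast
    then show ?thesis using b(2)[of j t] q(3)[of j] j by simp
  qed
  then show "\<exists>b. lt r b s \<and> (\<forall>t\<in>ran x. lt r t s \<longrightarrow> (t, b) \<in> r)" using b(1) by blast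
qed

lemma branch_precedes:
  assumes "lt (branch_space r) x y"
  shows "precedes r (ran x) (ran y)"
proof -
  obtain i a b where x: "x \<in> branches r" and y: "y \<in> branches r"
    and i: "\<And>j. j < i \<Longrightarrow> x j = y j" "x i = Some a" "y i = Some b" "lt r a b"
    using assms by (auto simp: lt_branch_space)
  have "{t \<in> ran z. lt r t c} = {t. \<exists>j<i. z j = Some t}" if "z \<in> branches r" "z i = Some c" for z c
    using branch_less_iff[OF that] by (auto simp: ran_def)
  from this[OF x i(2)] this[OF y i(3)] have "{t \<in> ran x. lt r t a} = {t \<in> ran y. lt r t b}"
    using i(1) by auto
  then show ?thesis unfolding precedes_def using i(2-4) by (auto intro: ranI)
qed

text \<open>Beyond the vertex with range \<open>S\<close> the branch is arbitrary. This does no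
  harm, as comparisons are decided at elements of the sets involved.\<close>

definition br :: "'a set \<Rightarrow> 'a ords \<rightharpoonup> 'a" where
  "br S = (SOME x. x \<in> branches r \<and> (\<exists>p\<in>vertices r. ran p = S \<and> p \<subseteq>\<^sub>m x))"

lemma br:
  assumes "gapped r S" "b \<in> Field r" "\<And>s. s \<in> S \<Longrightarrow> (s, b) \<in> r"
  shows "br S \<in> branches r" "\<exists>p\<in>vertices r. ran p = S \<and> p \<subseteq>\<^sub>m br S"
proof -
  obtain p where p: "p \<in> vertices r" "ran p = S" using ex_vertex_ran[OF assms] by blast
  obtain x where "x \<in> branches r" "p \<subseteq>\<^sub>m x" using vertex_le_branch[OF p(1)] by blast
  then have "\<exists>x. x \<in> branches r \<and> (\<exists>p\<in>vertices r. ran p = S \<and> p \<subseteq>\<^sub>m x)" using p by blast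
  from someI_ex[OF this, folded br_def]
  show "br S \<in> branches r" "\<exists>p\<in>vertices r. ran p = S \<and> p \<subseteq>\<^sub>m br S" by blast+
qed

lemma vertex_less_iff:
  assumes "p \<in> vertices r" "p i = Some a" "p j = Some b"
  shows "lt r b a \<longleftrightarrow> j < i"
  using vertex_mono[OF assms(1) _ assms(3,2)] vertex_mono[OF assms(1) _ assms(2,3)] assms lt_asym
  by (metis lt_imp_le lt_irrefl linorder_neqE option.inject)

text \<open>Equal sets below \<open>a\<close> and \<open>a'\<close> force equal enumerations. Each
  of the two values at j occurs in the other vertex, and not before j, where the vertices agree and
  are strictly increasing. So neither value is less than the other.\<close>

lemma vertex_agree:
  assumes p: "p \<in> vertices r" "p i = Some a" and p': "p' \<in> vertices r" "p' i' = Some a'"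
    and eq: "{t \<in> ran p. lt r t a} = {t \<in> ran p'. lt r t a'}"
  shows "j < i \<Longrightarrow> j < i' \<and> p j = p' j"
proof (induction j rule: less_induct)
  case (less j)
  have IH: "p k = p' k" if "k < j" for k using less that by (meson order.strict_trans)
  obtain t where t: "p j = Some t" using vertex_down[OF p less.prems] by blast
  then have "t \<in> {t \<in> ran p. lt r t a}" using vertex_less_iff[OF p t] less.prems by (auto intro: ranI)
  then have "t \<in> ran p'" "lt r t a'" unfolding eq by auto
  then obtain l where l: "p' l = Some t" by (auto simp: ran_def)
  then have "l < i'" using vertex_less_iff[OF p' l] \<open>lt r t a'\<close> by blast
  have "\<not> l < j"
  proof
    assume "l < j"
    then have "p l = Some t" using IH l by simp
    then show False using vertex_less_iff[OF p(1) t] \<open>l < j\<close> by fastforce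
  qed
  then have j: "j < i'" using \<open>l < i'\<close> by simp
  obtain t' where t': "p' j = Some t'" using vertex_down[OF p' j] by blast
  then have "t' \<in> {t \<in> ran p'. lt r t a'}" using vertex_less_iff[OF p' t'] j by (auto intro: ranI)
  then have "t' \<in> ran p" unfolding eq[symmetric] by auto
  then obtain m where m: "p m = Some t'" by (auto simp: ran_def)
  have "\<not> m < j"
  proof
    assume "m < j"
    then have "p' m = Some t'" using IH m by simp
    then show False using vertex_less_iff[OF p'(1) t'] \<open>m < j\<close> by fastforce
  qed
  then have "\<not> lt r t' t" using vertex_less_iff[OF p(1) t m] by simp
  moreover have "\<not> lt r t t'" using vertex_less_iff[OF p'(1) t' l] \<open>\<not> l < j\<close> by simp
  moreover have "t \<in> Field r" "t' \<in> Field r" using t t' p(1) p'(1) by (auto elim!: vertexE intro: ranI)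
  ultimately have "t = t'" using le_cases by blast
  then show ?case using j t t' by simp
qed

text \<open>A common notion for \<open>br S\<close> and for a branch with its own range. The vertex
  may depend on \<open>a\<close>, because the full range of a branch is not the range of a single
  vertex inside it.\<close>

definition realizes :: "('a ords \<rightharpoonup> 'a) \<Rightarrow> 'a set \<Rightarrow> bool" where
  "realizes x S \<longleftrightarrow> x \<in> branches r \<and> (\<forall>a\<in>S. \<exists>p\<in>vertices r. p \<subseteq>\<^sub>m x \<and> a \<in> ran p \<and>
     {t \<in> ran p. lt r t a} = {t \<in> S. lt r t a})"

lemma realizes_br:
  assumes "gapped r S" "b \<in> Field r" "\<And>s. s \<in> S \<Longrightarrow> (s, b) \<in> r"
  shows "realizes (br S) S"
  using br[OF assms] unfolding realizes_def by blast

lemma realizes_ran: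
  assumes x: "x \<in> branches r"
  shows "realizes x (ran x)"
  unfolding realizes_def
proof (intro conjI ballI x)
  fix a assume "a \<in> ran x"
  then obtain i where i: "x i = Some a" by (auto simp: ran_def)
  obtain q where q: "q \<in> vertices r" "q \<subseteq>\<^sub>m x" "\<And>j. j \<le> i \<Longrightarrow> q j = x j"
    using branch_vertexE[OF x i] by blast
  have "ran q \<subseteq> ran x" using q(2) by (force simp: ran_def map_le_def dom_def)
  moreover have "t \<in> ran q" if t: "t \<in> ran x" "lt r t a" for t
  proof -
    obtain j where j: "x j = Some t" using t(1) by (auto simp: ran_def)
    then have "j < i" using branch_less_iff[OF x i j] t(2) by blast
    then have "q j = Some t" using q(3)[of j] j by simp
    then show ?thesis by (rule ranI)
  qed
  ultimately have "{t \<in> ran q. lt r t a} = {t \<in> ran x. lt r t a}" by blast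
  moreover have "a \<in> ran q" using q(3)[of i] i by (auto intro: ranI)
  ultimately show "\<exists>p\<in>vertices r. p \<subseteq>\<^sub>m x \<and> a \<in> ran p \<and> {t \<in> ran p. lt r t a} = {t \<in> ran x. lt r t a}"
    using q(1,2) by blast
qed

text \<open>By \<open>vertex_agree\<close>, applied in both directions, the vertices through
  \<open>a\<close> and \<open>a'\<close> reach these values at the same index and agree before it;
  so this index is the first difference of \<open>x\<close> and \<open>y\<close>.\<close>

lemma realizes_less:
  assumes x: "realizes x S" and y: "realizes y S'" and "precedes r S S'"
  shows "lt (branch_space r) x y"
proof -
  obtain a a' where a: "a \<in> S" "a' \<in> S'" "lt r a a'" "{t \<in> S. lt r t a} = {t \<in> S'. lt r t a'}"
    using assms(3) by (auto simp: precedes_def)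
  obtain p where p: "p \<in> vertices r" "p \<subseteq>\<^sub>m x" "a \<in> ran p" "{t \<in> ran p. lt r t a} = {t \<in> S. lt r t a}"
    using x a(1) by (auto simp: realizes_def)
  obtain p' where p': "p' \<in> vertices r" "p' \<subseteq>\<^sub>m y" "a' \<in> ran p'"
    "{t \<in> ran p'. lt r t a'} = {t \<in> S'. lt r t a'}"
    using y a(2) by (auto simp: realizes_def)
  obtain i i' where i: "p i = Some a" "p' i' = Some a'" using p(3) p'(3) by (auto simp: ran_def)
  have eq: "{t \<in> ran p. lt r t a} = {t \<in> ran p'. lt r t a'}" using a(4) p(4) p'(4) by simp
  note agree = vertex_agree[OF p(1) i(1) p'(1) i(2) eq]
  have "j < i" if "j < i'" for j
    using vertex_agree[OF p'(1) i(2) p(1) i(1) eq[symmetric] that] by blast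
  then have ii: "i = i'" using agree by (metis linorder_neqE less_irrefl)
  have "x j = y j" if j: "j < i" for j
  proof -
    obtain c where "p j = Some c" using vertex_down[OF p(1) i(1) j] by blast
    then show ?thesis using agree[OF j] p(2) p'(2) by (metis domI map_le_def)
  qed
  moreover have "x i = Some a" "y i = Some a'"
    using i ii p(2) p'(2) by (metis domI map_le_def)+
  ultimately show ?thesis unfolding lt_branch_space using x y a(3) by (auto simp: realizes_def)
qed

lemma br_0:
  assumes S: "gapped r S" "b \<in> Field r" "\<And>s. s \<in> S \<Longrightarrow> (s, b) \<in> r"
    and m: "m \<in> S" "\<And>s. s \<in> S \<Longrightarrow> (m, s) \<in> r"
  shows "br S 0 = Some m"
proof -
  obtain p where p: "p \<in> vertices r" "ran p = S" "p \<subseteq>\<^sub>m br S" using br(2)[OF S] by blast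
  obtain i where i: "p i = Some m" using m(1) p(2) by (auto simp: ran_def)
  have "i = 0"
  proof (rule ccontr)
    assume "i \<noteq> 0"
    then obtain c where c: "p 0 = Some c" using vertex_down[OF p(1) i] zero_ords_less by blast
    then have "lt r c m" using vertex_mono[OF p(1) _ c i] \<open>i \<noteq> 0\<close> zero_ords_less by blast
    moreover have "(m, c) \<in> r" using c p(2) m(2) by (auto intro: ranI)
    ultimately show False using lt_asym by blast
  qed
  then show ?thesis using i p(3) by (metis domI map_le_def)
qed

section \<open>Concatenation of gapped sets and branches with a given first value\<close>

lemma gapped_subset:
  assumes "gapped r S" "T \<subseteq> S"
  shows "gapped r T"
  unfolding gapped_def
proof (intro conjI allI impI ballI)
  show "T \<subseteq> Field r" using assms by (auto simp: gapped_def)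
  show "\<exists>m\<in>U. \<forall>t\<in>U. (m, t) \<in> r" if "U \<subseteq> T" "U \<noteq> {}" for U
    using assms that by (simp add: gapped_def)
  show "\<exists>b. lt r b s \<and> (\<forall>t\<in>T. lt r t s \<longrightarrow> (t, b) \<in> r)" if "s \<in> T" for s
    using assms that unfolding gapped_def by (meson subsetD)
qed

lemma gapped_append:
  assumes A: "gapped r A" and B: "gapped r B"
    and c: "\<And>a. a \<in> A \<Longrightarrow> (a, c) \<in> r" "\<And>b. b \<in> B \<Longrightarrow> lt r c b"
  shows "gapped r (A \<union> B)"
  unfolding gapped_def
proof (intro conjI allI impI ballI)
  show "A \<union> B \<subseteq> Field r" using A B by (simp add: gapped_def)
  have less: "lt r a b" if "a \<in> A" "b \<in> B" for a b using c that le_lt_trans by blast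
  show "\<exists>m\<in>T. \<forall>t\<in>T. (m, t) \<in> r" if T: "T \<subseteq> A \<union> B" "T \<noteq> {}" for T
  proof (cases "T \<inter> A = {}")
    case True
    then have "T \<subseteq> B" using T by blast
    then show ?thesis using B T(2) by (simp add: gapped_def)
  next
    case False
    then obtain m where m: "m \<in> T \<inter> A" "\<forall>t\<in>T \<inter> A. (m, t) \<in> r" using A unfolding gapped_def by (meson inf_le2)
    moreover have "(m, t) \<in> r" if "t \<in> T" "t \<notin> A" for t using less[of m t] m that T by (auto simp: lt_imp_le)
    ultimately show ?thesis by blast
  qed
  fix s assume "s \<in> A \<union> B"
  then consider "s \<in> A" | "s \<in> B" by blast
  then show "\<exists>b. lt r b s \<and> (\<forall>t\<in>A \<union> B. lt r t s \<longrightarrow> (t, b) \<in> r)"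
  proof cases
    case 1
    then obtain b where "lt r b s" "\<forall>t\<in>A. lt r t s \<longrightarrow> (t, b) \<in> r" using A unfolding gapped_def by meson
    moreover have "\<not> lt r t s" if "t \<in> B" for t using less[OF 1 that] lt_asym[of s t] lt_imp_le[of r t s] by blast
    ultimately show ?thesis by blast
  next
    case 2
    then obtain b where b: "lt r b s" "\<forall>t\<in>B. lt r t s \<longrightarrow> (t, b) \<in> r" using B unfolding gapped_def by meson
    \<comment> \<open>The bound below \<open>s\<close> has to dominate all of \<open>A\<close> as
      well as the part of \<open>B\<close> below \<open>s\<close>: \<open>d\<close> is the larger of
      \<open>b\<close> and \<open>c\<close>.\<close>
    have "\<exists>d. (b, d) \<in> r \<and> (c, d) \<in> r \<and> lt r d s"
    proof (cases "lt r b c")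
      case True
      then show ?thesis
        using c(2)[OF 2] lt_imp_le[OF True] le_refl[OF lt_Field(2)[OF True]] by blast
    next
      case False
      then have "(c, b) \<in> r" using not_lt lt_Field(1)[OF b(1)] lt_Field(1)[OF c(2)[OF 2]] by blast
      then show ?thesis using b(1) le_refl[OF lt_Field(1)[OF b(1)]] by blast
    qed
    then obtain d where d: "(b, d) \<in> r" "(c, d) \<in> r" "lt r d s" by blast
    have "(t, d) \<in> r" if t: "t \<in> A \<union> B" "lt r t s" for t
      using t(1) le_trans[OF c(1) d(2)] le_trans[OF _ d(1)] b(2) t(2) by blast
    then show ?thesis using d(3) by blast
  qed
qed

lemma precedes_append:
  assumes "precedes r A B" "\<And>q a. q \<in> Q \<Longrightarrow> a \<in> A \<union> B \<Longrightarrow> lt r q a"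
  shows "precedes r (Q \<union> A) (Q \<union> B)"
proof -
  obtain a b where a: "a \<in> A" "b \<in> B" "lt r a b" "{t \<in> A. lt r t a} = {t \<in> B. lt r t b}"
    using assms(1) by (auto simp: precedes_def)
  have "{t \<in> Q \<union> A. lt r t a} = Q \<union> {t \<in> A. lt r t a}" "{t \<in> Q \<union> B. lt r t b} = Q \<union> {t \<in> B. lt r t b}"
    using assms(2) a(1,2) by auto
  then have "{t \<in> Q \<union> A. lt r t a} = {t \<in> Q \<union> B. lt r t b}" using a(4) by simp
  then show ?thesis unfolding precedes_def using a(1-3) by blast
qed

lemma singleton_gapped: "c \<in> Field r \<Longrightarrow> gapped r {c}"
  using no_min[of c] by (auto simp: gapped_def subset_singleton_iff)

text \<open>These branches make the projection surjective and serve as test points over prescribed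
  values.\<close>

lemma br_singleton:
  assumes "c \<in> Field r"
  shows "br {c} \<in> branches r" "br {c} 0 = Some c"
  using br(1)[OF singleton_gapped[OF assms] assms] br_0[OF singleton_gapped[OF assms] assms] assms by auto

lemma lt_branch_space_0:
  assumes "x \<in> branches r" "y \<in> branches r" "lt r (the (x 0)) (the (y 0))"
  shows "lt (branch_space r) x y"
  unfolding lt_branch_space using assms branch_0(1) by (intro conjI exI[of _ 0]) auto

lemma branch_space_0_mono:
  assumes "lt (branch_space r) x y"
  shows "(the (x 0), the (y 0)) \<in> r"
proof -
  obtain i a b where x: "x \<in> branches r" and y: "y \<in> branches r"
    and i: "\<And>j. j < i \<Longrightarrow> x j = y j" "x i = Some a" "y i = Some b" "lt r a b"
    using assms by (auto simp: lt_branch_space)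
  show ?thesis
    using i branch_0(2)[OF x] by (cases "i = 0") (auto simp: lt_imp_le zero_ords_less)
qed

end

section \<open>The completion of the branch space\<close>

text \<open>\<open>complete_lots\<close> asks for a lower bound too. Keeping only the members of
  \<open>S\<close> above one of them, \<open>a\<close>, supplies it and leaves the supremum
  unchanged.\<close>

lemma complete_lots_bounded_sup:
  assumes "complete_lots r" "S \<subseteq> Field r" "S \<noteq> {}" "b \<in> Field r" "\<And>a. a \<in> S \<Longrightarrow> (a, b) \<in> r"
  shows "\<exists>s. is_sup r S s"
proof -
  interpret lots r using assms(1) by unfold_locales (simp add: complete_lots_def)
  obtain a where a: "a \<in> S" using assms(3) by blast
  let ?S = "{s \<in> S. (a, s) \<in> r}"
  have aF: "a \<in> Field r" using a assms(2) by blast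
  then have "a \<in> ?S" using a by simp
  moreover have "b \<in> Above r ?S" using assms(4,5) by (auto simp: Above_def)
  moreover have "a \<in> Under r ?S" using aF by (auto simp: Under_def)
  ultimately obtain s where s: "is_sup r ?S s"
    using assms(1,2) unfolding complete_lots_def by (metis (no_types, lifting) empty_iff mem_Collect_eq subset_iff)
  have "is_sup r S s"
    unfolding is_sup_def Above_def
  proof (intro conjI CollectI ballI)
    show "s \<in> Field r" by (rule sup_Field[OF s])
    fix t assume t: "t \<in> S"
    show "(t, s) \<in> r"
    proof (cases "(a, t) \<in> r")
      case True
      then show ?thesis using sup_upper[OF s] t by simp
    next
      case False
      then have "lt r t a" using not_le aF t assms(2) by blast
      then show ?thesis using le_trans[OF lt_imp_le sup_upper[OF s \<open>a \<in> ?S\<close>]] by blast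
    qed
  qed (use sup_least[OF s] in auto)
  then show ?thesis by blast
qed

lemma openin_open_interval:
  assumes "a \<in> Field r" "b \<in> Field r"
  shows "openin (order_topology r) {c. lt r a c \<and> lt r c b}"
proof -
  have "{c. lt r a c \<and> lt r c b} = aboveS r a \<inter> underS r b"
    by (auto simp: lt_def aboveS_def underS_def)
  moreover have "openin (order_topology r) (aboveS r a)" "openin (order_topology r) (underS r b)"
    unfolding order_topology_def using assms by (auto intro: topology_generated_by_Basis)
  ultimately show ?thesis by (simp add: openin_Int)
qed

locale branch_completion = continuum +
  fixes Z :: "'b rel" and e and \<pi> :: "'b \<Rightarrow> 'a"
  assumes completion: "is_completion (branch_space r) Z e"
    and pi: "z \<in> Field Z \<Longrightarrow> is_sup r {the (x 0) |x. x \<in> branches r \<and> (e x, z) \<in> Z} (\<pi> z)"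
begin

sublocale Z: lots Z
  using completion by unfold_locales (simp add: is_completion_def complete_lots_def)

lemma Z_bounded_sup:
  "S \<subseteq> Field Z \<Longrightarrow> S \<noteq> {} \<Longrightarrow> b \<in> Field Z \<Longrightarrow> (\<And>a. a \<in> S \<Longrightarrow> (a, b) \<in> Z) \<Longrightarrow> \<exists>s. is_sup Z S s"
  using completion by (intro complete_lots_bounded_sup) (auto simp: is_completion_def)

lemma e_Field: "x \<in> branches r \<Longrightarrow> e x \<in> Field Z"
  using completion by (auto simp: is_completion_def order_map_def)

lemma e_strict: "lt (branch_space r) x y \<Longrightarrow> lt Z (e x) (e y)"
  using completion unfolding is_completion_def order_map_def inj_on_def Field_branch_space
  by (metis DiffE DiffI Field_branch_space lt_Field lt_def pair_in_Id_conv)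

lemma e_less_iff:
  assumes "x \<in> branches r" "y \<in> branches r"
  shows "lt Z (e x) (e y) \<longleftrightarrow> lt (branch_space r) x y"
  using e_strict branch_space_cases[OF assms] Z.lt_asym lt_imp_le lt_irrefl by metis

text \<open>Order density makes the open interval nonempty, and then the dense image of the branches
  meets it.\<close>

lemma between:
  assumes "lt Z z z'"
  obtains x where "x \<in> branches r" "lt Z z (e x)" "lt Z (e x) z'"
proof -
  have "order_dense Z" and cl: "order_topology Z closure_of (e ` branches r) = Field Z"
    using completion by (auto simp: is_completion_def)
  then obtain t where t: "lt Z z t" "lt Z t z'"
    using assms unfolding order_dense_def lt_def by blast
  then have "t \<in> order_topology Z closure_of (e ` branches r)" using cl lt_Field(2)[OF t(1)] by simp
  moreover have "openin (order_topology Z) {c. lt Z z c \<and> lt Z c z'}"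
    using assms by (intro openin_open_interval lt_Field)
  ultimately have "\<exists>c. c \<in> e ` branches r \<and> c \<in> {c. lt Z z c \<and> lt Z c z'}"
    unfolding in_closure_of using t by (elim conjE allE[of _ "{c. lt Z z c \<and> lt Z c z'}"]) simp
  then show thesis using that by blast
qed

text \<open>A maximum of the completion would give a greatest branch, but a branch starting above
  its first value is greater.\<close>

lemma Z_no_max:
  assumes "z \<in> Field Z"
  shows "\<exists>w. lt Z z w"
proof (rule ccontr)
  assume no: "\<not> ?thesis"
  have "(w, z) \<in> Z" if "w \<in> Field Z" for w using Z.not_lt[OF assms that] no by blast
  then have "is_sup Z (Field Z) z" using assms by (auto simp: is_sup_def Above_def)
  then obtain x where "is_sup (branch_space r) (branches r) x"
    using completion unfolding is_completion_def by auto
  then have x: "x \<in> branches r" "\<And>y. y \<in> branches r \<Longrightarrow> (y, x) \<in> branch_space r"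
    by (auto simp: is_sup_def Above_def)
  obtain c where c: "lt r (the (x 0)) c" using no_max branch_0[OF x(1)] by blast
  let ?y = "br {c}"
  have y: "?y \<in> branches r" "?y 0 = Some c" using br_singleton lt_Field(2)[OF c] by auto
  then have "lt (branch_space r) x ?y" using c x(1) by (intro lt_branch_space_0) auto
  then have "lt Z (e x) (e ?y)" by (rule e_strict)
  moreover have "(e ?y, e x) \<in> Z"
    using x(2)[OF y(1)] completion by (auto simp: is_completion_def order_map_def)
  ultimately show False using Z.lt_asym by blast
qed

lemma Z_no_min:
  assumes "z \<in> Field Z"
  shows "\<exists>w. lt Z w z"
proof (rule ccontr)
  assume no: "\<not> ?thesis"
  have "(z, w) \<in> Z" if "w \<in> Field Z" for w using Z.not_lt[OF that assms] no by blast
  then have "is_inf Z (Field Z) z" using assms by (auto simp: is_inf_def Under_def)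
  then obtain x where "is_inf (branch_space r) (branches r) x"
    using completion unfolding is_completion_def by auto
  then have x: "x \<in> branches r" "\<And>y. y \<in> branches r \<Longrightarrow> (x, y) \<in> branch_space r"
    by (auto simp: is_inf_def Under_def)
  obtain c where c: "lt r c (the (x 0))" using no_min branch_0[OF x(1)] by blast
  let ?y = "br {c}"
  have y: "?y \<in> branches r" "?y 0 = Some c" using br_singleton lt_Field(1)[OF c] by auto
  then have "lt (branch_space r) ?y x" using c x(1) by (intro lt_branch_space_0) auto
  then have "lt Z (e ?y) (e x)" by (rule e_strict)
  moreover have "(e x, e ?y) \<in> Z"
    using x(2)[OF y(1)] completion by (auto simp: is_completion_def order_map_def)
  ultimately show False using Z.lt_asym by blast
qed

text \<open>A point goes to the supremum of the images of the branches below it. The extra member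
  \<open>m z\<close> lets a lower bound for the value at \<open>z\<close> be prescribed; it must not
  exceed the image of any branch above \<open>z\<close>.\<close>

lemma extend_to_completion:
  assumes W: "Linear_order W"
    and W_sup: "\<And>S b. S \<subseteq> Field W \<Longrightarrow> S \<noteq> {} \<Longrightarrow> b \<in> Field W \<Longrightarrow> (\<And>a. a \<in> S \<Longrightarrow> (a, b) \<in> W) \<Longrightarrow>
      \<exists>s. is_sup W S s"
    and k: "\<And>x. x \<in> branches r \<Longrightarrow> k x \<in> Field W"
      "\<And>x y. lt (branch_space r) x y \<Longrightarrow> lt W (k x) (k y)"
    and m: "\<And>z. z \<in> Field Z \<Longrightarrow> m z \<in> Field W"
      "\<And>z x. x \<in> branches r \<Longrightarrow> lt Z z (e x) \<Longrightarrow> (m z, k x) \<in> W"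
  shows "\<exists>\<Phi>. strict_map Z W \<Phi> \<and>
    (\<forall>z\<in>Field Z. is_sup W (insert (m z) {k x |x. x \<in> branches r \<and> (e x, z) \<in> Z}) (\<Phi> z))"
proof -
  interpret W: lots W by unfold_locales fact
  let ?S = "\<lambda>z. insert (m z) {k x |x. x \<in> branches r \<and> (e x, z) \<in> Z}"
  have ub: "(a, k x) \<in> W" if a: "a \<in> ?S z" and x: "x \<in> branches r" "lt Z z (e x)" for a x z
  proof (cases "a = m z")
    case False
    then obtain y where y: "a = k y" "y \<in> branches r" "(e y, z) \<in> Z" using a by blast
    then have "lt (branch_space r) y x" using Z.le_lt_trans x e_less_iff by blast
    then show ?thesis using lt_imp_le[OF k(2)] y(1) by simp
  qed (use x m(2) in blast)
  have "\<exists>s. is_sup W (?S z) s" if z: "z \<in> Field Z" for z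
  proof -
    obtain w where "lt Z z w" using Z_no_max z by blast
    then obtain x where x: "x \<in> branches r" "lt Z z (e x)" using between by blast
    show ?thesis by (rule W_sup[of _ "k x"]) (use k(1) m(1)[OF z] x ub in auto)
  qed
  then have "\<forall>z\<in>Field Z. \<exists>s. is_sup W (?S z) s" by (rule ballI)
  from bchoice[OF this] obtain \<Phi> where \<Phi>: "\<And>z. z \<in> Field Z \<Longrightarrow> is_sup W (?S z) (\<Phi> z)" by blast
  have "lt W (\<Phi> z) (\<Phi> z')" if zz': "lt Z z z'" for z z'
  proof -
    \<comment> \<open>Two branches are needed: \<open>k x\<close> bounds the value at
      \<open>z\<close> from above, and the strictly larger \<open>k y\<close> lies below the value
      at \<open>z'\<close>.\<close>
    obtain x where x: "x \<in> branches r" "lt Z z (e x)" "lt Z (e x) z'" using between[OF zz'] by blast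
    obtain y where y: "y \<in> branches r" "lt Z (e x) (e y)" "lt Z (e y) z'" using between[OF x(3)] by blast
    have "(\<Phi> z, k x) \<in> W"
      using W.sup_least[OF \<Phi>[OF lt_Field(1)[OF zz']] k(1)[OF x(1)] ub[OF _ x(1,2)]] .
    moreover have "lt W (k x) (k y)" using k(2) e_less_iff x(1) y(1,2) by blast
    moreover have "(k y, \<Phi> z') \<in> W"
      using y(1) lt_imp_le[OF y(3)] by (intro W.sup_upper[OF \<Phi>[OF lt_Field(2)[OF zz']]]) blast
    ultimately show ?thesis using W.le_lt_trans W.lt_le_trans by blast
  qed
  then have "strict_map Z W \<Phi>" using W.sup_Field[OF \<Phi>] by (auto simp: strict_map_def)
  then show ?thesis using \<Phi> by blast
qed

section \<open>The projection to F and the lifting of self-maps\<close>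

lemma pi_Field: "z \<in> Field Z \<Longrightarrow> \<pi> z \<in> Field r"
  using sup_Field[OF pi] .

lemma pi_mono:
  assumes "(z, z') \<in> Z"
  shows "(\<pi> z, \<pi> z') \<in> r"
proof (rule sup_least[OF pi])
  show "z \<in> Field Z" "\<pi> z' \<in> Field r" using assms pi_Field by (auto simp: Field_def)
  fix a assume "a \<in> {the (x 0) |x. x \<in> branches r \<and> (e x, z) \<in> Z}"
  then obtain x where "a = the (x 0)" "x \<in> branches r" "(e x, z') \<in> Z"
    using Z.le_trans assms by blast
  then show "(a, \<pi> z') \<in> r" using assms by (intro sup_upper[OF pi]) (auto simp: Field_def)
qed

text \<open>Branches below \<open>x\<close> start at or below \<open>x 0\<close>, and
  \<open>x\<close> itself attains this value.\<close>

lemma pi_e: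
  assumes "x \<in> branches r"
  shows "\<pi> (e x) = the (x 0)"
proof (rule sup_unique[OF pi[OF e_Field[OF assms]]])
  have "(the (y 0), the (x 0)) \<in> r" if y: "y \<in> branches r" "(e y, e x) \<in> Z" for y
    using branch_space_cases[OF y(1) assms] e_strict Z.lt_asym y(2) branch_space_0_mono
      branch_0(2)[OF assms] le_refl by metis
  then show "is_sup r {the (y 0) |y. y \<in> branches r \<and> (e y, e x) \<in> Z} (the (x 0))"
    using assms branch_0(2)[OF assms] Z.le_refl[OF e_Field[OF assms]]
    by (auto simp: is_sup_def Above_def)
qed

lemma pi_surj:
  assumes "c \<in> Field r"
  shows "\<exists>z\<in>Field Z. \<pi> z = c"
  using br_singleton[OF assms] pi_e e_Field by (metis option.sel)

text \<open>Below, \<open>bot c\<close> is the least point of the fibre of \<open>\<pi>\<close> over \<open>c\<close>. As \<open>h\<close> may jump at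
  \<open>c = \<pi> z\<close>, the supremum of the images of the branches below \<open>z\<close> can fall short of the fibre over
  \<open>h c\<close>; hence \<open>bot (h c)\<close> is included in it.\<close>

lemma pi_lift:
  assumes h: "strict_map r r h" and v: "\<And>a. a \<in> Field r \<Longrightarrow> lt r (h a) v"
  shows "\<exists>H. strict_map Z Z H \<and> (\<forall>z\<in>Field Z. \<pi> (H z) = h (\<pi> z))"
proof -
  note h_mono = strict_map_mono[OF h linear]
  have h_Field: "h a \<in> Field r" if "a \<in> Field r" for a using h that by (auto simp: strict_map_def)
  obtain a where "a \<in> Field r" using nonempty by blast
  then have vF: "v \<in> Field r" using v lt_Field(2) by metis
  have gapped: "gapped r (h ` ran x)" if "x \<in> branches r" for x
    using gapped_image[OF branch_gapped[OF that] h linear linear] .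
  have bound: "(s, v) \<in> r" if "s \<in> h ` ran x" "x \<in> branches r" for s x
    using that v branch_ran_Field[OF that(2)] by (auto intro!: lt_imp_le)
  have real: "realizes (br (h ` ran x)) (h ` ran x)" if x: "x \<in> branches r" for x
    by (rule realizes_br[OF gapped[OF x] vF]) (rule bound[OF _ x])
  \<comment> \<open>The image of the range is bounded by \<open>v\<close>, so it is the range of a
    vertex and can be prolonged to a branch.\<close>
  define k where "k x = e (br (h ` ran x))" for x :: "'a ords \<rightharpoonup> 'a"
  have br_h: "br (h ` ran x) \<in> branches r" "br (h ` ran x) 0 = Some (h (the (x 0)))" if x: "x \<in> branches r" for x
    using br(1)[OF gapped[OF x] vF bound[OF _ x]]
      br_0[OF gapped[OF x] vF bound[OF _ x], of "h (the (x 0))"] branch_0[OF x] h_mono by auto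
  have k_Field: "k x \<in> Field Z" if "x \<in> branches r" for x
    using br_h(1)[OF that] e_Field by (simp add: k_def)
  have k_strict: "lt Z (k x) (k y)" if xy: "lt (branch_space r) x y" for x y
  proof -
    have B: "x \<in> branches r" "y \<in> branches r" using lt_Field[OF xy] by simp_all
    have "precedes r (h ` ran x) (h ` ran y)"
      using precedes_image[OF branch_precedes[OF xy] _ _ h linear linear] branch_ran_Field B by blast
    then have "lt (branch_space r) (br (h ` ran x)) (br (h ` ran y))"
      by (rule realizes_less[OF real[OF B(1)] real[OF B(2)]])
    then show ?thesis unfolding k_def by (rule e_strict)
  qed
  have "\<exists>s. is_sup Z {e x |x. x \<in> branches r \<and> lt r (the (x 0)) c} s" if c: "c \<in> Field r" for c
  proof (rule Z_bounded_sup[of _ "e (br {c})"])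
    obtain d where d: "lt r d c" using no_min[OF c] by blast
    have "br {d} \<in> branches r" "lt r (the (br {d} 0)) c" using br_singleton d lt_Field(1)[OF d] by auto
    then show "{e x |x. x \<in> branches r \<and> lt r (the (x 0)) c} \<noteq> {}" by blast
    fix a assume "a \<in> {e x |x. x \<in> branches r \<and> lt r (the (x 0)) c}"
    then obtain x where x: "a = e x" "x \<in> branches r" "lt r (the (x 0)) c" by blast
    then have "lt (branch_space r) x (br {c})" using br_singleton[OF c] by (intro lt_branch_space_0) auto
    then show "(a, e (br {c})) \<in> Z" using x(1) lt_imp_le[OF e_strict] by simp
  qed (use e_Field br_singleton c in auto)
  then have "\<forall>c\<in>Field r. \<exists>s. is_sup Z {e x |x. x \<in> branches r \<and> lt r (the (x 0)) c} s" by (rule ballI)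
  from bchoice[OF this] obtain bot
    where bot: "\<And>c. c \<in> Field r \<Longrightarrow> is_sup Z {e x |x. x \<in> branches r \<and> lt r (the (x 0)) c} (bot c)"
    by blast
  have bot_le: "(bot c, e y) \<in> Z" if "c \<in> Field r" "y \<in> branches r" "(c, the (y 0)) \<in> r" for c y
  proof (rule Z.sup_least[OF bot[OF that(1)] e_Field[OF that(2)]])
    fix a assume "a \<in> {e x |x. x \<in> branches r \<and> lt r (the (x 0)) c}"
    then obtain x where x: "a = e x" "x \<in> branches r" "lt r (the (x 0)) c" by blast
    then have "lt (branch_space r) x y" using that lt_le_trans by (intro lt_branch_space_0) auto
    then show "(a, e y) \<in> Z" using x(1) lt_imp_le[OF e_strict] by simp
  qed
  have le_pi_bot: "(c, \<pi> (bot c)) \<in> r" if c: "c \<in> Field r" for c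
  proof (rule ccontr)
    have bF: "bot c \<in> Field Z" by (rule Z.sup_Field[OF bot[OF c]])
    assume "(c, \<pi> (bot c)) \<notin> r"
    then have "lt r (\<pi> (bot c)) c" using not_le c pi_Field[OF bF] by blast
    then obtain d where d: "lt r (\<pi> (bot c)) d" "lt r d c" using dense by blast
    have y: "br {d} \<in> branches r" "br {d} 0 = Some d" using br_singleton lt_Field(2)[OF d(1)] by auto
    then have "lt r (the (br {d} 0)) c" using d(2) by simp
    then have "(e (br {d}), bot c) \<in> Z" using y(1) by (intro Z.sup_upper[OF bot[OF c]]) blast
    moreover have "\<pi> (e (br {d})) = d" using pi_e[OF y(1)] y(2) by simp
    ultimately show False using pi_mono d(1) lt_asym by metis
  qed
  define m where "m z = bot (h (\<pi> z))" for z
  have m_Field: "m z \<in> Field Z" if "z \<in> Field Z" for z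
    unfolding m_def by (rule Z.sup_Field[OF bot[OF h_Field[OF pi_Field[OF that]]]])
  have m_le: "(m z, k x) \<in> Z" if "x \<in> branches r" "lt Z z (e x)" for z x
  proof -
    have "(h (\<pi> z), h (the (x 0))) \<in> r" using pi_mono[OF lt_imp_le[OF that(2)]] h_mono pi_e[OF that(1)] by simp
    then show ?thesis unfolding m_def k_def
      using br_h[OF that(1)] by (intro bot_le) (auto simp: Field_def)
  qed
  have "\<exists>H. strict_map Z Z H \<and>
    (\<forall>z\<in>Field Z. is_sup Z (insert (m z) {k x |x. x \<in> branches r \<and> (e x, z) \<in> Z}) (H z))"
  proof (rule extend_to_completion[OF Z.linear])
    show "\<exists>s. is_sup Z S s" if "S \<subseteq> Field Z" "S \<noteq> {}" "b \<in> Field Z" "\<And>a. a \<in> S \<Longrightarrow> (a, b) \<in> Z" for S b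
      using that by (rule Z_bounded_sup)
  qed (fact k_Field k_strict m_Field m_le)+
  then obtain H where H: "strict_map Z Z H"
    "\<And>z. z \<in> Field Z \<Longrightarrow> is_sup Z (insert (m z) {k x |x. x \<in> branches r \<and> (e x, z) \<in> Z}) (H z)"
    by blast
  have "\<pi> (H z) = h (\<pi> z)" if z: "z \<in> Field Z" for z
  proof -
    have F: "h (\<pi> z) \<in> Field r" "H z \<in> Field Z"
      using h_Field pi_Field[OF z] Z.sup_Field[OF H(2)[OF z]] by auto
    have "(m z, H z) \<in> Z" using Z.sup_upper[OF H(2)[OF z]] by blast
    then have ge: "(h (\<pi> z), \<pi> (H z)) \<in> r"
      using le_pi_bot[OF F(1)] pi_mono le_trans unfolding m_def by blast
    \<comment> \<open>Otherwise a branch starting at some \<open>d\<close> strictly between would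
      bound the whole set whose supremum is \<open>H z\<close>, and the projection of
      \<open>H z\<close> would be at most \<open>d\<close>.\<close>
    have "\<not> lt r (h (\<pi> z)) (\<pi> (H z))"
    proof
      assume "lt r (h (\<pi> z)) (\<pi> (H z))"
      then obtain d where d: "lt r (h (\<pi> z)) d" "lt r d (\<pi> (H z))" using dense by blast
      let ?y = "br {d}"
      have y: "?y \<in> branches r" "?y 0 = Some d" using br_singleton lt_Field(2)[OF d(1)] by auto
      have "(H z, e ?y) \<in> Z"
      proof (rule Z.sup_least[OF H(2)[OF z] e_Field[OF y(1)]])
        fix a assume "a \<in> insert (m z) {k x |x. x \<in> branches r \<and> (e x, z) \<in> Z}"
        then consider "a = m z" | x where "a = k x" "x \<in> branches r" "(e x, z) \<in> Z" by blast
        then show "(a, e ?y) \<in> Z"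
        proof cases
          case 1
          then show ?thesis unfolding m_def using bot_le[OF F(1) y(1)] y(2) lt_imp_le[OF d(1)] by simp
        next
          case 2
          have "(h (the (x 0)), h (\<pi> z)) \<in> r" using pi_mono[OF 2(3)] pi_e[OF 2(2)] h_mono by simp
          then have "lt r (h (the (x 0))) d" using d(1) le_lt_trans by blast
          then have "lt (branch_space r) (br (h ` ran x)) ?y"
            using br_h[OF 2(2)] y by (intro lt_branch_space_0) auto
          then show ?thesis using 2(1) lt_imp_le[OF e_strict] unfolding k_def by simp
        qed
      qed
      then have "(\<pi> (H z), d) \<in> r" using pi_mono pi_e[OF y(1)] y(2) by fastforce
      then show False using d(2) lt_asym by blast
    qed
    then show ?thesis using ge by (auto simp: lt_def)
  qed
  then show ?thesis using H(1) by blast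
qed

text \<open>The branches through a vertex contain a copy of the branch space; below, \<open>Q\<close> is the range of a
  vertex all of whose branches lie between \<open>z\<close> and \<open>z'\<close>.\<close>

lemma Z_self_map:
  assumes "lt Z z z'"
  shows "\<exists>f. strict_map Z Z f \<and> (\<forall>w\<in>Field Z. lt Z z (f w) \<and> lt Z (f w) z')"
proof -
  obtain x where x: "x \<in> branches r" "lt Z z (e x)" "lt Z (e x) z'" using between[OF assms] by blast
  obtain y where y: "y \<in> branches r" "lt Z (e x) (e y)" "lt Z (e y) z'" using between[OF x(3)] by blast
  have "lt (branch_space r) x y" using e_less_iff x y by blast
  then obtain s s' where s: "s \<in> ran x" "s' \<in> ran y" "lt r s s'" "{t \<in> ran x. lt r t s} = {t \<in> ran y. lt r t s'}"
    using branch_precedes unfolding precedes_def by blast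
  define P where "P = {t \<in> ran x. lt r t s}"
  \<comment> \<open>Replacing \<open>s\<close> in \<open>x\<close>, or \<open>s'\<close> in
    \<open>y\<close>, by a point \<open>c\<close> strictly between them gives a vertex all of whose
    branches run between \<open>x\<close> and \<open>y\<close>. The interval from \<open>c\<close>
    to \<open>d\<close> then holds the values of a squeezed copy of any branch.\<close>
  obtain c where c: "lt r s c" "lt r c s'" using dense[OF s(3)] by blast
  obtain d where d: "lt r c d" using no_max lt_Field(2)[OF c(1)] by blast
  obtain h where h: "strict_map r r h" "\<And>a. a \<in> Field r \<Longrightarrow> lt r c (h a) \<and> lt r (h a) d"
    using self_map[OF d] by blast
  define Q where "Q = P \<union> {c}"
  have P: "(p, s) \<in> r" if "p \<in> P" for p using that lt_imp_le by (auto simp: P_def)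
  have Qc: "(q, c) \<in> r" if "q \<in> Q" for q
    using that P lt_imp_le[OF c(1)] le_trans le_refl[OF lt_Field(2)[OF c(1)]] by (auto simp: Q_def)
  have "gapped r Q" unfolding Q_def
    using gapped_subset[OF branch_gapped[OF x(1)], of P] singleton_gapped lt_Field(2)[OF c(1)] c(1)
    by (intro gapped_append[of _ _ s]) (auto simp: P P_def)
  define S where "S w = Q \<union> h ` ran w" for w :: "'a ords \<rightharpoonup> 'a"
  have hr: "lt r c a" "(a, d) \<in> r" if "w \<in> branches r" "a \<in> h ` ran w" for w a
    using that h(2) branch_ran_Field[OF that(1)] by (auto simp: lt_imp_le)
  have gapped: "gapped r (S w)" if w: "w \<in> branches r" for w
    unfolding S_def using \<open>gapped r Q\<close> gapped_image[OF branch_gapped[OF w] h(1) linear linear] Qc hr(1)[OF w]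
    by (rule gapped_append)
  have bound: "(a, d) \<in> r" if "a \<in> S w" "w \<in> branches r" for w a
    using that hr(2) Qc le_trans lt_imp_le[OF d] unfolding S_def by blast
  have dF: "d \<in> Field r" by (rule lt_Field(2)[OF d])
  have S_less: "{t \<in> S w. lt r t c} = P" if w: "w \<in> branches r" for w
    unfolding S_def Q_def using hr(1)[OF w] lt_asym lt_imp_le P le_lt_trans[OF _ c(1)] by fastforce
  have cS: "c \<in> S w" for w by (simp add: S_def Q_def)
  have real: "realizes (br (S w)) (S w)" if w: "w \<in> branches r" for w
    using realizes_br[OF gapped[OF w] dF bound[OF _ w]] .
  have "precedes r (ran x) (S w)" if "w \<in> branches r" for w
    unfolding precedes_def
    by (intro bexI[OF _ cS] bexI[OF _ s(1)] conjI c(1)) (simp add: S_less[OF that] P_def)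
  then have lower: "lt Z (e x) (e (br (S w)))" if "w \<in> branches r" for w
    using realizes_less[OF realizes_ran[OF x(1)] real] that by (intro e_strict) blast
  have "precedes r (S w) (ran y)" if "w \<in> branches r" for w
    unfolding precedes_def
    by (intro bexI[OF _ cS] bexI[OF _ s(2)] conjI c(2)) (simp add: S_less[OF that] P_def s(4))
  then have upper: "lt Z (e (br (S w))) (e y)" if "w \<in> branches r" for w
    using realizes_less[OF real realizes_ran[OF y(1)]] that by (intro e_strict) blast
  have strict: "lt Z (e (br (S w))) (e (br (S w')))" if ww': "lt (branch_space r) w w'" for w w'
  proof -
    have B: "w \<in> branches r" "w' \<in> branches r" using lt_Field[OF ww'] by simp_all
    have "precedes r (h ` ran w) (h ` ran w')"
      using precedes_image[OF branch_precedes[OF ww'] _ _ h(1) linear linear] branch_ran_Field B by blast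
    then have "precedes r (S w) (S w')" unfolding S_def
      by (rule precedes_append) (use Qc hr(1) B le_lt_trans in blast)
    then show ?thesis using realizes_less real B by (intro e_strict) blast
  qed
  have S_Field: "e (br (S w)) \<in> Field Z" if "w \<in> branches r" for w
    using lt_Field(2)[OF lower[OF that]] .
  have "(e x, e (br (S w))) \<in> Z" if "w \<in> branches r" for w
    using lower[OF that] by (rule lt_imp_le)
  \<comment> \<open>Prescribing \<open>e x\<close> as lower bound keeps every value above
    \<open>z\<close>; from above the values are bounded by \<open>e y\<close>.\<close>
  then have "\<exists>f. strict_map Z Z f \<and>
    (\<forall>w\<in>Field Z. is_sup Z (insert (e x) {e (br (S v)) |v. v \<in> branches r \<and> (e v, w) \<in> Z}) (f w))"
  proof (intro extend_to_completion[OF Z.linear])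
    show "\<exists>s. is_sup Z S s" if "S \<subseteq> Field Z" "S \<noteq> {}" "b \<in> Field Z" "\<And>a. a \<in> S \<Longrightarrow> (a, b) \<in> Z" for S b
      using that by (rule Z_bounded_sup)
  qed (use S_Field strict e_Field[OF x(1)] in auto)
  then obtain f where f: "strict_map Z Z f"
    "\<And>w. w \<in> Field Z \<Longrightarrow> is_sup Z (insert (e x) {e (br (S v)) |v. v \<in> branches r \<and> (e v, w) \<in> Z}) (f w)"
    by blast
  have "lt Z z (f w) \<and> lt Z (f w) z'" if w: "w \<in> Field Z" for w
  proof
    show "lt Z z (f w)" using x(2) Z.sup_upper[OF f(2)[OF w]] Z.lt_le_trans by blast
    have "(f w, e y) \<in> Z"
    proof (rule Z.sup_least[OF f(2)[OF w] e_Field[OF y(1)]])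
      fix a assume "a \<in> insert (e x) {e (br (S v)) |v. v \<in> branches r \<and> (e v, w) \<in> Z}"
      then show "(a, e y) \<in> Z" using lt_imp_le[OF y(2)] lt_imp_le[OF upper] by auto
    qed
    then show "lt Z (f w) z'" using y(3) Z.le_lt_trans by blast
  qed
  with f(1) show ?thesis by blast
qed

text \<open>This closes the successor step: a(F) satisfies the same axioms as F, so the construction
  can be iterated.\<close>

sublocale Z: continuum Z
proof unfold_locales
  obtain c where "c \<in> Field r" using nonempty by blast
  then show "Field Z \<noteq> {}" using pi_surj[of c] by blast
  show "\<exists>s. is_sup Z S s" if "S \<subseteq> Field Z" "S \<noteq> {}" "b \<in> Field Z" "\<And>a. a \<in> S \<Longrightarrow> (a, b) \<in> Z" for S b
    using that by (rule Z_bounded_sup)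
qed (fact Z_no_max Z_no_min Z_self_map)+

end

section \<open>Embedding countable lexicographic powers in the completion\<close>

context continuum
begin

text \<open>The Cantor scheme: \<open>g x\<close> lies in a decreasing sequence of intervals, the \<open>n\<close>-th step of
  which goes to the right part iff \<open>x n\<close>.\<close>

lemma ex_Cantor_map:
  "\<exists>g :: (nat \<Rightarrow> bool) \<Rightarrow> 'a. \<forall>x y n. (\<forall>j<n. x j = y j) \<longrightarrow> \<not> x n \<longrightarrow> y n \<longrightarrow> lt r (g x) (g y)"
proof -
  obtain a0 where "a0 \<in> Field r" using nonempty by blast
  then obtain b0 where ab0: "lt r a0 b0" using no_max by blast
  \<comment> \<open>The gap between \<open>c\<close> and \<open>d\<close> plays the part of the
    removed middle third; it keeps the limits in the two halves apart.\<close>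
  have "\<exists>c d. lt r a c \<and> lt r c d \<and> lt r d b" if "lt r a b" for a b
    using dense that by blast
  then obtain C D where CD: "\<And>a b. lt r a b \<Longrightarrow> lt r a (C a b) \<and> lt r (C a b) (D a b) \<and> lt r (D a b) b"
    by metis
  define I where "I x = rec_nat (a0, b0) (\<lambda>n (a, b). if x n then (D a b, b) else (a, C a b))" for x :: "nat \<Rightarrow> bool"
  have I0: "I x 0 = (a0, b0)" for x by (simp add: I_def)
  have ISuc: "I x (Suc n) = (if x n then (D (fst (I x n)) (snd (I x n)), snd (I x n))
      else (fst (I x n), C (fst (I x n)) (snd (I x n))))" for x n
    by (simp add: I_def split_beta)
  have I: "lt r (fst (I x n)) (snd (I x n))" for x n
    by (induction n) (use CD ab0 lt_trans in \<open>auto simp: I0 ISuc\<close>)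
  note IF = lt_Field[OF I]
  have step: "(fst (I x n), fst (I x (Suc n))) \<in> r" "(snd (I x (Suc n)), snd (I x n)) \<in> r" for x n
    using CD[OF I[of x n]] IF[of x n] lt_trans by (auto simp: ISuc intro!: lt_imp_le)
  have mono: "(fst (I x n), fst (I x (n + k))) \<in> r \<and> (snd (I x (n + k)), snd (I x n)) \<in> r" for x n k
  proof (induction k)
    case (Suc k)
    then show ?case using step[of x "n + k"] le_trans by auto
  qed (use IF in simp)
  have bound: "(fst (I x n), snd (I x m)) \<in> r" for x n m
  proof -
    have "(fst (I x n), fst (I x (n + m))) \<in> r" using mono by blast
    moreover have "(snd (I x (m + n)), snd (I x m)) \<in> r" using mono by blast
    ultimately show ?thesis using lt_imp_le[OF I[of x "n + m"]] le_trans by (metis add.commute)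
  qed
  have "\<exists>s. is_sup r (range (\<lambda>n. fst (I x n))) s" for x
    by (rule bounded_sup[of _ "snd (I x 0)"]) (use IF bound in auto)
  then obtain g where g: "\<And>x. is_sup r (range (\<lambda>n. fst (I x n))) (g x)" by metis
  have "lt r (g x) (g y)" if eq: "\<And>j. j < n \<Longrightarrow> x j = y j" and xn: "\<not> x n" and yn: "y n" for x y n
  proof -
    have "I x k = I y k" if "k \<le> n" for k
      using that by (induction k) (use eq in \<open>auto simp: I0 ISuc\<close>)
    then have In: "I x n = I y n" by simp
    have "(g x, snd (I x (Suc n))) \<in> r"
      by (rule sup_least[OF g]) (use IF bound in auto)
    moreover have "(fst (I y (Suc n)), g y) \<in> r" by (rule sup_upper[OF g]) blast
    moreover have "lt r (snd (I x (Suc n))) (fst (I y (Suc n)))"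
      using CD[OF I[of x n]] xn yn In by (simp add: ISuc)
    ultimately show ?thesis using le_lt_trans lt_le_trans by blast
  qed
  then show ?thesis by (intro exI[of _ g] allI impI) blast
qed

text \<open>An ordinal is coded by the set of the numbers of its predecessors. These sets increase
  strictly, so at the first number where two of them differ the later ordinal has the larger
  entry.\<close>

lemma ex_countable_ordinal_map:
  assumes "countable {..<\<beta> :: 'k ords}"
  shows "\<exists>q. \<forall>j<\<beta>. \<forall>i<j. lt r (q i) (q j)"
proof -
  obtain g :: "(nat \<Rightarrow> bool) \<Rightarrow> 'a"
    where g: "\<And>x y n. (\<And>j. j < n \<Longrightarrow> x j = y j) \<Longrightarrow> \<not> x n \<Longrightarrow> y n \<Longrightarrow> lt r (g x) (g y)"
    using ex_Cantor_map by metis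
  obtain num :: "'k ords \<Rightarrow> nat" where num: "inj_on num {..<\<beta>}" using assms by (auto simp: countable_def)
  define B where "B i n \<longleftrightarrow> (\<exists>k<i. num k = n)" for i n
  have "lt r (g (B i)) (g (B j))" if ij: "i < j" "j < \<beta>" for i j
  proof -
    have sub: "B j n" if "B i n" for n using that ij(1) unfolding B_def by (metis order.strict_trans)
    have "\<not> B i (num i)"
    proof
      assume "B i (num i)"
      then obtain k where k: "k < i" "num k = num i" by (auto simp: B_def)
      then have "k = i" using ij by (intro inj_onD[OF num]) auto
      then show False using k(1) by simp
    qed
    moreover have "B j (num i)" using ij(1) by (auto simp: B_def)
    ultimately have ex: "\<exists>n. B j n \<and> \<not> B i n" by blast
    define n where "n = (LEAST n. B j n \<and> \<not> B i n)"
    have n: "B j n \<and> \<not> B i n" unfolding n_def by (rule LeastI_ex[OF ex])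
    show ?thesis
    proof (rule g)
      show "B i k = B j k" if "k < n" for k using that sub not_less_Least unfolding n_def by blast
    qed (use n in auto)
  qed
  then show ?thesis by (intro exI[of _ "g \<circ> B"]) simp
qed

text \<open>The points \<open>q i\<close> cut out consecutive intervals, and \<open>G i\<close>
  squeezes the chain into the i-th. As \<open>q i\<close> separates the values of \<open>G i\<close>
  from all earlier ones, a gap is present even at limit indices.\<close>

lemma ex_ordinal_product_map:
  assumes "countable {..<\<beta> :: 'k ords}"
  obtains G q where "\<And>i. i < \<beta> \<Longrightarrow> strict_map r r (G i)"
    "\<And>i a. i < \<beta> \<Longrightarrow> a \<in> Field r \<Longrightarrow> lt r (q i) (G i a)"
    "\<And>i j a. i < j \<Longrightarrow> j < \<beta> \<Longrightarrow> a \<in> Field r \<Longrightarrow> lt r (G i a) (q j)"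
proof -
  \<comment> \<open>One point more than \<beta>: if there is a last interval, it needs an upper
    end.\<close>
  have "{..<succ_ord \<beta>} = insert \<beta> {..<\<beta>}" by (auto simp: less_succ_ord)
  then have "countable {..<succ_ord \<beta>}" using assms by simp
  then obtain q where q: "\<And>i j. i < j \<Longrightarrow> j < succ_ord \<beta> \<Longrightarrow> lt r (q i) (q j)"
    using ex_countable_ordinal_map by metis
  have succ_le: "succ_ord i \<le> j" if "i < j" for i j :: "'k ords"
    using that unfolding succ_ord_def by (rule Least_le)
  have "lt r (q i) (q (succ_ord i))" if "i < \<beta>" for i
    using q[OF succ_ord_greater[of i]] succ_le[OF that] by (simp add: less_succ_ord)
  then have "\<forall>i\<in>{..<\<beta>}. \<exists>f. strict_map r r f \<and> (\<forall>a\<in>Field r. lt r (q i) (f a) \<and> lt r (f a) (q (succ_ord i)))"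
    using self_map by blast
  from bchoice[OF this] obtain G where G: "\<And>i. i < \<beta> \<Longrightarrow> strict_map r r (G i)"
    "\<And>i a. i < \<beta> \<Longrightarrow> a \<in> Field r \<Longrightarrow> lt r (q i) (G i a) \<and> lt r (G i a) (q (succ_ord i))"
    by (metis lessThan_iff)
  have "lt r (G i a) (q j)" if "i < j" "j < \<beta>" "a \<in> Field r" for i j a
  proof -
    have "lt r (G i a) (q (succ_ord i))" using G(2) that by (meson order.strict_trans)
    moreover have "(q (succ_ord i), q j) \<in> r"
    proof (cases "succ_ord i = j")
      case True
      then show ?thesis using lt_Field(2)[OF calculation] by simp
    next
      case False
      then have "succ_ord i < j" using succ_le[OF that(1)] by simp
      moreover have "j < succ_ord \<beta>" using that(2) by (simp add: less_succ_ord)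
      ultimately show ?thesis using q lt_imp_le by metis
    qed
    ultimately show ?thesis by (rule lt_le_trans)
  qed
  then show thesis using that[of G q] G by blast
qed

end

lemma Field_lex_power: "Field (lex_power r u v \<beta>) = (\<Pi>\<^sub>E i\<in>{..<\<beta>}. if i = 0 then Field r else interval r u v)"
  by (simp add: lex_power_def)

lemma lex_power_Field:
  assumes "x \<in> Field (lex_power r u v \<beta>)" "i < \<beta>"
  shows "x i \<in> Field r"
  using PiE_mem[OF assms(1)[unfolded Field_lex_power], of i] assms(2)
  by (auto simp: interval_def Field_def split: if_splits)

text \<open>The values of a branch increase, so all coordinates after the first are squeezed by
  \<open>h (x 0)\<close> above \<open>x 0\<close>. The upper bound \<open>d (x 0)\<close> makes the
  resulting set the range of a vertex.\<close>

lemma (in branch_completion) lex_power_map: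
  assumes "countable {..<\<beta> :: 'k ords}" "0 < \<beta>"
  shows "\<exists>f. strict_map (lex_power r u v \<beta>) Z f"
proof -
  let ?L = "lex_power r u v \<beta>"
  obtain G q where G: "\<And>i. i < \<beta> \<Longrightarrow> strict_map r r (G i)"
    "\<And>i a. i < \<beta> \<Longrightarrow> a \<in> Field r \<Longrightarrow> lt r (q i) (G i a)"
    "\<And>i j a. i < j \<Longrightarrow> j < \<beta> \<Longrightarrow> a \<in> Field r \<Longrightarrow> lt r (G i a) (q j)"
    using ex_ordinal_product_map[OF assms(1)] by blast
  have "\<forall>c\<in>Field r. \<exists>d h. strict_map r r h \<and> (\<forall>a\<in>Field r. lt r c (h a) \<and> lt r (h a) d)"
    using no_max self_map by meson
  then obtain d h where h: "\<And>c. c \<in> Field r \<Longrightarrow> strict_map r r (h c)"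
    "\<And>c a. c \<in> Field r \<Longrightarrow> a \<in> Field r \<Longrightarrow> lt r c (h c a) \<and> lt r (h c a) (d c)"
    by metis
  define B where "B c x = {h c (G i (x i)) |i. 0 < i \<and> i < \<beta>}" for c and x :: "'k ords \<Rightarrow> 'a"
  define S where "S x = {x 0} \<union> B (x 0) x" for x
  have G_less: "lt r (G i a) (G j b)" if "i < j" "j < \<beta>" "a \<in> Field r" "b \<in> Field r" for i j a b
    using G(2,3) that lt_trans by blast
  have G_Field: "G i a \<in> Field r" "q i \<in> Field r" if "i < \<beta>" "a \<in> Field r" for i a
    using lt_Field[OF G(2)[OF that]] by auto
  have h_strict: "lt r (h c a) (h c b)" if "c \<in> Field r" "lt r a b" for c a b
    using h(1)[OF that(1)] that(2) by (simp add: strict_map_def)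
  have x_Field: "x i \<in> Field r" if "x \<in> Field ?L" "i < \<beta>" for x i using lex_power_Field that .
  have x0: "x 0 \<in> Field r" if "x \<in> Field ?L" for x using x_Field that assms(2) .
  have B_Field: "a \<in> Field r" "lt r (x 0) a" "lt r a (d (x 0))" if x: "x \<in> Field ?L" and a: "a \<in> B (x 0) x" for x a
  proof -
    obtain i where "i < \<beta>" "a = h (x 0) (G i (x i))" using a by (auto simp: B_def)
    then show "lt r (x 0) a" "lt r a (d (x 0))" using h(2) x0[OF x] G_Field(1) x_Field[OF x] by auto
    then show "a \<in> Field r" using lt_Field(2) by metis
  qed
  have less_iff: "lt r (h (x 0) (G i (x i))) (h (x 0) (G j (x j))) \<longleftrightarrow> i < j"
    if "x \<in> Field ?L" "i < \<beta>" "j < \<beta>" for x i j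
  proof -
    have *: "lt r (h (x 0) (G i (x i))) (h (x 0) (G j (x j)))" if "i < j" "j < \<beta>" for i j
      using that G_less x_Field[OF \<open>x \<in> Field ?L\<close>] order.strict_trans[OF that] x0[OF \<open>x \<in> Field ?L\<close>]
      by (intro h_strict) auto
    then show ?thesis using *[of i j] *[of j i] that lt_asym lt_imp_le by (metis linorder_neqE lt_irrefl)
  qed
  have "gapped r (B (x 0) x)" if x: "x \<in> Field ?L" for x
    unfolding gapped_def
  proof (intro conjI allI impI ballI)
    show "B (x 0) x \<subseteq> Field r" using B_Field(1)[OF x] by blast
    fix T assume T: "T \<subseteq> B (x 0) x" "T \<noteq> {}"
    define P where "P i \<longleftrightarrow> i < \<beta> \<and> h (x 0) (G i (x i)) \<in> T" for i
    obtain t where "t \<in> T" using T(2) by blast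
    then have ex: "\<exists>i. P i" using T(1) unfolding B_def P_def by blast
    define i where "i = (LEAST i. P i)"
    have i: "P i" unfolding i_def by (rule LeastI_ex[OF ex])
    have "(h (x 0) (G i (x i)), t) \<in> r" if t: "t \<in> T" for t
    proof -
      obtain j where j: "j < \<beta>" "t = h (x 0) (G j (x j))" using t T(1) unfolding B_def by blast
      then have "i \<le> j" unfolding i_def using t by (intro Least_le) (simp add: P_def)
      then have "\<not> lt r t (h (x 0) (G i (x i)))" using less_iff[OF x j(1)] i j(2) by (auto simp: P_def)
      moreover have "t \<in> Field r" "h (x 0) (G i (x i)) \<in> Field r"
        using T(1) B_Field(1)[OF x] t i by (auto simp: P_def)
      ultimately show ?thesis using not_lt by blast
    qed
    then show "\<exists>m\<in>T. \<forall>t\<in>T. (m, t) \<in> r" using i unfolding P_def by blast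
  next
    fix s assume "s \<in> B (x 0) x"
    then obtain i where i: "i < \<beta>" "s = h (x 0) (G i (x i))" unfolding B_def by blast
    \<comment> \<open>The image of \<open>q i\<close> is the witness of the gap: earlier coded
      values may have \<open>s\<close> as their supremum only if no such point were kept
      free.\<close>
    have "lt r (h (x 0) (q i)) s" unfolding i(2) by (intro h_strict x0[OF x] G(2) i(1) x_Field[OF x])
    moreover have "(t, h (x 0) (q i)) \<in> r" if t: "t \<in> B (x 0) x" "lt r t s" for t
    proof -
      obtain j where j: "j < \<beta>" "t = h (x 0) (G j (x j))" using t unfolding B_def by blast
      then have "j < i" using less_iff[OF x j(1) i(1)] t(2) i(2) by blast
      then show ?thesis unfolding j(2) using i(1) j(1) by (intro lt_imp_le h_strict x0[OF x] G(3) x_Field[OF x])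
    qed
    ultimately show "\<exists>b. lt r b s \<and> (\<forall>t\<in>B (x 0) x. lt r t s \<longrightarrow> (t, b) \<in> r)" by blast
  qed
  then have gapped: "gapped r (S x)" if "x \<in> Field ?L" for x
    unfolding S_def using B_Field(2)[OF that] that x0
    by (intro gapped_append[of _ _ "x 0"] singleton_gapped) auto
  have dF: "d (x 0) \<in> Field r" "lt r (x 0) (d (x 0))" if "x \<in> Field ?L" for x
  proof -
    show "lt r (x 0) (d (x 0))" using h(2)[OF x0[OF that] x0[OF that]] lt_trans by metis
    then show "d (x 0) \<in> Field r" by (rule lt_Field)
  qed
  have bound: "(a, d (x 0)) \<in> r" if "x \<in> Field ?L" "a \<in> S x" for x a
    using that B_Field(3)[OF that(1)] dF(2)[OF that(1)] unfolding S_def by (auto intro: lt_imp_le)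
  have real: "realizes (br (S x)) (S x)" if x: "x \<in> Field ?L" for x
    by (rule realizes_br[OF gapped[OF x] dF(1)[OF x]]) (rule bound[OF x])
  have "precedes r (S x) (S y)" if xy: "lt ?L x y" for x y
  proof -
    have x: "x \<in> Field ?L" and y: "y \<in> Field ?L" using lt_Field[OF xy] by auto
    obtain i where i: "i < \<beta>" "\<And>j. j < i \<Longrightarrow> x j = y j" "lt r (x i) (y i)"
      using xy by (auto simp: lex_power_def lt_lex_order)
    \<comment> \<open>If the first difference is at 0, then \<open>x 0\<close> and
      \<open>y 0\<close> are the witnesses, as nothing in either set comes before them.\<close>
    have 0: "{t \<in> S z. lt r t (z 0)} = {}" if "z \<in> Field ?L" for z
      using lt_asym[OF B_Field(2)[OF that]] by (auto simp: S_def dest: lt_imp_le)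
    show ?thesis
    proof (cases "i = 0")
      case True
      then show ?thesis unfolding precedes_def using i(3) 0[OF x] 0[OF y]
        by (intro bexI[of _ "x 0"] bexI[of _ "y 0"]) (auto simp: S_def)
    next
      case False
      then have i0: "0 < i" by (simp add: zero_ords_less)
      then have eq0: "x 0 = y 0" by (rule i(2))
      let ?s = "\<lambda>z. h (z 0) (G i (z i))"
      \<comment> \<open>What comes before the i-th coded value depends only on the coordinates
        before i, hence is the same for \<open>x\<close> and \<open>y\<close> at their first
        difference.\<close>
      have below: "{t \<in> B (z 0) z. lt r t (?s z)} = {h (z 0) (G j (z j)) |j. 0 < j \<and> j < i}" if z: "z \<in> Field ?L" for z
        using less_iff[OF z _ i(1)] order.strict_trans[OF _ i(1)] unfolding B_def by blast
      have "lt r (?s x) (?s y)"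
        using G(1)[OF i(1)] i(3) x0[OF x] eq0 by (auto simp: strict_map_def intro!: h_strict)
      moreover have "{t \<in> B (x 0) x. lt r t (?s x)} = {t \<in> B (y 0) y. lt r t (?s y)}"
        unfolding below[OF x] below[OF y] using i(2) eq0 by (intro Collect_cong) metis
      ultimately have "precedes r (B (x 0) x) (B (y 0) y)"
        unfolding precedes_def using i0 i(1) by (intro bexI[of _ "?s x"] bexI[of _ "?s y"]) (auto simp: B_def)
      then show ?thesis unfolding S_def eq0
        by (intro precedes_append) (use B_Field(2)[OF x, unfolded eq0] B_Field(2)[OF y] in auto)
    qed
  qed
  then have "lt Z (e (br (S x))) (e (br (S y)))" if "lt ?L x y" for x y
    using realizes_less[OF real real] lt_Field[OF that] that by (intro e_strict) blast
  moreover have "e (br (S x)) \<in> Field Z" if "x \<in> Field ?L" for x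
    using real[OF that] e_Field by (auto simp: realizes_def)
  ultimately have "strict_map ?L Z (\<lambda>x. e (br (S x)))" by (auto simp: strict_map_def)
  then show ?thesis by blast
qed

section \<open>Lexicographic powers\<close>

text \<open>The tail \<open>w\<close> is a parameter so that one sequence has two different
  extensions, which is the source of the doubling in \<open>not_lex_power_map\<close>.\<close>

definition pad :: "'k ords \<Rightarrow> 'k ords \<Rightarrow> ('a \<Rightarrow> 'a) \<Rightarrow> 'a \<Rightarrow> ('k ords \<Rightarrow> 'a) \<Rightarrow> 'k ords \<Rightarrow> 'a" where
  "pad \<beta> \<beta>' k w x = (\<lambda>i\<in>{..<\<beta>'}. if i < \<beta> then k (x i) else w)"

context continuum
begin

lemma lex_power_PiE: "x \<in> Field (lex_power r u v \<beta>) \<Longrightarrow> x \<in> (\<Pi>\<^sub>E i\<in>{..<\<beta>}. Field r)"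
  using lex_power_Field[of x r u v \<beta>] by (auto simp: Field_lex_power PiE_iff)

lemma Linear_order_lex_power: "Linear_order (lex_power r u v \<beta>)"
  unfolding lex_power_def
proof (rule Linear_order_lex_order)
  show "(\<Pi>\<^sub>E i\<in>{..<\<beta>}. if i = 0 then Field r else interval r u v) \<subseteq> (\<Pi>\<^sub>E i\<in>{..<\<beta>}. Field r)"
    using lex_power_PiE unfolding Field_lex_power by blast
qed (rule linear)

lemma pad_Field:
  assumes k: "\<And>a. a \<in> Field r \<Longrightarrow> lt r u' (k a) \<and> lt r (k a) v'"
    and w: "w \<in> interval r u' v'" and x: "x \<in> (\<Pi>\<^sub>E i\<in>{..<\<beta>}. Field r)"
  shows "pad \<beta> \<beta>' k w x \<in> Field (lex_power r u' v' \<beta>')"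
proof -
  have "w \<in> Field r" using w by (auto simp: interval_def Field_def)
  moreover have "k (x i) \<in> Field r" "k (x i) \<in> interval r u' v'" if "i < \<beta>" for i
  proof -
    have "x i \<in> Field r" using x that by (auto dest: PiE_mem)
    then show "k (x i) \<in> Field r" "k (x i) \<in> interval r u' v'"
      using k[of "x i"] lt_Field[of r u' "k (x i)"] by (auto simp: interval_def lt_imp_le)
  qed
  ultimately show ?thesis using w unfolding Field_lex_power pad_def by auto
qed

lemma pad_less:
  assumes k: "strict_map r r k" "\<And>a. a \<in> Field r \<Longrightarrow> lt r u' (k a) \<and> lt r (k a) v'"
    and "\<beta> \<le> \<beta>'" "w \<in> interval r u' v'" "w' \<in> interval r u' v'"
    and "x \<in> (\<Pi>\<^sub>E i\<in>{..<\<beta>}. Field r)" "y \<in> (\<Pi>\<^sub>E i\<in>{..<\<beta>}. Field r)"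
    and i: "i < \<beta>" "\<And>j. j < i \<Longrightarrow> x j = y j" "lt r (x i) (y i)"
  shows "lt (lex_power r u' v' \<beta>') (pad \<beta> \<beta>' k w x) (pad \<beta> \<beta>' k w' y)"
proof -
  have "i < \<beta>'" using assms by simp
  moreover have "pad \<beta> \<beta>' k w x j = pad \<beta> \<beta>' k w' y j" if "j < i" for j
    using that i order.strict_trans[OF that i(1)] by (simp add: pad_def)
  moreover have "lt r (pad \<beta> \<beta>' k w x i) (pad \<beta> \<beta>' k w' y i)"
    using i \<open>i < \<beta>'\<close> k(1) by (simp add: pad_def strict_map_def)
  moreover note pad_Field[OF k(2) assms(4,6)] pad_Field[OF k(2) assms(5,7)]
  ultimately show ?thesis
    unfolding Field_lex_power unfolding lex_power_def lt_lex_order by (intro conjI exI[of _ i]) simp_all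
qed

text \<open>Squeezing every coordinate into the interval from \<open>u'\<close> to \<open>v'\<close>
  absorbs the change of interval along with the change of length.\<close>

lemma lex_power_mono:
  assumes "lt r u' v'" "\<beta> \<le> \<beta>'"
  shows "\<exists>f. strict_map (lex_power r u v \<beta>) (lex_power r u' v' \<beta>') f"
proof -
  obtain k where k: "strict_map r r k" "\<And>a. a \<in> Field r \<Longrightarrow> lt r u' (k a) \<and> lt r (k a) v'"
    using self_map[OF assms(1)] by blast
  have w: "u' \<in> interval r u' v'" using assms(1) lt_Field[OF assms(1)] by (auto simp: interval_def lt_imp_le)
  have "strict_map (lex_power r u v \<beta>) (lex_power r u' v' \<beta>') (pad \<beta> \<beta>' k u')"
    unfolding strict_map_def
  proof (intro conjI allI impI image_subsetI)
    show "pad \<beta> \<beta>' k u' x \<in> Field (lex_power r u' v' \<beta>')" if "x \<in> Field (lex_power r u v \<beta>)" for x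
      using pad_Field[OF k(2) w lex_power_PiE[OF that]] .
    fix x y assume xy: "lt (lex_power r u v \<beta>) x y"
    obtain i where i: "i < \<beta>" "\<And>j. j < i \<Longrightarrow> x j = y j" "lt r (x i) (y i)"
      using xy by (auto simp: lex_power_def lt_lex_order)
    show "lt (lex_power r u' v' \<beta>') (pad \<beta> \<beta>' k u' x) (pad \<beta> \<beta>' k u' y)"
      using pad_less[OF k assms(2) w w lex_power_PiE[OF lt_Field(1)[OF xy]] lex_power_PiE[OF lt_Field(2)[OF xy]] i] .
  qed
  then show ?thesis by blast
qed

lemma map_into_lex_power:
  assumes "lt r u v" "0 < \<beta>"
  shows "\<exists>f. strict_map r (lex_power r u v \<beta>) f"
proof -
  let ?f = "\<lambda>a. \<lambda>i\<in>{..<\<beta>}. if i = 0 then a else u"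
  have w: "u \<in> interval r u v" using assms(1) lt_Field[OF assms(1)] by (auto simp: interval_def lt_imp_le)
  have F: "?f a \<in> Field (lex_power r u v \<beta>)" if "a \<in> Field r" for a
    using that w unfolding Field_lex_power by auto
  have "lt (lex_power r u v \<beta>) (?f a) (?f b)" if "lt r a b" for a b
    using F[OF lt_Field(1)[OF that]] F[OF lt_Field(2)[OF that]] that assms(2)
    unfolding Field_lex_power unfolding lex_power_def lt_lex_order by (intro conjI exI[of _ 0]) simp_all
  then have "strict_map r (lex_power r u v \<beta>) ?f" using F by (auto simp: strict_map_def)
  then show ?thesis by blast
qed

text \<open>A point of J^\<beta> has two extensions to length \<beta>', with tails \<open>u'\<close>
  and \<open>v'\<close>. They first differ at coordinate \<beta>, while a larger point outweighs the
  choice of the tail. So J^\<beta> doubled embeds in the longer power, and through \<open>f\<close>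
  and \<open>g\<close> in J^\<beta> itself, against \<open>no_doubling\<close>.\<close>

lemma not_lex_power_map:
  assumes uv: "lt r u v" and uv': "lt r u' v'" and \<beta>: "\<beta> < \<beta>'"
  shows "\<not> strict_map (lex_power r u' v' \<beta>') (lex_power r u v \<beta>) f"
proof
  assume f: "strict_map (lex_power r u' v' \<beta>') (lex_power r u v \<beta>) f"
  let ?J = "interval r u v"
  let ?R = "Restr r ?J"
  let ?P = "\<Pi>\<^sub>E i\<in>{..<\<beta>}. Field ?R"
  \<comment> \<open>Unlike F_\<beta>, this power has J at coordinate 0 too, hence a least point and
    all suprema. The map \<open>g\<close> squeezes F_\<beta> into it.\<close>
  let ?C = "lex_order \<beta> (\<lambda>_. ?R) ?P"
  have JF: "?J \<subseteq> Field r" by (auto simp: interval_def Field_def)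
  have FR: "Field ?R = ?J" by (rule Field_Restr[OF JF])
  have LR: "Linear_order ?R" by (rule Linear_order_Restr[OF linear])
  have w: "u' \<in> interval r u' v'" "v' \<in> interval r u' v'" "u \<in> ?J"
    using lt_Field[OF uv'] lt_Field[OF uv] uv uv' by (auto simp: interval_def lt_imp_le)
  obtain h where h: "strict_map r r h" "\<And>a. a \<in> Field r \<Longrightarrow> lt r u (h a) \<and> lt r (h a) v"
    using self_map[OF uv] by blast
  obtain k where k: "strict_map r r k" "\<And>a. a \<in> Field r \<Longrightarrow> lt r u' (k a) \<and> lt r (k a) v'"
    using self_map[OF uv'] by blast
  define g where "g x = (\<lambda>i\<in>{..<\<beta>}. h (x i))" for x :: "'b ords \<Rightarrow> 'a"
  have gP: "g x \<in> ?P" if "x \<in> Field (lex_power r u v \<beta>)" for x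
    unfolding g_def FR using lex_power_Field[OF that] h(2) by (auto simp: interval_def lt_imp_le)
  have g_less: "lt ?C (g x) (g y)" if xy: "lt (lex_power r u v \<beta>) x y" for x y
  proof -
    obtain i where i: "i < \<beta>" "\<And>j. j < i \<Longrightarrow> x j = y j" "lt r (x i) (y i)"
      using xy by (auto simp: lex_power_def lt_lex_order)
    have P: "g x \<in> ?P" "g y \<in> ?P" using gP lt_Field[OF xy] by blast+
    then have "g x i \<in> ?J" "g y i \<in> ?J" using i(1) unfolding FR by (auto dest: PiE_mem)
    moreover have "lt r (g x i) (g y i)" using h(1) i by (simp add: g_def strict_map_def)
    ultimately have "lt ?R (g x i) (g y i)" by (auto simp: lt_def)
    moreover have "g x j = g y j" if "j < i" for j using i(1,2) that by (simp add: g_def)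
    ultimately show ?thesis unfolding lt_lex_order using P i(1) by blast
  qed
  have PF: "x \<in> (\<Pi>\<^sub>E i\<in>{..<\<beta>}. Field r)" if "x \<in> ?P" for x
    using that JF unfolding FR by (auto simp: PiE_iff)
  have pad: "pad \<beta> \<beta>' k w x \<in> Field (lex_power r u' v' \<beta>')" if "w \<in> interval r u' v'" "x \<in> ?P" for w x
    by (rule pad_Field[OF k(2) that(1) PF[OF that(2)]])
  note less = pad_less[OF k less_imp_le[OF \<beta>] w(2,1) PF PF]
  have f_Field: "f x \<in> Field (lex_power r u v \<beta>)" if "x \<in> Field (lex_power r u' v' \<beta>')" for x
    using f that by (auto simp: strict_map_def)
  have f_less: "lt (lex_power r u v \<beta>) (f x) (f y)" if "lt (lex_power r u' v' \<beta>') x y" for x y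
    using f that by (auto simp: strict_map_def)
  show False
  proof (rule no_doubling[of ?C "\<lambda>i\<in>{..<\<beta>}. u" "\<lambda>x. g (f (pad \<beta> \<beta>' k u' x))" "\<lambda>x. g (f (pad \<beta> \<beta>' k v' x))"])
    show L: "Linear_order ?C" by (rule Linear_order_lex_order) (use LR in auto)
    interpret C: lots ?C by unfold_locales (rule L)
    show bot: "(\<lambda>i\<in>{..<\<beta>}. u) \<in> Field ?C" using w(3) FR by auto
    have u_le: "(u, a) \<in> r" if "a \<in> ?J" for a using that by (auto simp: interval_def)
    show "((\<lambda>i\<in>{..<\<beta>}. u), x) \<in> ?C" if x: "x \<in> Field ?C" for x
    proof (rule ccontr)
      assume "((\<lambda>i\<in>{..<\<beta>}. u), x) \<notin> ?C"
      then have "lt ?C x (\<lambda>i\<in>{..<\<beta>}. u)" using C.not_le[OF bot x] by blast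
      then obtain i where i: "i < \<beta>" "lt ?R (x i) u" by (auto simp: lt_lex_order)
      then have "lt r (x i) u" "x i \<in> ?J" by (auto simp: lt_def)
      then show False using u_le lt_asym by blast
    qed
    show "\<exists>s. is_sup ?C S s" if S: "S \<subseteq> Field ?C" "S \<noteq> {}" for S
    proof (rule lex_order_sup[where m = "\<lambda>_. u"])
      show "\<exists>s. is_sup ?R T s" if T: "T \<subseteq> Field ?R" "T \<noteq> {}" for T
      proof -
        have TJ: "T \<subseteq> ?J" using T(1) unfolding FR .
        then obtain s where s: "is_sup r T s"
          using bounded_sup[of T v] T(2) JF lt_Field(2)[OF uv] by (auto simp: interval_def)
        obtain t where t: "t \<in> T" using T(2) by blast
        have "(u, s) \<in> r" using u_le[of t] sup_upper[OF s t] TJ t le_trans by blast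
        moreover have "(s, v) \<in> r"
          using TJ by (intro sup_least[OF s] lt_Field(2)[OF uv]) (auto simp: interval_def)
        ultimately have "s \<in> ?J" by (simp add: interval_def)
        then have "is_sup ?R T s"
          using sup_upper[OF s] sup_least[OF s] TJ JF unfolding is_sup_def Above_def FR by auto
        then show ?thesis by blast
      qed
    qed (use LR w(3) FR u_le S in auto)
    show "g (f (pad \<beta> \<beta>' k u' x)) \<in> Field ?C" if "x \<in> Field ?C" for x
      using that unfolding Field_lex_order by (intro gP f_Field pad w)
    show "lt ?C (g (f (pad \<beta> \<beta>' k u' x))) (g (f (pad \<beta> \<beta>' k v' x)))" if "x \<in> Field ?C" for x
    proof (intro g_less f_less)
      have x: "x \<in> ?P" using that by simp
      have "pad \<beta> \<beta>' k u' x \<in> Field (lex_power r u' v' \<beta>')" "pad \<beta> \<beta>' k v' x \<in> Field (lex_power r u' v' \<beta>')"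
        using pad[OF _ x] w by blast+
      moreover have "\<forall>j<\<beta>. pad \<beta> \<beta>' k u' x j = pad \<beta> \<beta>' k v' x j"
        by (simp add: pad_def)
      moreover have "lt r (pad \<beta> \<beta>' k u' x \<beta>) (pad \<beta> \<beta>' k v' x \<beta>)" using \<beta> uv' by (simp add: pad_def)
      ultimately show "lt (lex_power r u' v' \<beta>') (pad \<beta> \<beta>' k u' x) (pad \<beta> \<beta>' k v' x)"
        using \<beta> unfolding Field_lex_power unfolding lex_power_def lt_lex_order by blast
    qed
    show "lt ?C (g (f (pad \<beta> \<beta>' k v' x))) (g (f (pad \<beta> \<beta>' k u' y)))" if xy: "lt ?C x y" for x y
    proof (intro g_less f_less)
      obtain i where i: "i < \<beta>" "\<And>j. j < i \<Longrightarrow> x j = y j" "lt ?R (x i) (y i)"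
        using xy by (auto simp: lt_lex_order)
      have "lt r (x i) (y i)" using i(3) by (simp add: lt_def)
      moreover have "x \<in> ?P" "y \<in> ?P" using lt_Field[OF xy] by simp_all
      ultimately show "lt (lex_power r u' v' \<beta>') (pad \<beta> \<beta>' k v' x) (pad \<beta> \<beta>' k u' y)"
        using less[of x y i] i(1,2) by blast
    qed
  qed
qed

end

section \<open>Homogeneous chains\<close>

lemma CHLOTS_continuum:
  assumes "CHLOTS X"
  shows "continuum X"
proof -
  have X: "Linear_order X" "complete_lots X" and big: "infinite (Field X) \<or> 3 \<le> card (Field X)"
    and homog: "\<And>C. C \<noteq> {} \<Longrightarrow> openin (order_topology X) C \<Longrightarrow> convex_in X C \<Longrightarrow> \<exists>f. iso X (Restr X C) f"
    using assms by (auto simp: CHLOTS_def HLOTS_def)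
  interpret lots X by unfold_locales (rule X)
  have iso: "\<exists>f. bij_betw f (Field X) C \<and> (\<forall>a\<in>Field X. \<forall>b\<in>Field X. (a, b) \<in> X \<longleftrightarrow> (f a, f b) \<in> X)"
    if C: "C \<noteq> {}" "openin (order_topology X) C" "convex_in X C" for C
  proof -
    obtain f where "iso X (Restr X C) f" using homog[OF C] by blast
    moreover have FC: "Field (Restr X C) = C" using C(3) by (intro Field_Restr) (simp add: convex_in_def)
    ultimately have "bij_betw f (Field X) C" "\<forall>a\<in>Field X. \<forall>b\<in>Field X. (a, b) \<in> X \<longleftrightarrow> (f a, f b) \<in> Restr X C"
      unfolding iso_iff2 FC by auto
    then show ?thesis using bij_betwE by (intro exI[of _ f]) fastforce
  qed
  have up: "openin (order_topology X) {c. lt X a c}" "convex_in X {c. lt X a c}" if "a \<in> Field X" for a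
  proof -
    have "{c. lt X a c} = aboveS X a" by (auto simp: lt_def aboveS_def)
    then show "openin (order_topology X) {c. lt X a c}"
      unfolding order_topology_def using that by (auto intro: topology_generated_by_Basis)
    show "convex_in X {c. lt X a c}"
      unfolding convex_in_def by (auto dest: lt_Field lt_le_trans)
  qed
  have down: "openin (order_topology X) {c. lt X c a}" "convex_in X {c. lt X c a}" if "a \<in> Field X" for a
  proof -
    have "{c. lt X c a} = underS X a" by (auto simp: lt_def underS_def)
    then show "openin (order_topology X) {c. lt X c a}"
      unfolding order_topology_def using that by (auto intro: topology_generated_by_Basis)
    show "convex_in X {c. lt X c a}"
      unfolding convex_in_def by (auto dest: lt_Field le_lt_trans)
  qed
  have not_small: "Field X \<noteq> {}" "Field X \<noteq> {a}" for a using big by auto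
  \<comment> \<open>A one-point copy of \<open>X\<close> contradicts its having at least three
    points.\<close>
  have no_singleton: False if a: "openin (order_topology X) {a}" "convex_in X {a}" for a
  proof -
    obtain f where "bij_betw f (Field X) {a}" using iso[OF _ a] by blast
    then have "card (Field X) = card {a}" "finite (Field X)" using bij_betw_same_card bij_betw_finite by blast+
    then show False using big by simp
  qed
  \<comment> \<open>If \<open>a\<close> were the minimum, the points above it would form a copy of
    \<open>X\<close> with a minimum \<open>f a\<close>. Then only \<open>a\<close> lies below
    \<open>f a\<close>, so the singleton of \<open>a\<close> is open and convex.\<close>
  have no_min: "\<exists>b. lt X b a" if a: "a \<in> Field X" for a
  proof (rule ccontr)
    assume "\<not> ?thesis"
    then have min: "(a, b) \<in> X" if "b \<in> Field X" for b using that a not_lt by blast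
    obtain b where "b \<in> Field X" "b \<noteq> a" using not_small(1) not_small(2)[of a] by blast
    then have "lt X a b" using min by (auto simp: lt_def)
    then obtain f where f: "bij_betw f (Field X) {c. lt X a c}"
      "\<forall>a\<in>Field X. \<forall>b\<in>Field X. (a, b) \<in> X \<longleftrightarrow> (f a, f b) \<in> X"
      using iso[OF _ up[OF a]] by blast
    have fa: "lt X a (f a)" using bij_betwE[OF f(1)] a by blast
    have ge: "(f a, c) \<in> X" if c: "lt X a c" for c
    proof -
      have "c \<in> f ` Field X" using bij_betw_imp_surj_on[OF f(1)] c by blast
      then show ?thesis using f(2) min a by blast
    qed
    have "c = a" if "lt X c (f a)" for c
    proof -
      have "\<not> lt X a c" using ge[of c] lt_asym[OF that] by blast
      then show ?thesis using min[OF lt_Field(1)[OF that]] by (auto simp: lt_def)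
    qed
    then have "{c. lt X c (f a)} = {a}" using fa by blast
    then show False using no_singleton down[OF lt_Field(2)[OF fa]] by metis
  qed
  have no_max: "\<exists>b. lt X a b" if a: "a \<in> Field X" for a
  proof (rule ccontr)
    assume "\<not> ?thesis"
    then have max: "(b, a) \<in> X" if "b \<in> Field X" for b using that a not_lt by blast
    obtain b where "b \<in> Field X" "b \<noteq> a" using not_small(1) not_small(2)[of a] by blast
    then have "lt X b a" using max by (auto simp: lt_def)
    then obtain f where f: "bij_betw f (Field X) {c. lt X c a}"
      "\<forall>a\<in>Field X. \<forall>b\<in>Field X. (a, b) \<in> X \<longleftrightarrow> (f a, f b) \<in> X"
      using iso[OF _ down[OF a]] by blast
    have fa: "lt X (f a) a" using bij_betwE[OF f(1)] a by blast
    have le: "(c, f a) \<in> X" if c: "lt X c a" for c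
    proof -
      have "c \<in> f ` Field X" using bij_betw_imp_surj_on[OF f(1)] c by blast
      then show ?thesis using f(2) max a by blast
    qed
    have "c = a" if "lt X (f a) c" for c
    proof -
      have "\<not> lt X c a" using le[of c] lt_asym[OF that] by blast
      then show ?thesis using max[OF lt_Field(2)[OF that]] by (auto simp: lt_def)
    qed
    then have "{c. lt X (f a) c} = {a}" using fa by blast
    then show False using no_singleton up[OF lt_Field(1)[OF fa]] by metis
  qed
  \<comment> \<open>With nothing between \<open>a\<close> and \<open>b\<close>, the open ray below
    \<open>b\<close> would have the maximum \<open>a\<close>, though it is a copy of
    \<open>X\<close> and so has none.\<close>
  have dense: "\<exists>c. lt X a c \<and> lt X c b" if ab: "lt X a b" for a b
  proof (rule ccontr)
    assume no: "\<not> ?thesis"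
    note F = lt_Field[OF ab]
    obtain f where f: "bij_betw f (Field X) {c. lt X c b}"
      "\<forall>a\<in>Field X. \<forall>b\<in>Field X. (a, b) \<in> X \<longleftrightarrow> (f a, f b) \<in> X"
      using iso[OF _ down[OF F(2)]] ab by blast
    have "a \<in> f ` Field X" using bij_betw_imp_surj_on[OF f(1)] ab by blast
    then obtain a' where a': "a' \<in> Field X" "a = f a'" by blast
    obtain c where c: "lt X a' c" using no_max a'(1) by blast
    have cF: "c \<in> Field X" by (rule lt_Field(2)[OF c])
    have "lt X (f c) b" using bij_betwE[OF f(1)] cF by blast
    moreover have "\<not> (f c, f a') \<in> X" using f(2) cF a'(1) lt_asym[OF c] by blast
    then have "lt X a (f c)"
      using not_le[of "f c" a] lt_Field(1)[OF \<open>lt X (f c) b\<close>] F(1) a'(2) by blast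
    ultimately show False using no by blast
  qed
  show ?thesis
  proof unfold_locales
    show "\<exists>s. is_sup X S s" if "S \<subseteq> Field X" "S \<noteq> {}" "b \<in> Field X" "\<And>a. a \<in> S \<Longrightarrow> (a, b) \<in> X" for S b
      using complete_lots_bounded_sup[OF X(2) that] .
    fix u v assume uv: "lt X u v"
    let ?C = "{c. lt X u c \<and> lt X c v}"
    have "convex_in X ?C"
      unfolding convex_in_def by (auto dest: lt_Field lt_le_trans le_lt_trans)
    moreover have "?C \<noteq> {}" using dense[OF uv] by blast
    moreover have "openin (order_topology X) ?C" by (intro openin_open_interval lt_Field[OF uv])
    ultimately obtain f where f: "bij_betw f (Field X) ?C"
      "\<forall>a\<in>Field X. \<forall>b\<in>Field X. (a, b) \<in> X \<longleftrightarrow> (f a, f b) \<in> X"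
      using iso[of ?C] by blast
    have fC: "lt X u (f a) \<and> lt X (f a) v" if "a \<in> Field X" for a using bij_betwE[OF f(1)] that by blast
    have "f a \<in> Field X" if "a \<in> Field X" for a using fC[OF that] lt_Field by metis
    moreover have "lt X (f a) (f b)" if "lt X a b" for a b
    proof -
      have "(f a, f b) \<in> X" using f(2) lt_Field[OF that] lt_imp_le[OF that] by blast
      moreover have "f a \<noteq> f b"
        using bij_betw_imp_inj_on[OF f(1)] lt_Field[OF that] that by (auto simp: inj_on_def)
      ultimately show ?thesis by (simp add: lt_def)
    qed
    ultimately show "\<exists>f. strict_map X X f \<and> (\<forall>x\<in>Field X. lt X u (f x) \<and> lt X (f x) v)"
      using fC by (intro exI[of _ f]) (auto simp: strict_map_def)
  qed (use no_min no_max not_small in blast)+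
qed

section \<open>The tower\<close>

lemma iso_imp_Linear_order:
  assumes "iso r s f" "Linear_order s"
  shows "Linear_order r"
proof -
  interpret s: lots s by unfold_locales fact
  have f: "bij_betw f (Field r) (Field s)"
    "\<And>a b. a \<in> Field r \<Longrightarrow> b \<in> Field r \<Longrightarrow> (a, b) \<in> r \<longleftrightarrow> (f a, f b) \<in> s"
    using assms(1) unfolding iso_iff2 by auto
  have fF: "f a \<in> Field s" if "a \<in> Field r" for a using bij_betwE[OF f(1)] that by blast
  have F: "a \<in> Field r" "b \<in> Field r" if "(a, b) \<in> r" for a b using that by (auto simp: Field_def)
  have inj: "a = b" if "a \<in> Field r" "b \<in> Field r" "f a = f b" for a b
    using bij_betw_imp_inj_on[OF f(1)] that by (auto simp: inj_on_def)
  show ?thesis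
    unfolding order_on_defs
  proof (intro conjI)
    show "r \<subseteq> Field r \<times> Field r" using F by auto
    show "refl_on (Field r) r" unfolding refl_on_def using f(2) fF by auto
    show "trans r"
    proof (rule transI)
      fix a b c assume ab: "(a, b) \<in> r" "(b, c) \<in> r"
      then have "(f a, f b) \<in> s" "(f b, f c) \<in> s" using f(2) F by blast+
      then show "(a, c) \<in> r" using s.le_trans f(2) F(1)[OF ab(1)] F(2)[OF ab(2)] by blast
    qed
    show "antisym r"
    proof (rule antisymI)
      fix a b assume ab: "(a, b) \<in> r" "(b, a) \<in> r"
      then have "(f a, f b) \<in> s" "(f b, f a) \<in> s" using f(2) F by blast+
      then show "a = b" using s.le_antisym inj F[OF ab(1)] by blast
    qed
    show "total_on (Field r) r"
      unfolding total_on_def using f(2) fF s.not_lt lt_imp_le by metis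
  qed
qed

section \<open>Order surjections\<close>

definition projection :: "'a rel \<Rightarrow> 'b rel \<Rightarrow> ('a \<Rightarrow> 'b) \<Rightarrow> bool" where
  "projection r s f \<longleftrightarrow> (\<forall>a b. (a, b) \<in> r \<longrightarrow> (f a, f b) \<in> s) \<and> f ` Field r = Field s"

lemma projection_comp: "projection r s f \<Longrightarrow> projection s t g \<Longrightarrow> projection r t (g \<circ> f)"
  unfolding projection_def image_comp[symmetric] by simp

lemma projection_cong:
  "projection r s f \<Longrightarrow> (\<And>x. x \<in> Field r \<Longrightarrow> f x = g x) \<Longrightarrow> projection r s g"
  unfolding projection_def by (metis (no_types, lifting) FieldI1 FieldI2 image_cong)

lemma projection_Field: "projection r s f \<Longrightarrow> a \<in> Field r \<Longrightarrow> f a \<in> Field s"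
  unfolding projection_def by blast

lemma projection_surj:
  assumes "projection r s f" "c \<in> Field s"
  obtains a where "a \<in> Field r" "f a = c"
proof -
  have "c \<in> f ` Field r" using assms by (simp add: projection_def)
  then show thesis using that by blast
qed

lemma projection_lt_cancel:
  assumes "projection r s f" "Linear_order r" "Linear_order s" "a \<in> Field r" "b \<in> Field r" "lt s (f a) (f b)"
  shows "lt r a b"
proof -
  interpret r: lots r by unfold_locales fact
  interpret s: lots s by unfold_locales fact
  have "(b, a) \<notin> r" using assms(1,6) s.lt_asym unfolding projection_def by blast
  then show ?thesis using r.not_le assms(4,5) by blast
qed

text \<open>Any choice of preimages is strictly increasing, by
  \<open>projection_lt_cancel\<close>.\<close>

lemma projection_section:
  assumes "projection r s f" "Linear_order r" "Linear_order s"
  shows "\<exists>g. strict_map s r g"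
proof -
  have "\<forall>c\<in>Field s. \<exists>a. a \<in> Field r \<and> f a = c" using projection_surj[OF assms(1)] by metis
  from bchoice[OF this] obtain g where g: "\<And>c. c \<in> Field s \<Longrightarrow> g c \<in> Field r \<and> f (g c) = c" by blast
  have "lt r (g c) (g d)" if "lt s c d" for c d
    using projection_lt_cancel[OF assms, of "g c" "g d"] g[OF lt_Field(1)[OF that]] g[OF lt_Field(2)[OF that]] that
    by simp
  then show ?thesis using g by (intro exI[of _ g]) (auto simp: strict_map_def)
qed

text \<open>If \<open>f x\<close> exceeded an upper bound \<open>b\<close>, a point \<open>d\<close>
  strictly between them would have a preimage below \<open>x\<close>, hence below some
  \<open>a\<close> in \<open>S\<close>, and \<open>d\<close> would be at most \<open>f a\<close> and
  so at most \<open>b\<close>.\<close>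

lemma (in continuum) projection_sup:
  assumes f: "projection s r f" and s: "Linear_order s" and x: "is_sup s S x" "S \<subseteq> Field s"
  shows "is_sup r (f ` S) (f x)"
proof -
  interpret s: lots s by unfold_locales fact
  have xF: "x \<in> Field s" by (rule s.sup_Field[OF x(1)])
  have "(f x, b) \<in> r" if b: "b \<in> Field r" "\<And>a. a \<in> f ` S \<Longrightarrow> (a, b) \<in> r" for b
  proof (rule ccontr)
    assume "(f x, b) \<notin> r"
    then have "lt r b (f x)" using not_le projection_Field[OF f xF] b(1) by blast
    then obtain d where d: "lt r b d" "lt r d (f x)" using dense by blast
    then obtain y where y: "y \<in> Field s" "f y = d" using projection_surj[OF f lt_Field(2)[OF d(1)]] by blast
    then have "lt s y x" using projection_lt_cancel[OF f s linear y(1) xF] d(2) by simp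
    then obtain a where a: "a \<in> S" "lt s y a" using s.sup_lessD[OF x] by blast
    have "(d, f a) \<in> r" using f lt_imp_le[OF a(2)] y(2) unfolding projection_def by blast
    then have "(d, b) \<in> r" using b(2) a(1) le_trans by blast
    then show False using d(1) lt_asym by blast
  qed
  moreover have "(f a, f x) \<in> r" if "a \<in> S" for a
    using f s.sup_upper[OF x(1) that] unfolding projection_def by blast
  ultimately show ?thesis using projection_Field[OF f xF] by (auto simp: is_sup_def Above_def)
qed

locale tower =
  fixes X :: "'a rel" and A :: "Omega \<Rightarrow> 'a rel" and p :: "Omega \<Rightarrow> Omega \<Rightarrow> 'a \<Rightarrow> 'a"
  assumes X: "continuum X" and tower: "a_tower X A p"
begin

text \<open>The induction hypothesis along the tower. Compatibility of the projections is part of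
  it, because \<open>a_tower\<close> states it at successors only for the immediately preceding
  stage and at limits only through threads.\<close>

definition regular :: "Omega \<Rightarrow> bool" where
  "regular \<alpha> \<longleftrightarrow> continuum (A \<alpha>) \<and> (\<forall>\<beta><\<alpha>. projection (A \<alpha>) (A \<beta>) (p \<alpha> \<beta>)) \<and>
     (\<forall>j<\<alpha>. \<forall>i<j. \<forall>z\<in>Field (A \<alpha>). p \<alpha> i z = p j i (p \<alpha> j z))"

lemma regular_Linear: "regular \<alpha> \<Longrightarrow> Linear_order (A \<alpha>)"
  by (auto simp: regular_def continuum_def lots_def)

lemma regular_lots: "regular \<alpha> \<Longrightarrow> lots (A \<alpha>)"
  by (auto simp: regular_def continuum_def)

lemma succ_completion:
  assumes "regular \<alpha>"
  shows "\<exists>e. branch_completion (A \<alpha>) (A (succ_ord \<alpha>)) e (p (succ_ord \<alpha>) \<alpha>)"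
proof -
  have "is_a (A \<alpha>) (A (succ_ord \<alpha>)) (p (succ_ord \<alpha>) \<alpha>)" using tower by (simp add: a_tower_def)
  then show ?thesis
    using assms unfolding is_a_def regular_def branch_completion_def branch_completion_axioms_def by blast
qed

lemma less_succ_cases:
  assumes "(\<beta> :: 'k ords) < succ_ord \<alpha>"
  obtains "\<beta> = \<alpha>" | "\<beta> < \<alpha>"
  using assms that by (auto simp: less_succ_ord order_le_less)

lemma p_succ: "\<beta> < \<alpha> \<Longrightarrow> z \<in> Field (A (succ_ord \<alpha>)) \<Longrightarrow> p (succ_ord \<alpha>) \<beta> z = p \<alpha> \<beta> (p (succ_ord \<alpha>) \<alpha> z)"
  using tower by (simp add: a_tower_def)

lemma regular_succ:
  assumes "regular \<alpha>"
  shows "regular (succ_ord \<alpha>)"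
proof -
  obtain e where "branch_completion (A \<alpha>) (A (succ_ord \<alpha>)) e (p (succ_ord \<alpha>) \<alpha>)"
    using succ_completion[OF assms] by blast
  then interpret branch_completion "A \<alpha>" "A (succ_ord \<alpha>)" e "p (succ_ord \<alpha>) \<alpha>" .
  have proj: "projection (A (succ_ord \<alpha>)) (A \<alpha>) (p (succ_ord \<alpha>) \<alpha>)"
    unfolding projection_def using pi_mono pi_surj pi_Field by blast
  have "projection (A (succ_ord \<alpha>)) (A \<beta>) (p (succ_ord \<alpha>) \<beta>)" if "\<beta> < succ_ord \<alpha>" for \<beta>
    using that
  proof (cases rule: less_succ_cases)
    case 2
    then have "projection (A \<alpha>) (A \<beta>) (p \<alpha> \<beta>)" using assms by (simp add: regular_def)
    from projection_comp[OF proj this] show ?thesis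
      by (rule projection_cong) (simp add: p_succ[OF 2])
  qed (use proj in simp)
  moreover have "p (succ_ord \<alpha>) i z = p j i (p (succ_ord \<alpha>) j z)"
    if "j < succ_ord \<alpha>" "i < j" "z \<in> Field (A (succ_ord \<alpha>))" for i j z
    using that(1)
  proof (cases rule: less_succ_cases)
    case 1
    then show ?thesis using p_succ that by simp
  next
    case 2
    have "p \<alpha> i w = p j i (p \<alpha> j w)" if "w \<in> Field (A \<alpha>)" for w
      using assms 2 \<open>i < j\<close> that by (simp add: regular_def)
    then show ?thesis using p_succ[OF _ that(3)] 2 that(2) pi_Field[OF that(3)] by (metis order.strict_trans)
  qed
  ultimately show ?thesis unfolding regular_def using Z.continuum_axioms by blast
qed

section \<open>Limit stages: threads and their order\<close>

context
  fixes \<mu> :: Omega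
  assumes limit: "limit_ord \<mu>" and all_below: "\<forall>i<\<mu>. regular i"
begin

lemma below: "i < \<mu> \<Longrightarrow> regular i"
  using all_below by blast

lemma projection_below: "j < \<mu> \<Longrightarrow> i < j \<Longrightarrow> projection (A j) (A i) (p j i)"
  using below by (simp add: regular_def)

lemma p_below: "k < \<mu> \<Longrightarrow> j < k \<Longrightarrow> i < j \<Longrightarrow> z \<in> Field (A k) \<Longrightarrow> p k i z = p j i (p k j z)"
  using below by (simp add: regular_def)

abbreviation thread :: "'a \<Rightarrow> Omega \<Rightarrow> 'a" where
  "thread z \<equiv> \<lambda>i\<in>{..<\<mu>}. p \<mu> i z"

lemma iso_thread: "iso (A \<mu>) (inverse_limit A p \<mu>) thread"
  using tower limit by (simp add: a_tower_def)

lemma Field_inverse_limit: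
  "Field (inverse_limit A p \<mu>) = {x \<in> \<Pi>\<^sub>E i\<in>{..<\<mu>}. Field (A i). \<forall>j<\<mu>. \<forall>i<j. x i = p j i (x j)}"
  by (simp add: inverse_limit_def)

lemma thread_bij: "bij_betw thread (Field (A \<mu>)) (Field (inverse_limit A p \<mu>))"
  using iso_thread by (simp add: iso_iff2)

lemma p_limit:
  assumes "z \<in> Field (A \<mu>)" "j < \<mu>"
  shows "p \<mu> j z \<in> Field (A j)" "i < j \<Longrightarrow> p \<mu> i z = p j i (p \<mu> j z)"
proof -
  have z: "thread z \<in> Field (inverse_limit A p \<mu>)" using bij_betwE[OF thread_bij] assms(1) by blast
  then show "p \<mu> j z \<in> Field (A j)" using assms(2) unfolding Field_inverse_limit by auto
  have "thread z i = p j i (thread z j)" if "i < j" using z assms(2) that unfolding Field_inverse_limit by blast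
  then show "p \<mu> i z = p j i (p \<mu> j z)" if "i < j" using that assms(2) order.strict_trans[OF that assms(2)] by simp
qed

lemma Linear_limit: "Linear_order (A \<mu>)"
proof (rule iso_imp_Linear_order[OF iso_thread])
  show "Linear_order (inverse_limit A p \<mu>)"
    unfolding inverse_limit_def by (rule Linear_order_lex_order) (use below regular_Linear in auto)
qed

interpretation L: lots "A \<mu>"
  using Linear_limit by unfold_locales

lemma limit_lt_iff:
  assumes "z \<in> Field (A \<mu>)" "w \<in> Field (A \<mu>)"
  shows "lt (A \<mu>) z w \<longleftrightarrow> (\<exists>i<\<mu>. (\<forall>j<i. p \<mu> j z = p \<mu> j w) \<and> lt (A i) (p \<mu> i z) (p \<mu> i w))"
proof -
  have "lt (A \<mu>) z w \<longleftrightarrow> lt (inverse_limit A p \<mu>) (thread z) (thread w)"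
    using iso_thread[unfolded iso_iff2] assms inj_onD[OF bij_betw_imp_inj_on[OF thread_bij] _ assms]
    unfolding lt_def by blast
  also have "\<dots> \<longleftrightarrow> (\<exists>i<\<mu>. (\<forall>j<i. thread z j = thread w j) \<and> lt (A i) (thread z i) (thread w i))"
    using bij_betwE[OF thread_bij] assms
    unfolding Field_inverse_limit unfolding inverse_limit_def lt_lex_order by blast
  also have "\<dots> \<longleftrightarrow> (\<exists>i<\<mu>. (\<forall>j<i. p \<mu> j z = p \<mu> j w) \<and> lt (A i) (p \<mu> i z) (p \<mu> i w))"
    by (intro ex_cong1 conj_cong refl) (auto intro: order.strict_trans)
  finally show ?thesis .
qed

text \<open>On threads the lexicographic order is coordinatewise: a strict inequality at the first
  difference persists at all later coordinates, since the projections between stages are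
  monotone.\<close>

lemma limit_mono:
  assumes zw: "(z, w) \<in> A \<mu>" and "i < \<mu>"
  shows "(p \<mu> i z, p \<mu> i w) \<in> A i"
proof -
  interpret i: lots "A i" using regular_lots[OF below[OF assms(2)]] .
  have F: "z \<in> Field (A \<mu>)" "w \<in> Field (A \<mu>)" using zw by (auto simp: Field_def)
  show ?thesis
  proof (cases "z = w")
    case True
    then show ?thesis using p_limit(1)[OF F(1) assms(2)] by simp
  next
    case False
    then have "lt (A \<mu>) z w" using zw by (simp add: lt_def)
    then obtain k where k: "k < \<mu>" "\<And>j. j < k \<Longrightarrow> p \<mu> j z = p \<mu> j w" "lt (A k) (p \<mu> k z) (p \<mu> k w)"
      using limit_lt_iff[OF F] by blast
    consider "i < k" | "i = k" | "k < i" by (rule linorder_cases)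
    then show ?thesis
    proof cases
      case 1
      then show ?thesis using k(2) p_limit(1)[OF F(1) assms(2)] by simp
    next
      case 2
      then show ?thesis using k(3) by (simp add: lt_imp_le)
    next
      case 3
      have "lt (A k) (p i k (p \<mu> i z)) (p i k (p \<mu> i w))"
        using k(3) p_limit(2)[OF F(1) assms(2) 3] p_limit(2)[OF F(2) assms(2) 3] by simp
      then have "lt (A i) (p \<mu> i z) (p \<mu> i w)"
        using projection_lt_cancel[OF projection_below[OF assms(2) 3] i.linear regular_Linear[OF below[OF k(1)]]]
          p_limit(1)[OF F(1) assms(2)] p_limit(1)[OF F(2) assms(2)] by blast
      then show ?thesis by (rule lt_imp_le)
    qed
  qed
qed

lemma limit_ltI:
  assumes F: "z \<in> Field (A \<mu>)" "w \<in> Field (A \<mu>)" and "i < \<mu>" "lt (A i) (p \<mu> i z) (p \<mu> i w)"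
  shows "lt (A \<mu>) z w"
proof -
  interpret i: lots "A i" using regular_lots[OF below[OF assms(3)]] .
  have "(w, z) \<notin> A \<mu>" using limit_mono[OF _ assms(3)] i.lt_asym[OF assms(4)] by blast
  then show ?thesis using L.not_le F by blast
qed

text \<open>A final part determines a thread; the coordinates before \<open>i\<^sub>0\<close> are
  the projections of \<open>f i\<^sub>0\<close>.\<close>

lemma limit_thread:
  assumes i0: "i\<^sub>0 < \<mu>" and f: "\<And>j. i\<^sub>0 \<le> j \<Longrightarrow> j < \<mu> \<Longrightarrow> f j \<in> Field (A j)"
    "\<And>j k. i\<^sub>0 \<le> k \<Longrightarrow> k < j \<Longrightarrow> j < \<mu> \<Longrightarrow> p j k (f j) = f k"
  shows "\<exists>z\<in>Field (A \<mu>). \<forall>j. i\<^sub>0 \<le> j \<longrightarrow> j < \<mu> \<longrightarrow> p \<mu> j z = f j"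
proof -
  define x where "x = (\<lambda>j\<in>{..<\<mu>}. if j < i\<^sub>0 then p i\<^sub>0 j (f i\<^sub>0) else f j)"
  have "x \<in> Field (inverse_limit A p \<mu>)"
    unfolding Field_inverse_limit
  proof (intro CollectI conjI allI impI)
    show "x \<in> (\<Pi>\<^sub>E i\<in>{..<\<mu>}. Field (A i))"
      unfolding x_def using f(1) projection_Field[OF projection_below[OF i0]] i0 by auto
    fix j i assume ij: "j < \<mu>" "i < j"
    consider "i\<^sub>0 \<le> i" | "i < i\<^sub>0" "i\<^sub>0 < j" | "j = i\<^sub>0" | "j < i\<^sub>0" using ij(2) by fastforce
    then show "x i = p j i (x j)"
    proof cases
      case 1
      then show ?thesis using ij f(2)[OF 1 ij(2,1)] by (auto simp: x_def)
    next
      case 2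
      then have "p j i (f j) = p i\<^sub>0 i (p j i\<^sub>0 (f j))" using p_below[OF ij(1) 2(2,1)] f(1)[of j] ij by simp
      then show ?thesis using 2 ij f(2)[of i\<^sub>0 j] by (auto simp: x_def)
    next
      case 3
      then show ?thesis using ij order.strict_trans[OF ij(2,1)] by (simp add: x_def)
    next
      case 4
      moreover have "i < \<mu>" "i < i\<^sub>0" using 4 ij by simp_all
      ultimately show ?thesis using ij p_below[OF i0 4 ij(2)] f(1)[of i\<^sub>0] i0 by (simp add: x_def)
    qed
  qed
  then have "x \<in> thread ` Field (A \<mu>)" using bij_betw_imp_surj_on[OF thread_bij] by simp
  then obtain z where z: "x = thread z" "z \<in> Field (A \<mu>)" by (rule imageE)
  have "p \<mu> j z = f j" if "i\<^sub>0 \<le> j" "j < \<mu>" for j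
    using fun_cong[OF z(1), of j] that by (simp add: x_def split: if_splits)
  then show ?thesis using z(2) by blast
qed

lemma limit_lift:
  assumes i0: "i\<^sub>0 < \<mu>" and f: "\<And>j. i\<^sub>0 \<le> j \<Longrightarrow> j < \<mu> \<Longrightarrow> strict_map (A j) (A j) (f j)"
    "\<And>j k z. i\<^sub>0 \<le> k \<Longrightarrow> k < j \<Longrightarrow> j < \<mu> \<Longrightarrow> z \<in> Field (A j) \<Longrightarrow> p j k (f j z) = f k (p j k z)"
  shows "\<exists>H. strict_map (A \<mu>) (A \<mu>) H \<and>
    (\<forall>j z. i\<^sub>0 \<le> j \<longrightarrow> j < \<mu> \<longrightarrow> z \<in> Field (A \<mu>) \<longrightarrow> p \<mu> j (H z) = f j (p \<mu> j z))"
proof -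
  have "\<forall>z\<in>Field (A \<mu>). \<exists>w. w \<in> Field (A \<mu>) \<and> (\<forall>j. i\<^sub>0 \<le> j \<longrightarrow> j < \<mu> \<longrightarrow> p \<mu> j w = f j (p \<mu> j z))"
  proof
    fix z assume z: "z \<in> Field (A \<mu>)"
    have "\<exists>w\<in>Field (A \<mu>). \<forall>j. i\<^sub>0 \<le> j \<longrightarrow> j < \<mu> \<longrightarrow> p \<mu> j w = f j (p \<mu> j z)"
    proof (rule limit_thread[OF i0])
      show "f j (p \<mu> j z) \<in> Field (A j)" if "i\<^sub>0 \<le> j" "j < \<mu>" for j
        using f(1)[OF that] p_limit(1)[OF z that(2)] by (auto simp: strict_map_def)
      show "p j k (f j (p \<mu> j z)) = f k (p \<mu> k z)" if "i\<^sub>0 \<le> k" "k < j" "j < \<mu>" for j k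
        using f(2)[OF that p_limit(1)[OF z that(3)]] p_limit(2)[OF z that(3,2)] by simp
    qed
    then show "\<exists>w. w \<in> Field (A \<mu>) \<and> (\<forall>j. i\<^sub>0 \<le> j \<longrightarrow> j < \<mu> \<longrightarrow> p \<mu> j w = f j (p \<mu> j z))" by blast
  qed
  from bchoice[OF this] obtain H where H: "\<And>z. z \<in> Field (A \<mu>) \<Longrightarrow> H z \<in> Field (A \<mu>)"
    "\<And>z j. z \<in> Field (A \<mu>) \<Longrightarrow> i\<^sub>0 \<le> j \<Longrightarrow> j < \<mu> \<Longrightarrow> p \<mu> j (H z) = f j (p \<mu> j z)"
    by blast
  have "lt (A \<mu>) (H z) (H w)" if zw: "lt (A \<mu>) z w" for z w
  proof -
    note F = lt_Field[OF zw]
    obtain i where i: "i < \<mu>" "lt (A i) (p \<mu> i z) (p \<mu> i w)" using limit_lt_iff[OF F] zw by blast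
    \<comment> \<open>Compatible maps are given from \<open>i\<^sub>0\<close> on, so a difference at
      an earlier coordinate is first carried up to \<open>m\<close>.\<close>
    define m where "m = max i i\<^sub>0"
    have m: "m < \<mu>" "i\<^sub>0 \<le> m" "i \<le> m" using i(1) i0 by (auto simp: m_def)
    have "lt (A m) (p \<mu> m z) (p \<mu> m w)"
    proof (cases "i = m")
      case False
      then have im: "i < m" using m(3) by simp
      show ?thesis
        using projection_lt_cancel[OF projection_below[OF m(1) im] regular_Linear[OF below[OF m(1)]]
            regular_Linear[OF below[OF i(1)]] p_limit(1)[OF F(1) m(1)] p_limit(1)[OF F(2) m(1)]]
          i(2) p_limit(2)[OF F(1) m(1) im] p_limit(2)[OF F(2) m(1) im] by simp
    qed (use i in simp)
    then have "lt (A m) (f m (p \<mu> m z)) (f m (p \<mu> m w))" using f(1)[OF m(2,1)] by (simp add: strict_map_def)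
    then show ?thesis using H F m by (intro limit_ltI[OF _ _ m(1)]) auto
  qed
  then have "strict_map (A \<mu>) (A \<mu>) H" using H(1) by (auto simp: strict_map_def)
  then show ?thesis using H(2) by blast
qed

end

text \<open>This yields surjectivity of the projections at limits. Preimages are chosen at
  successors and threads taken at limits. Outside the range from \<beta> to \<mu> the predicate
  \<open>P\<close> is void, so that the recursion can run over all of \<open>Omega\<close>.\<close>

lemma ex_thread_above:
  assumes all: "\<forall>i<\<mu>. regular i" and \<beta>: "\<beta> < \<mu>" and c: "c \<in> Field (A \<beta>)"
  shows "\<exists>f. f \<beta> = c \<and> (\<forall>j<\<mu>. \<beta> \<le> j \<longrightarrow> f j \<in> Field (A j) \<and> (\<forall>k<j. \<beta> \<le> k \<longrightarrow> p j k (f j) = f k))"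
proof -
  have reg: "regular i" if "i < \<mu>" for i using all that by blast
  define P where "P f j t \<longleftrightarrow> (\<beta> \<le> j \<longrightarrow> j < \<mu> \<longrightarrow> t \<in> Field (A j) \<and> (j = \<beta> \<longrightarrow> t = c) \<and>
    (\<forall>k<j. \<beta> \<le> k \<longrightarrow> p j k t = f k))" for f :: "Omega \<Rightarrow> 'a" and j t
  have "\<exists>f. \<forall>j. P f j (f j)"
  proof (rule dependent_wellorder_choice)
    show "P f j t = P g j t" if "\<And>k. k < j \<Longrightarrow> f k = g k" for t f g j
      using that by (simp add: P_def)
    fix j f assume IH: "\<And>k. k < j \<Longrightarrow> P f k (f k)"
    show "\<exists>t. P f j t"
    proof (cases "\<beta> < j \<and> j < \<mu>")
      case False
      then show ?thesis using c by (intro exI[of _ c]) (auto simp: P_def)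
    next
      case True
      have f: "f k \<in> Field (A k)" "\<And>l. l < k \<Longrightarrow> \<beta> \<le> l \<Longrightarrow> p k l (f k) = f l" if "\<beta> \<le> k" "k < j" for k
        using IH[OF that(2)] True that order.strict_trans[OF that(2), of \<mu>] by (auto simp: P_def)
      obtain t where t: "t \<in> Field (A j)" "\<And>k. k < j \<Longrightarrow> \<beta> \<le> k \<Longrightarrow> p j k t = f k"
      proof (cases j rule: ords_cases)
        case 1
        then show ?thesis using True by simp
      next
        case (2 k)
        have k: "\<beta> \<le> k" "k < j" using True 2 less_succ_ord succ_ord_greater by auto
        have j: "regular j" using reg True by blast
        then have "projection (A j) (A k) (p j k)" using k by (simp add: regular_def)
        then obtain t where t: "t \<in> Field (A j)" "p j k t = f k" using projection_surj f(1)[OF k] by metis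
        have "p j l t = f l" if "l < j" "\<beta> \<le> l" for l
          using that(1)[unfolded 2]
        proof (cases rule: less_succ_cases)
          case 1
          then show ?thesis using t(2) 2 by simp
        next
          case lk: 2
          then have "p j l t = p k l (p j k t)" using j k(2) t(1) by (simp add: regular_def)
          then show ?thesis using f(2)[OF k lk that(2)] t(2) 2 by simp
        qed
        then show ?thesis using that t(1) by blast
      next
        case 3
        have "\<forall>i<j. regular i" using reg True by (meson order.strict_trans)
        then have "\<exists>t\<in>Field (A j). \<forall>k. \<beta> \<le> k \<longrightarrow> k < j \<longrightarrow> p j k t = f k"
          by (rule limit_thread[OF 3]) (use True f in auto)
        then show ?thesis using that by blast
      qed
      then show ?thesis using True by (intro exI[of _ t]) (auto simp: P_def)
    qed
  qed
  then obtain f where f: "\<And>j. P f j (f j)" by blast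
  show ?thesis using f f[of \<beta>] \<beta> by (intro exI[of _ f]) (simp add: P_def)
qed

text \<open>The same recursion for maps, with \<open>pi_lift\<close> at successors and
  \<open>limit_lift\<close> at limits. The bound \<open>v\<close> is there because
  \<open>pi_lift\<close> asks for a bounded map at each stage.\<close>

lemma ex_lifts:
  assumes all: "\<forall>i<\<mu>. regular i" and \<beta>: "\<beta> < \<mu>"
    and h: "strict_map (A \<beta>) (A \<beta>) h" "\<And>a. a \<in> Field (A \<beta>) \<Longrightarrow> lt (A \<beta>) (h a) v"
  shows "\<exists>f. f \<beta> = h \<and> (\<forall>j<\<mu>. \<beta> \<le> j \<longrightarrow> strict_map (A j) (A j) (f j) \<and>
    (\<forall>k<j. \<beta> \<le> k \<longrightarrow> (\<forall>z\<in>Field (A j). p j k (f j z) = f k (p j k z))))"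
proof -
  have reg: "regular i" if "i < \<mu>" for i using all that by blast
  define P where "P f j H \<longleftrightarrow> (\<beta> \<le> j \<longrightarrow> j < \<mu> \<longrightarrow> strict_map (A j) (A j) H \<and> (j = \<beta> \<longrightarrow> H = h) \<and>
    (\<forall>k<j. \<beta> \<le> k \<longrightarrow> (\<forall>z\<in>Field (A j). p j k (H z) = f k (p j k z))))"
    for f :: "Omega \<Rightarrow> 'a \<Rightarrow> 'a" and j H
  have "\<exists>f. \<forall>j. P f j (f j)"
  proof (rule dependent_wellorder_choice)
    show "P f j t = P g j t" if "\<And>k. k < j \<Longrightarrow> f k = g k" for t f g j
      using that by (simp add: P_def)
    fix j f assume IH: "\<And>k. k < j \<Longrightarrow> P f k (f k)"
    show "\<exists>t. P f j t"
    proof (cases "\<beta> < j \<and> j < \<mu>")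
      case False
      then show ?thesis using h(1) by (intro exI[of _ h]) (auto simp: P_def)
    next
      case True
      have f: "strict_map (A k) (A k) (f k)" "k = \<beta> \<Longrightarrow> f k = h"
        "\<And>l z. l < k \<Longrightarrow> \<beta> \<le> l \<Longrightarrow> z \<in> Field (A k) \<Longrightarrow> p k l (f k z) = f l (p k l z)"
        if "\<beta> \<le> k" "k < j" for k
        using IH[OF that(2)] True that order.strict_trans[OF that(2), of \<mu>] by (auto simp: P_def)
      obtain H where H: "strict_map (A j) (A j) H"
        "\<And>k z. k < j \<Longrightarrow> \<beta> \<le> k \<Longrightarrow> z \<in> Field (A j) \<Longrightarrow> p j k (H z) = f k (p j k z)"
      proof (cases j rule: ords_cases)
        case 1
        then show ?thesis using True by simp
      next
        case (2 k)
        have k: "\<beta> \<le> k" "k < j" using True 2 less_succ_ord succ_ord_greater by auto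
        have reg_k: "regular k" "regular \<beta>" using reg True k(2) \<beta> by (meson order.strict_trans)+
        \<comment> \<open>Any point over \<open>v\<close> bounds \<open>f k\<close>: the projection
          of \<open>f k a\<close> to stage \<beta> is a value of \<open>h\<close>, hence below
          \<open>v\<close>.\<close>
        have "\<exists>w. \<forall>a\<in>Field (A k). lt (A k) (f k a) w"
        proof (cases "k = \<beta>")
          case True
          then show ?thesis using f(2)[OF k True] h(2) by auto
        next
          case False
          then have \<beta>k: "\<beta> < k" using k(1) by simp
          then have proj: "projection (A k) (A \<beta>) (p k \<beta>)" using reg_k by (simp add: regular_def)
          obtain a where "a \<in> Field (A \<beta>)"
            using reg_k(2) continuum.nonempty unfolding regular_def by blast
          then have "v \<in> Field (A \<beta>)" using h(2) lt_Field(2) by metis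
          then obtain w where w: "w \<in> Field (A k)" "p k \<beta> w = v" using projection_surj[OF proj] by metis
          have "lt (A k) (f k a) w" if a: "a \<in> Field (A k)" for a
          proof (rule projection_lt_cancel[OF proj regular_Linear[OF reg_k(1)] regular_Linear[OF reg_k(2)] _ w(1)])
            show "f k a \<in> Field (A k)" using f(1)[OF k] a by (auto simp: strict_map_def)
            have "p k \<beta> (f k a) = h (p k \<beta> a)" using f(3)[OF k \<beta>k _ a] f(2)[of \<beta>] True by simp
            then show "lt (A \<beta>) (p k \<beta> (f k a)) (p k \<beta> w)"
              using h(2) projection_Field[OF proj a] w(2) by simp
          qed
          then show ?thesis by blast
        qed
        then obtain w where w: "\<And>a. a \<in> Field (A k) \<Longrightarrow> lt (A k) (f k a) w" by blast
        obtain e where "branch_completion (A k) (A j) e (p j k)"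
          using succ_completion[OF reg_k(1)] 2 by blast
        then interpret branch_completion "A k" "A j" e "p j k" .
        obtain H where H: "strict_map (A j) (A j) H" "\<forall>z\<in>Field (A j). p j k (H z) = f k (p j k z)"
          using pi_lift[OF f(1)[OF k] w] by blast
        have "p j l (H z) = f l (p j l z)" if "l < j" "\<beta> \<le> l" and z: "z \<in> Field (A j)" for l z
          using that(1)[unfolded 2]
        proof (cases rule: less_succ_cases)
          case 1
          then show ?thesis using H(2) z 2 by simp
        next
          case lk: 2
          have "p j l w = p k l (p j k w)" if "w \<in> Field (A j)" for w using p_succ[OF lk] that 2 by simp
          moreover have "H z \<in> Field (A j)" using H(1) z by (auto simp: strict_map_def)
          ultimately show ?thesis using f(3)[OF k lk that(2) pi_Field[OF z]] H(2) z 2 by simp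
        qed
        then show ?thesis using that H(1) by blast
      next
        case 3
        have "\<forall>i<j. regular i" using reg True by (meson order.strict_trans)
        then have "\<exists>H. strict_map (A j) (A j) H \<and>
            (\<forall>k z. \<beta> \<le> k \<longrightarrow> k < j \<longrightarrow> z \<in> Field (A j) \<longrightarrow> p j k (H z) = f k (p j k z))"
          by (rule limit_lift[OF 3]) (use True f in auto)
        then show ?thesis using that by blast
      qed
      then show ?thesis using True by (intro exI[of _ H]) (auto simp: P_def)
    qed
  qed
  then obtain f where f: "\<And>j. P f j (f j)" by blast
  show ?thesis using f f[of \<beta>] \<beta> by (intro exI[of _ f]) (simp add: P_def)
qed

lemma regular_limit:
  assumes \<mu>: "limit_ord \<mu>" and all: "\<forall>i<\<mu>. regular i"
  shows "regular \<mu>"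
proof -
  have reg: "regular i" if "i < \<mu>" for i using all that by blast
  note Lin = Linear_limit[OF \<mu> all] and F = p_limit(1)[OF \<mu> all] and mono = limit_mono[OF \<mu> all]
  note ltI = limit_ltI[OF \<mu> all]
  interpret lots "A \<mu>" using Lin by unfold_locales
  have surj: "\<exists>z\<in>Field (A \<mu>). p \<mu> \<beta> z = c" if \<beta>: "\<beta> < \<mu>" "c \<in> Field (A \<beta>)" for \<beta> c
  proof -
    obtain f where f: "f \<beta> = c" "\<And>j. j < \<mu> \<Longrightarrow> \<beta> \<le> j \<Longrightarrow> f j \<in> Field (A j)"
      "\<And>j k. j < \<mu> \<Longrightarrow> \<beta> \<le> j \<Longrightarrow> k < j \<Longrightarrow> \<beta> \<le> k \<Longrightarrow> p j k (f j) = f k"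
      using ex_thread_above[OF all \<beta>] by blast
    have "\<exists>z\<in>Field (A \<mu>). \<forall>j. \<beta> \<le> j \<longrightarrow> j < \<mu> \<longrightarrow> p \<mu> j z = f j"
      using limit_thread[OF \<mu> all \<beta>(1), of f] f by simp
    then show ?thesis using f(1) \<beta>(1) by blast
  qed
  have proj: "projection (A \<mu>) (A \<beta>) (p \<mu> \<beta>)" if "\<beta> < \<mu>" for \<beta>
    unfolding projection_def
  proof (intro conjI allI impI equalityI subsetI)
    show "c \<in> p \<mu> \<beta> ` Field (A \<mu>)" if "c \<in> Field (A \<beta>)" for c using surj[OF \<open>\<beta> < \<mu>\<close> that] by blast
  qed (use mono F that in auto)
  have cont: "continuum (A i)" if "i < \<mu>" for i using reg[OF that] by (simp add: regular_def)
  have 0: "0 < \<mu>" using \<mu> by (simp add: limit_ord_def zero_ords_less)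
  interpret zero: continuum "A 0" using cont[OF 0] .
  have "continuum (A \<mu>)"
  proof unfold_locales
    show "Field (A \<mu>) \<noteq> {}" using zero.nonempty surj[OF 0] by blast
    show "\<exists>b. lt (A \<mu>) a b" if a: "a \<in> Field (A \<mu>)" for a
    proof -
      obtain c where c: "lt (A 0) (p \<mu> 0 a) c" using zero.no_max F[OF a 0] by blast
      obtain z where "z \<in> Field (A \<mu>)" "p \<mu> 0 z = c" using surj[OF 0 lt_Field(2)[OF c]] by blast
      then show ?thesis using ltI[OF a _ 0] c by blast
    qed
    show "\<exists>b. lt (A \<mu>) b a" if a: "a \<in> Field (A \<mu>)" for a
    proof -
      obtain c where c: "lt (A 0) c (p \<mu> 0 a)" using zero.no_min F[OF a 0] by blast
      obtain z where "z \<in> Field (A \<mu>)" "p \<mu> 0 z = c" using surj[OF 0 lt_Field(1)[OF c]] by blast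
      then show ?thesis using ltI[OF _ a 0] c by blast
    qed
    fix S b assume S: "S \<subseteq> Field (A \<mu>)" "S \<noteq> {}" and b: "b \<in> Field (A \<mu>)" "\<And>a. a \<in> S \<Longrightarrow> (a, b) \<in> A \<mu>"
    \<comment> \<open>Suprema are taken coordinatewise; by \<open>projection_sup\<close> the
      projections preserve them, so they form a thread.\<close>
    have "\<forall>i\<in>{..<\<mu>}. \<exists>s. is_sup (A i) (p \<mu> i ` S) s"
    proof
      fix i assume "i \<in> {..<\<mu>}"
      then have i: "i < \<mu>" by simp
      show "\<exists>s. is_sup (A i) (p \<mu> i ` S) s"
        by (rule continuum.bounded_sup[OF cont[OF i], of _ "p \<mu> i b"]) (use S b F[OF _ i] mono[OF _ i] in auto)
    qed
    from bchoice[OF this] obtain s where s: "\<And>i. i < \<mu> \<Longrightarrow> is_sup (A i) (p \<mu> i ` S) (s i)" by blast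
    have s_Field: "s i \<in> Field (A i)" if "i < \<mu>" for i
      using lots.sup_Field[OF regular_lots[OF reg[OF that]] s[OF that]] .
    have "p j k (s j) = s k" if "k < j" "j < \<mu>" for j k
    proof -
      have k: "k < \<mu>" using that by simp
      have "projection (A j) (A k) (p j k)" using reg[OF that(2)] that(1) by (simp add: regular_def)
      from continuum.projection_sup[OF cont[OF k] this regular_Linear[OF reg[OF that(2)]] s[OF that(2)]]
      have "is_sup (A k) (p j k ` p \<mu> j ` S) (p j k (s j))" using S(1) F[OF _ that(2)] by blast
      moreover have "p j k ` p \<mu> j ` S = p \<mu> k ` S"
        unfolding image_image using p_limit(2)[OF \<mu> all _ that(2,1)] S(1) by (intro image_cong) auto
      ultimately show ?thesis using lots.sup_unique[OF regular_lots[OF reg[OF k]]] s[OF k] by simp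
    qed
    then obtain z where z: "z \<in> Field (A \<mu>)" "\<And>i. i < \<mu> \<Longrightarrow> p \<mu> i z = s i"
      using limit_thread[OF \<mu> all 0, of s] s_Field by auto
    have "(a, z) \<in> A \<mu>" if a: "a \<in> S" for a
    proof (rule ccontr)
      assume "(a, z) \<notin> A \<mu>"
      then have "lt (A \<mu>) z a" using not_le S(1) a z(1) by blast
      then obtain i where i: "i < \<mu>" "lt (A i) (p \<mu> i z) (p \<mu> i a)"
        using limit_lt_iff[OF \<mu> all z(1)] S(1) a by blast
      interpret i: lots "A i" using regular_lots[OF reg[OF i(1)]] .
      have "(p \<mu> i a, s i) \<in> A i" using i.sup_upper[OF s[OF i(1)]] a by blast
      then show False using i.lt_asym[OF i(2)] z(2)[OF i(1)] by simp
    qed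
    moreover have "(z, c) \<in> A \<mu>" if c: "c \<in> Field (A \<mu>)" "\<And>a. a \<in> S \<Longrightarrow> (a, c) \<in> A \<mu>" for c
    proof (rule ccontr)
      assume "(z, c) \<notin> A \<mu>"
      then have "lt (A \<mu>) c z" using not_le c z(1) by blast
      then obtain i where i: "i < \<mu>" "lt (A i) (p \<mu> i c) (p \<mu> i z)"
        using limit_lt_iff[OF \<mu> all c(1) z(1)] by blast
      interpret i: lots "A i" using regular_lots[OF reg[OF i(1)]] .
      have "(s i, p \<mu> i c) \<in> A i"
        by (rule i.sup_least[OF s[OF i(1)] F[OF c(1) i(1)]]) (use mono[OF _ i(1)] c(2) in auto)
      then show False using i.lt_asym[OF i(2)] z(2)[OF i(1)] by simp
    qed
    ultimately show "\<exists>s. is_sup (A \<mu>) S s" using z(1) by (auto simp: is_sup_def Above_def)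
  next
    fix u v assume uv: "lt (A \<mu>) u v"
    note uvF = lt_Field[OF uv]
    obtain i where i: "i < \<mu>" "lt (A i) (p \<mu> i u) (p \<mu> i v)"
      using limit_lt_iff[OF \<mu> all uvF] uv by blast
    \<comment> \<open>The points \<open>u\<close> and \<open>v\<close> are already separated at
      stage i. A self-map of that stage between their projections is lifted, and a point projecting
      strictly between them lies strictly between \<open>u\<close> and \<open>v\<close>.\<close>
    obtain h where h: "strict_map (A i) (A i) h"
      "\<And>a. a \<in> Field (A i) \<Longrightarrow> lt (A i) (p \<mu> i u) (h a) \<and> lt (A i) (h a) (p \<mu> i v)"
      using continuum.self_map[OF cont[OF i(1)] i(2)] by blast
    obtain f where f: "f i = h" "\<And>j. j < \<mu> \<Longrightarrow> i \<le> j \<Longrightarrow> strict_map (A j) (A j) (f j)"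
      "\<And>j k z. j < \<mu> \<Longrightarrow> i \<le> j \<Longrightarrow> k < j \<Longrightarrow> i \<le> k \<Longrightarrow> z \<in> Field (A j) \<Longrightarrow> p j k (f j z) = f k (p j k z)"
      using ex_lifts[OF all i(1) h(1), of "p \<mu> i v"] h(2) by auto
    obtain H where H: "strict_map (A \<mu>) (A \<mu>) H"
      "\<And>j z. i \<le> j \<Longrightarrow> j < \<mu> \<Longrightarrow> z \<in> Field (A \<mu>) \<Longrightarrow> p \<mu> j (H z) = f j (p \<mu> j z)"
      using limit_lift[OF \<mu> all i(1), of f] f by auto
    have "lt (A \<mu>) u (H z) \<and> lt (A \<mu>) (H z) v" if z: "z \<in> Field (A \<mu>)" for z
    proof -
      have "H z \<in> Field (A \<mu>)" using H(1) z by (auto simp: strict_map_def)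
      moreover have "p \<mu> i (H z) = h (p \<mu> i z)" using H(2)[OF _ i(1) z] f(1) by simp
      ultimately show ?thesis using ltI[OF _ _ i(1)] uvF h(2) F[OF z i(1)] by simp
    qed
    then show "\<exists>f. strict_map (A \<mu>) (A \<mu>) f \<and> (\<forall>x\<in>Field (A \<mu>). lt (A \<mu>) u (f x) \<and> lt (A \<mu>) (f x) v)"
      using H(1) by blast
  qed
  then show ?thesis unfolding regular_def using proj p_limit(2)[OF \<mu> all] by blast
qed

lemma regular: "regular \<alpha>"
proof (induction \<alpha> rule: less_induct)
  case (less \<alpha>)
  show ?case
  proof (cases \<alpha> rule: ords_cases)
    case 1
    then show ?thesis using X tower by (simp add: regular_def a_tower_def)
  next
    case (2 j)
    then show ?thesis using less regular_succ succ_ord_greater by blast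
  next
    case 3
    then show ?thesis using less regular_limit by blast
  qed
qed

lemma tower_map:
  assumes "\<alpha> \<le> \<alpha>'"
  shows "\<exists>f. strict_map (A \<alpha>) (A \<alpha>') f"
proof (cases "\<alpha> = \<alpha>'")
  case True
  then show ?thesis by (intro exI[of _ id]) (simp add: strict_map_def)
next
  case False
  then have "projection (A \<alpha>') (A \<alpha>) (p \<alpha>' \<alpha>)" using regular[of \<alpha>'] assms by (simp add: regular_def)
  then show ?thesis by (rule projection_section) (use regular regular_Linear in blast)+
qed

end

theorem theorem1p4:
  fixes X :: "'a rel"
    and A :: "Omega \<Rightarrow> 'a rel"
    and p :: "Omega \<Rightarrow> Omega \<Rightarrow> 'a \<Rightarrow> 'a"
    and \<alpha> \<beta> \<alpha>' \<beta>' :: Omega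
    and u v u' v' :: 'a
  assumes "CHLOTS X"
    and "a_tower X A p"
    and "0 < \<beta>" and "0 < \<beta>'"
    and "((\<alpha>, \<beta>), (\<alpha>', \<beta>')) \<in> {(i, j). i < j} <*lex*> {(i, j). i < j}"
    and "(u, v) \<in> A \<alpha> - Id" and "(u', v') \<in> A \<alpha>' - Id"
  shows "bigger (lex_power (A \<alpha>') u' v' \<beta>') (lex_power (A \<alpha>) u v \<beta>)"
proof -
  interpret tower X A p
    by (rule tower.intro[OF CHLOTS_continuum[OF assms(1)] assms(2)])
  let ?L = "lex_power (A \<alpha>) u v \<beta>" and ?L' = "lex_power (A \<alpha>') u' v' \<beta>'"
  interpret A: continuum "A \<alpha>" using regular[of \<alpha>] by (simp add: regular_def)
  interpret A': continuum "A \<alpha>'" using regular[of \<alpha>'] by (simp add: regular_def)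
  have uv: "lt (A \<alpha>) u v" and uv': "lt (A \<alpha>') u' v'" using assms(6,7) by (simp_all add: lt_def)
  have "(\<exists>f. strict_map ?L ?L' f) \<and> \<not> (\<exists>f. strict_map ?L' ?L f)"
  proof (cases "\<alpha> = \<alpha>'")
    case True
    then have "\<beta> < \<beta>'" using assms(5) by simp
    have "\<exists>f. strict_map ?L ?L' f"
      using A'.lex_power_mono[OF uv', of \<beta> \<beta>' u v] \<open>\<beta> < \<beta>'\<close> True by simp
    moreover have "\<not> strict_map ?L' ?L f" for f
      using A.not_lex_power_map[OF uv _ \<open>\<beta> < \<beta>'\<close>, of u' v' f] uv' True by simp
    ultimately show ?thesis by blast
  next
    case False
    then have "\<alpha> < \<alpha>'" using assms(5) by simp
    then have "succ_ord \<alpha> \<le> \<alpha>'" unfolding succ_ord_def by (rule Least_le)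
    then obtain f where f: "strict_map (A (succ_ord \<alpha>)) (A \<alpha>') f" using tower_map by blast
    obtain g where g: "strict_map (A \<alpha>') ?L' g" using A'.map_into_lex_power[OF uv' assms(4)] by blast
    obtain e where "branch_completion (A \<alpha>) (A (succ_ord \<alpha>)) e (p (succ_ord \<alpha>) \<alpha>)"
      using succ_completion[OF regular] by blast
    then interpret branch_completion "A \<alpha>" "A (succ_ord \<alpha>)" e "p (succ_ord \<alpha>) \<alpha>" .
    \<comment> \<open>Every countable length \<delta> is allowed: length \<beta> gives the required
      embedding, and the successor of \<beta> the contradiction with
      \<open>not_lex_power_map\<close>.\<close>
    have map: "\<exists>h. strict_map (lex_power (A \<alpha>) u v \<delta>) ?L' h" if "0 < \<delta>" for \<delta> :: Omega
      using lex_power_map[OF countable_below_Omega that, of u v] strict_map_comp[OF strict_map_comp[OF _ f] g] by blast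
    have "\<not> strict_map ?L' ?L k" for k
    proof
      assume k: "strict_map ?L' ?L k"
      have \<beta>: "\<beta> < succ_ord \<beta>" by (rule succ_ord_greater)
      then obtain h where h: "strict_map (lex_power (A \<alpha>) u v (succ_ord \<beta>)) ?L' h"
        using map assms(3) by (meson order.strict_trans)
      show False using A.not_lex_power_map[OF uv uv \<beta>] strict_map_comp[OF h k] by blast
    qed
    then show ?thesis using map[OF assms(3)] by blast
  qed
  moreover have L: "Linear_order ?L" and L': "Linear_order ?L'"
    by (rule A.Linear_order_lex_power, rule A'.Linear_order_lex_power)
  ultimately show ?thesis
    unfolding bigger_def
    by (simp only: lots.strict_map_iff_order_map_inj[OF lots.intro[OF L] L']
        lots.strict_map_iff_order_map_inj[OF lots.intro[OF L'] L] simp_thms)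
qed

end
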